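(* Let $\lambda>0$, $\alpha>-2$, $p>0$, $\beta=\frac{\alpha+2}{p+1}$. Consider global solutions, i.e. functions $u$ with $u\in C^2(\mathbb{R}^2\setminus\{0\})$ satisfying $$\Delta u=\frac{\lambda|x|^\alpha}{u^p}\ \text{ in }\mathbb{R}^2\setminus\{0\},\qquad u(0)=0,\quad u>0\ \text{ in }\mathbb{R}^2\setminus\{0\},\tag{a}$$ and the condition that there are constants $C_1,C_2$ (possibly depending on $u$) such that $$0<C_1\le r^{-\frac{\alpha+2}{p+1}}u(r,\theta)\le C_2<\infty\quad\text{for all }(r,\theta)\in(0,\infty)\times S^1,\tag{b}$$ where $(r,\theta)$ are polar coordinates. (1) If $(\alpha,p)\in\mathscr{M}$, then $u(r,\theta)=\big(\frac{\lambda}{\beta^2}\big)^{\frac1{p+1}}r^{\frac{\alpha+2}{p+1}}$ is the unique global solution of (a) that satisfies (b). (2) If $p=3$ and $\alpha\in\{0,2,4,\dots\}$, then $u$ is a global solution of (a) that satisfies (b) if and only if $u(r,\theta)=r^{\frac{\alpha+2}{p+1}}w_{\epsilon,a}(\theta)$ for some $(\epsilon,a)\in(0,1]\times[0,\pi/\beta)$, where $$w_{\epsilon,a}(\theta)=\Big(\frac{\lambda}{\beta^2}\Big)^{\frac14}\Big[\epsilon\cos^2(\beta(\theta+a))+\epsilon^{-1}\sin^2(\beta(\theta+a))\Big]^{\frac12}.$$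
   Context: $S^1=\mathbb{R}/2\pi\mathbb{Z}$. $\mathscr{M}=\mathscr{M}_1\cup\mathscr{M}_2\cup\mathscr{M}_3\cup\mathscr{M}_4$ with $$\mathscr{M}_1=\Big\{(\alpha,p):\alpha>-2,\ 0<p<1,\ \text{and either } \alpha\le-1 \text{ or there is an integer } j\ge1 \text{ with } \alpha\le j-1 \text{ and } p\le\big(\tfrac{\alpha+2}{j}\big)^2-1\Big\},$$ $$\mathscr{M}_2=\Big\{(\alpha,p):\alpha>-2,\ 1\le p<3,\ \text{and either } p\ge2\alpha+3 \text{ or there is an integer } j\ge1 \text{ with } \tfrac{2(\alpha+2)}{j+1}-1\le p\le\big(\tfrac{\alpha+2}{j}\big)^2-1\Big\},$$ $$\mathscr{M}_3=\{(\alpha,3):\alpha>-2,\ \alpha\notin\{0,2,4,\dots\}\},$$ $$\mathscr{M}_4=\Big\{(\alpha,p):\alpha>-2,\ p>3,\ \text{and either } p\ge(\alpha+2)^2-1 \text{ or there is an integer } j\ge1 \text{ with } \big(\tfrac{\alpha+2}{j+1}\big)^2-1\le p\le\tfrac{2(\alpha+2)}{j}-1\Big\}.$$ *)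

theory Defs
  imports "HOL-Analysis.Analysis"
begin

text \<open>
  On an open set \<open>S\<close> this is the usual class $C^k(S)$: the function is differentiable on \<open>S\<close> and
  all its directional derivatives are of class $C^{k-1}$.
\<close>

primrec Ck_on :: "nat \<Rightarrow> 'a::euclidean_space set \<Rightarrow> ('a \<Rightarrow> real) \<Rightarrow> bool" where
  "Ck_on 0 S u \<longleftrightarrow> continuous_on S u"
| "Ck_on (Suc k) S u \<longleftrightarrow>
     (\<forall>x\<in>S. u differentiable (at x)) \<and>
     (\<forall>v. Ck_on k S (\<lambda>x. frechet_derivative u (at x) v))"

definition laplacian :: "('a::euclidean_space \<Rightarrow> real) \<Rightarrow> 'a \<Rightarrow> real" where
  "laplacian u x =
     (\<Sum>i\<in>Basis. frechet_derivative (\<lambda>y. frechet_derivative u (at y) i) (at x) i)"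

definition polar :: "real \<Rightarrow> real \<Rightarrow> real ^ 2" where
  "polar r \<theta> = vector [r * cos \<theta>, r * sin \<theta>]"

definition global_solution :: "real \<Rightarrow> real \<Rightarrow> real \<Rightarrow> (real ^ 2 \<Rightarrow> real) \<Rightarrow> bool" where
  "global_solution lam \<alpha> p u \<longleftrightarrow>
     Ck_on 2 (- {0}) u \<and>
     (\<forall>x. x \<noteq> 0 \<longrightarrow> laplacian u x = lam * norm x powr \<alpha> / u x powr p) \<and>
     u 0 = 0 \<and>
     (\<forall>x. x \<noteq> 0 \<longrightarrow> u x > 0)"

text \<open>Functions of an angle in $S^1 = \mathbb{R}/2\pi\mathbb{Z}$ are written as functions of a real \<open>\<theta>\<close>.\<close>

definition two_sided_bound :: "real \<Rightarrow> real \<Rightarrow> (real ^ 2 \<Rightarrow> real) \<Rightarrow> bool" where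
  "two_sided_bound \<alpha> p u \<longleftrightarrow>
     (\<exists>C1 C2. 0 < C1 \<and>
        (\<forall>r>0. \<forall>\<theta>. C1 \<le> r powr (- ((\<alpha> + 2) / (p + 1))) * u (polar r \<theta>) \<and>
                    r powr (- ((\<alpha> + 2) / (p + 1))) * u (polar r \<theta>) \<le> C2))"

definition \<M>\<^sub>1 :: "(real \<times> real) set" where
  "\<M>\<^sub>1 = {(\<alpha>, p). \<alpha> > -2 \<and> 0 < p \<and> p < 1 \<and>
     (\<alpha> \<le> -1 \<or>
      (\<exists>j::int. j \<ge> 1 \<and> \<alpha> \<le> real_of_int j - 1 \<and> p \<le> ((\<alpha> + 2) / real_of_int j)\<^sup>2 - 1))}"

definition \<M>\<^sub>2 :: "(real \<times> real) set" where
  "\<M>\<^sub>2 = {(\<alpha>, p). \<alpha> > -2 \<and> 1 \<le> p \<and> p < 3 \<and>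
     (p \<ge> 2 * \<alpha> + 3 \<or>
      (\<exists>j::int. j \<ge> 1 \<and> 2 * (\<alpha> + 2) / (real_of_int j + 1) - 1 \<le> p \<and>
                p \<le> ((\<alpha> + 2) / real_of_int j)\<^sup>2 - 1))}"

definition \<M>\<^sub>3 :: "(real \<times> real) set" where
  "\<M>\<^sub>3 = {(\<alpha>, p). \<alpha> > -2 \<and> p = 3 \<and> \<alpha> \<notin> {2 * real k | k::nat. True}}"

definition \<M>\<^sub>4 :: "(real \<times> real) set" where
  "\<M>\<^sub>4 = {(\<alpha>, p). \<alpha> > -2 \<and> p > 3 \<and>
     (p \<ge> (\<alpha> + 2)\<^sup>2 - 1 \<or>
      (\<exists>j::int. j \<ge> 1 \<and> ((\<alpha> + 2) / (real_of_int j + 1))\<^sup>2 - 1 \<le> p \<and>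
                p \<le> 2 * (\<alpha> + 2) / real_of_int j - 1))}"

definition \<M> :: "(real \<times> real) set" where
  "\<M> = \<M>\<^sub>1 \<union> \<M>\<^sub>2 \<union> \<M>\<^sub>3 \<union> \<M>\<^sub>4"

definition w_profile :: "real \<Rightarrow> real \<Rightarrow> real \<Rightarrow> real \<Rightarrow> real \<Rightarrow> real" where
  "w_profile lam \<beta> \<epsilon> a \<theta> =
     (lam / \<beta>\<^sup>2) powr (1 / 4) *
     sqrt (\<epsilon> * (cos (\<beta> * (\<theta> + a)))\<^sup>2 + inverse \<epsilon> * (sin (\<beta> * (\<theta> + a)))\<^sup>2)"

end

theory Submission
  imports Defs "HOL-Complex_Analysis.Great_Picard"
begin

text \<open>Write \<open>\<beta> = (\<alpha> + 2) / (p + 1)\<close> and pass to logarithmic polar coordinates: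
\<open>u (r, \<theta>) = r\<^sup>\<beta> v (ln r, \<theta>)\<close>. The equation becomes autonomous on the cylinder
\<open>\<real> \<times> S\<^sup>1\<close>,
  \[ v_{tt} + 2 \beta v_t + v_{\theta\theta} + g(v) = 0, \qquad g(y) = \beta^2 y - \lambda y^{-p}, \]
and the two-sided bound says precisely that \<open>v\<close> takes values in a compact subinterval of
\<open>(0, \<infinity>)\<close>. Two independent arguments give the theorem.

\<^bold>\<open>Bounded entire solutions do not depend on \<open>t\<close>.\<close> With \<open>G' = g\<close>, the energy
\<open>E (t) = \<integral> (v\<^sub>t\<^sup>2 - v\<^sub>\<theta>\<^sup>2) / 2 + G (v) d\<theta>\<close> satisfies
\<open>E' = -2 \<beta> \<integral> v\<^sub>t\<^sup>2 d\<theta> \<le> 0\<close>. Testing the equation with \<open>v\<close> and averaging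
in \<open>t\<close> against a bump shows that \<open>E\<close> is bounded on the whole line, so
\<open>v\<^sub>t\<close> is square integrable on the cylinder. Hence the averages of \<open>v\<close> over the windows
\<open>[s - 1, s + 1]\<close> solve \<open>w'' + g (w) = 0\<close> up to an error that vanishes as
\<open>s \<rightarrow> \<plusminus>\<infinity>\<close>, and subsequences converge to \<open>2\<pi>\<close>-periodic solutions of that
ordinary differential equation. The virial identity eliminates \<open>v\<^sub>\<theta>\<close> from \<open>E\<close>, so that both limits
of \<open>E\<close> are values of \<open>\<integral> G (w) - w g (w) / 2 d\<theta>\<close> at such profiles \<open>w\<close>. If all profiles
give the same value, then \<open>E\<close> is constant and \<open>v\<^sub>t = 0\<close> (lemma \<open>stationary\<close>).
The averages replace elliptic regularity: they are uniformly Lipschitz in \<open>\<theta>\<close>, which is what the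
theorem of Arzela and Ascoli asks for.

\<^bold>\<open>The profiles.\<close> Let \<open>w\<close> be a nonconstant \<open>2\<pi>\<close>-periodic solution of \<open>w'' + g (w) = 0\<close>. It
oscillates symmetrically, so the distance between consecutive zeros of \<open>w'\<close> is \<open>\<pi> / n\<close> for an integer
\<open>n \<ge> 1\<close>. For every real \<open>q\<close> the function \<open>y = w\<^sup>q w'\<close> has the same zeros and solves a linear
equation \<open>y'' + Q y = 0\<close> with
  \[ Q = (3q+1)\beta^2 - (3q-p)\lambda w^{-p-1} - q(q-1)(w'/w)^2 . \]
Three exponents give a \<open>Q\<close> that can be compared with a constant: \<open>q = 1\<close> with \<open>4 \<beta>\<^sup>2\<close>,
\<open>q = p/3\<close> with \<open>\<beta>\<^sup>2 (p + 1)\<close>, and, for \<open>p < 1\<close>, \<open>q = p\<close> with \<open>\<beta>\<^sup>2 (p + 1)\<^sup>2\<close>. Sturm comparison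
then places \<open>n\<close> strictly between explicit bounds (lemma \<open>steady_frequency\<close>), and the inequalities
defining \<open>\<M>\<close> for \<open>p \<noteq> 3\<close> say that no integer lies there. So all profiles are constant, which proves
uniqueness on those parts of \<open>\<M>\<close>.

For \<open>p = 3\<close> the profile equation is the Ermakov-Pinney equation. Uniqueness for the initial value
problem at a minimum identifies every profile with some \<open>w_profile\<close>; a nonconstant one is
\<open>2\<pi>\<close>-periodic only if \<open>2\<beta> = (\<alpha> + 2) / 2\<close> is an integer, that is, if \<open>\<alpha>\<close> is an even nonnegative
integer. In that case \<open>\<integral> G (w) - w g (w) / 2 = \<lambda> \<integral> w\<^sup>-\<^sup>2\<close> has the same value for the whole family,
so the first argument applies again. Conversely, for integral \<open>n = 2\<beta>\<close> the square of
\<open>r\<^sup>\<beta> w_profile\<close> is a combination of \<open>|z|\<^sup>n\<close>, \<open>Re z\<^sup>n\<close> and \<open>Im z\<^sup>n\<close>, hence smooth away from the origin.\<close>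

section \<open>Autonomous second-order equations and their periodic solutions\<close>

text \<open>The equation \<open>w'' = - g (w)\<close> on the whole line; the derivative \<open>w'\<close> is a parameter of its own, which
makes it available as phase-space coordinate and as initial value.\<close>

definition solves_ode :: "(real \<Rightarrow> real) \<Rightarrow> (real \<Rightarrow> real) \<Rightarrow> (real \<Rightarrow> real) \<Rightarrow> bool" where
  "solves_ode g w w' \<longleftrightarrow>
     (\<forall>x. (w has_real_derivative w' x) (at x) \<and> (w' has_real_derivative - g (w x)) (at x))"

lemma solves_odeD:
  assumes "solves_ode g w w'"
  shows "(w has_real_derivative w' x) (at x)" "(w' has_real_derivative - g (w x)) (at x)"
  using assms by (auto simp: solves_ode_def)

lemma solves_ode_continuous:
  assumes "solves_ode g w w'"
  shows "continuous_on S w" "continuous_on S w'"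
  using solves_odeD[OF assms] by (meson DERIV_isCont continuous_at_imp_continuous_on)+

text \<open>A Gronwall argument: the squared distance \<open>D\<close> in the phase plane satisfies
\<open>\<bar>D'\<bar> \<le> (1 + \<bar>K\<bar>) D\<close>, so it vanishes identically once it vanishes at \<open>a\<close>.\<close>

lemma solves_ode_unique:
  assumes w: "solves_ode g w w'" and z: "solves_ode g z z'"
    and S: "\<And>x. w x \<in> S" "\<And>x. z x \<in> S"
    and lip: "\<And>x y. x \<in> S \<Longrightarrow> y \<in> S \<Longrightarrow> \<bar>g x - g y\<bar> \<le> K * \<bar>x - y\<bar>"
    and init: "w a = z a" "w' a = z' a"
  shows "w = z"
proof
  fix x
  define D where "D x = (w x - z x)\<^sup>2 + (w' x - z' x)\<^sup>2" for x
  define D' where "D' x = 2 * (w' x - z' x) * ((w x - z x) - (g (w x) - g (z x)))" for x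
  define M where "M = 1 + \<bar>K\<bar>"
  have der: "(D has_real_derivative D' x) (at x)" for x
    unfolding D_def D'_def
    by (rule derivative_eq_intros refl solves_odeD[OF w] solves_odeD[OF z] | simp)+
       (simp add: algebra_simps)
  have bound: "\<bar>D' x\<bar> \<le> M * D x" for x
  proof -
    let ?d = "w x - z x" and ?e = "w' x - z' x"
    have "\<bar>?d - (g (w x) - g (z x))\<bar> \<le> \<bar>?d\<bar> + \<bar>g (w x) - g (z x)\<bar>" by linarith
    also have "\<dots> \<le> \<bar>?d\<bar> + \<bar>K\<bar> * \<bar>?d\<bar>"
      using lip[OF S(1)[of x] S(2)[of x]] mult_right_mono[OF abs_ge_self[of K] abs_ge_zero[of ?d]] by linarith
    finally have 1: "\<bar>?d - (g (w x) - g (z x))\<bar> \<le> M * \<bar>?d\<bar>"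
      by (simp add: M_def algebra_simps)
    have "\<bar>D' x\<bar> = 2 * \<bar>?e\<bar> * \<bar>?d - (g (w x) - g (z x))\<bar>"
      unfolding D'_def abs_mult by simp
    also have "\<dots> \<le> 2 * \<bar>?e\<bar> * (M * \<bar>?d\<bar>)"
      by (intro mult_left_mono 1) auto
    also have "\<dots> = M * (2 * \<bar>?d\<bar> * \<bar>?e\<bar>)" by simp
    also have "\<dots> \<le> M * D x"
    proof (rule mult_left_mono)
      show "2 * \<bar>?d\<bar> * \<bar>?e\<bar> \<le> D x"
        using sum_squares_bound[of "\<bar>?d\<bar>" "\<bar>?e\<bar>"] by (simp add: D_def)
    qed (simp add: M_def)
    finally show ?thesis .
  qed
  have Da: "D a = 0" by (simp add: D_def init)
  have "D x \<le> 0"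
  proof (cases "a \<le> x")
    case True
    have "- (D a * exp (- M * a)) \<le> - (D x * exp (- M * x))"
    proof (rule DERIV_nonneg_imp_nondecreasing[OF True])
      fix s
      have "((\<lambda>x. - (D x * exp (- M * x))) has_real_derivative (M * D s - D' s) * exp (- M * s)) (at s)"
        by (rule derivative_eq_intros refl der | simp)+ (simp add: algebra_simps)
      moreover have "0 \<le> (M * D s - D' s) * exp (- M * s)"
        using bound[of s] by auto
      ultimately show "\<exists>y. ((\<lambda>x. - (D x * exp (- M * x))) has_real_derivative y) (at s) \<and> 0 \<le> y"
        by blast
    qed
    then show ?thesis by (simp add: Da mult_le_0_iff)
  next
    case False
    then have le: "x \<le> a" by simp
    have "D x * exp (M * x) \<le> D a * exp (M * a)"
    proof (rule DERIV_nonneg_imp_nondecreasing[OF le])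
      fix s
      have "((\<lambda>x. D x * exp (M * x)) has_real_derivative (M * D s + D' s) * exp (M * s)) (at s)"
        by (rule derivative_eq_intros refl der | simp)+ (simp add: algebra_simps)
      moreover have "0 \<le> (M * D s + D' s) * exp (M * s)"
        using bound[of s] by auto
      ultimately show "\<exists>y. ((\<lambda>x. D x * exp (M * x)) has_real_derivative y) (at s) \<and> 0 \<le> y"
        by blast
    qed
    then show ?thesis by (simp add: Da mult_le_0_iff)
  qed
  then show "w x = z x"
    unfolding D_def by (smt (verit) zero_le_power2 power2_eq_iff_nonneg zero_eq_power2)
qed

lemma periodic_add_of_int:
  fixes f :: "real \<Rightarrow> 'a"
  assumes per: "\<And>x. f (x + T) = f x"
  shows "f (x + of_int k * T) = f x"
proof -
  have pn: "f (x + of_nat n * T) = f x" for x n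
  proof (induction n)
    case (Suc n)
    have "x + of_nat (Suc n) * T = (x + of_nat n * T) + T" by (simp add: algebra_simps)
    then show ?case by (metis Suc per)
  qed simp
  show ?thesis
  proof (cases "k \<ge> 0")
    case True
    then show ?thesis using pn[of x "nat k"] by simp
  next
    case False
    then show ?thesis using pn[of "x + of_int k * T" "nat (- k)"] by simp
  qed
qed

lemma obtain_period_shift:
  fixes x T :: real
  assumes T: "T > 0"
  obtains k where "x + of_int k * T \<in> {0..<T}"
proof -
  have "of_int \<lfloor>x / T\<rfloor> * T \<le> x" "x < (of_int \<lfloor>x / T\<rfloor> + 1) * T"
    using T by (simp_all add: pos_le_divide_eq[symmetric] pos_divide_less_eq[symmetric])
  then have "x + of_int (- \<lfloor>x / T\<rfloor>) * T \<in> {0..<T}" by (auto simp: algebra_simps)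
  then show ?thesis using that by blast
qed

lemma periodic_attains_min:
  fixes f :: "real \<Rightarrow> real"
  assumes cont: "continuous_on UNIV f" and T: "T > 0" and per: "\<And>x. f (x + T) = f x"
  obtains a where "\<And>x. f a \<le> f x"
proof -
  have "\<exists>a\<in>{0..T}. \<forall>x\<in>{0..T}. f a \<le> f x"
    using T by (intro continuous_attains_inf continuous_on_subset[OF cont]) auto
  then obtain a where a: "\<And>x. x \<in> {0..T} \<Longrightarrow> f a \<le> f x" by blast
  have "f a \<le> f x" for x
  proof -
    obtain k where "x + of_int k * T \<in> {0..<T}" using obtain_period_shift[OF T] by blast
    then show ?thesis
      using a[of "x + of_int k * T"] periodic_add_of_int[of f T x k] per by simp
  qed
  then show ?thesis using that by blast
qed

lemma periodic_deriv:
  fixes f :: "real \<Rightarrow> real"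
  assumes f: "\<And>x. (f has_real_derivative f' x) (at x)" and per: "\<And>x. f (x + T) = f x"
  shows "f' (x + T) = f' x"
proof -
  have "((\<lambda>x. f (x + T)) has_real_derivative f' (x + T)) (at x)"
    by (rule DERIV_shift[THEN iffD1]) (rule f)
  then have "(f has_real_derivative f' (x + T)) (at x)" using per by simp
  then show ?thesis using f[of x] DERIV_unique by blast
qed

text \<open>At a minimum the force is not positive: otherwise, by monotonicity, it would be positive along the whole
orbit, \<open>w'\<close> would be strictly decreasing, and \<open>w'\<close> could not be periodic.\<close>

lemma solves_ode_periodic_min:
  assumes w: "solves_ode g w w'" and T: "T > 0" and per: "\<And>x. w (x + T) = w x"
    and S: "\<And>x. w x \<in> S" and mono: "\<And>x y. x \<in> S \<Longrightarrow> y \<in> S \<Longrightarrow> x \<le> y \<Longrightarrow> g x \<le> g y"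
  obtains a where "\<And>x. w a \<le> w x" "w' a = 0" "g (w a) \<le> 0"
proof -
  obtain a where a: "\<And>x. w a \<le> w x"
    using periodic_attains_min[OF solves_ode_continuous(1)[OF w] T per] by blast
  have wa: "w' a = 0"
    by (rule DERIV_local_min[OF solves_odeD(1)[OF w] zero_less_one]) (simp add: a)
  have "g (w a) \<le> 0"
  proof (rule ccontr)
    assume "\<not> ?thesis"
    then have neg: "- g (w x) < 0" for x
      using mono[OF S S a[of x]] by simp
    have "w' 0 > w' x" if "x > 0" for x
      by (rule DERIV_neg_imp_decreasing[OF that])
         (use solves_odeD(2)[OF w] neg in blast)
    then have w0: "w' x < w' 0" if "x > 0" for x using that by blast
    have "w' T = w' 0"
      using periodic_deriv[of w w' T 0] solves_odeD(1)[OF w] per by simp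
    with w0[OF T] show False by simp
  qed
  with a wa that show ?thesis by blast
qed

text \<open>The equation is invariant under \<open>x \<mapsto> 2 a - x\<close>, and the reflected solution has the same Cauchy data
at a critical point \<open>a\<close>.\<close>

lemma solves_ode_reflect:
  assumes w: "solves_ode g w w'" and S: "\<And>x. w x \<in> S"
    and lip: "\<And>x y. x \<in> S \<Longrightarrow> y \<in> S \<Longrightarrow> \<bar>g x - g y\<bar> \<le> K * \<bar>x - y\<bar>"
    and crit: "w' a = 0"
  shows "w (2 * a - x) = w x"
proof -
  have "solves_ode g (\<lambda>x. w (2 * a - x)) (\<lambda>x. - w' (2 * a - x))"
    unfolding solves_ode_def
  proof (intro allI conjI)
    fix x
    have l: "((\<lambda>x. 2 * a - x) has_real_derivative -1) (at x)"
      by (auto intro!: derivative_eq_intros)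
    show "((\<lambda>x. w (2 * a - x)) has_real_derivative - w' (2 * a - x)) (at x)"
      using DERIV_chain2[OF solves_odeD(1)[OF w] l] by simp
    show "((\<lambda>x. - w' (2 * a - x)) has_real_derivative - g (w (2 * a - x))) (at x)"
      using DERIV_minus[OF DERIV_chain2[OF solves_odeD(2)[OF w] l]] by simp
  qed
  from solves_ode_unique[OF this w S S lip, of a] have "(\<lambda>x. w (2 * a - x)) = w"
    using crit by simp
  then show ?thesis by (rule fun_cong)
qed

text \<open>The solution increases from a minimum at \<open>a\<close> to the next critical point \<open>a + L\<close>. Reflecting at both
points shows that \<open>2 L\<close> is a period, and that \<open>w\<close> returns to its minimum value exactly at the points
\<open>a + 2 L \<int>\<close>; hence every other period \<open>T\<close> is a multiple of \<open>2 L\<close>.\<close>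

lemma solves_ode_half_period:
  assumes w: "solves_ode g w w'" and T: "T > 0" and per: "\<And>x. w (x + T) = w x"
    and S: "\<And>x. w x \<in> S" and mono: "\<And>x y. x \<in> S \<Longrightarrow> y \<in> S \<Longrightarrow> x \<le> y \<Longrightarrow> g x \<le> g y"
    and lip: "\<And>x y. x \<in> S \<Longrightarrow> y \<in> S \<Longrightarrow> \<bar>g x - g y\<bar> \<le> K * \<bar>x - y\<bar>"
    and nonconst: "\<not> (\<forall>x y. w x = w y)"
  obtains a L n where "L > 0" "n \<ge> (1::nat)" "2 * real n * L = T" "w' a = 0" "w' (a + L) = 0"
    "\<And>x. a < x \<Longrightarrow> x < a + L \<Longrightarrow> w' x > 0" "\<And>x. w a \<le> w x" "g (w a) < 0"
proof -
  obtain a where a: "\<And>x. w a \<le> w x" and wa: "w' a = 0" and ga: "g (w a) \<le> 0"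
    using solves_ode_periodic_min[OF w T per S mono] by blast
  have "g (w a) \<noteq> 0"
  proof
    assume "g (w a) = 0"
    then have "solves_ode g (\<lambda>x. w a) (\<lambda>x. 0)" by (simp add: solves_ode_def)
    from solves_ode_unique[OF w this S S lip, of a] wa have "w = (\<lambda>x. w a)" by simp
    then show False using nonconst by metis
  qed
  with ga have ga: "g (w a) < 0" by simp
  obtain d where d: "d > 0" "\<And>h. 0 < h \<Longrightarrow> h < d \<Longrightarrow> w' a < w' (a + h)"
    using DERIV_pos_inc_right[OF solves_odeD(2)[OF w, of a]] ga by auto
  have per': "w' (x + T) = w' x" for x
    by (rule periodic_deriv[OF solves_odeD(1)[OF w] per])
  have dT: "d \<le> T" using d(2)[of T] per'[of a] T by force
  \<comment> \<open>\<open>w'\<close> is positive on \<open>(a, a + d)\<close>: starting at \<open>a + d/2\<close> loses no zero and makes the set compact\<close>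
  define Z where "Z = {a + d/2 .. a + T} \<inter> w' -` {0}"
  have "compact Z" unfolding Z_def
    by (intro compact_Int_closed closed_vimage continuous_on_closed_vimage[THEN iffD1, rule_format, of UNIV, simplified]
        solves_ode_continuous(2)[OF w]) auto
  moreover have "a + T \<in> Z" using d dT T per'[of a] wa by (auto simp: Z_def)
  ultimately obtain b where b: "b \<in> Z" "\<And>x. x \<in> Z \<Longrightarrow> b \<le> x"
    using compact_attains_inf[of Z] by blast
  define L where "L = b - a"
  have L: "L > 0" "w' (a + L) = 0" using b(1) d by (auto simp: L_def Z_def)
  have pos: "w' x > 0" if "a < x" "x < a + L" for x
  proof (cases "x < a + d")
    case True
    then show ?thesis using d(2)[of "x - a"] wa that by simp
  next
    case False
    show ?thesis
    proof (rule ccontr)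
      assume "\<not> w' x > 0"
      moreover have "w' (a + d/2) > 0" using d(2)[of "d/2"] d(1) wa by simp
      ultimately have "\<exists>y\<ge>a + d/2. y \<le> x \<and> w' y = 0"
        using False d solves_ode_continuous(2)[OF w]
        by (intro IVT2') auto
      then obtain y where "y \<ge> a + d/2" "y \<le> x" "w' y = 0" by blast
      then have "y \<in> Z" using that b(1) by (auto simp: Z_def L_def)
      from b(2)[OF this] \<open>y \<le> x\<close> that show False by (simp add: L_def)
    qed
  qed
  have ra: "w (2 * a - x) = w x" for x by (rule solves_ode_reflect[OF w S lip wa])
  have rb: "w (2 * (a + L) - x) = w x" for x by (rule solves_ode_reflect[OF w S lip L(2)])
  have per2: "w (x + 2 * L) = w x" for x
    using rb[of "2 * a - x"] ra[of x] by (simp add: algebra_simps)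
  have gt1: "w a < w x" if "a < x" "x \<le> a + L" for x
  proof (rule DERIV_pos_imp_increasing_open[OF that(1)])
    show "\<exists>y. (w has_real_derivative y) (at z) \<and> 0 < y" if "a < z" "z < x" for z
      using solves_odeD(1)[OF w, of z] pos[of z] that \<open>x \<le> a + L\<close> by force
  qed (rule solves_ode_continuous[OF w])
  have gt: "w a < w x" if "a < x" "x < a + 2 * L" for x
  proof (cases "x \<le> a + L")
    case True then show ?thesis using gt1 that by simp
  next
    case False
    then show ?thesis using gt1[of "2 * (a + L) - x"] rb[of x] that by simp
  qed
  define n where "n = nat \<lfloor>T / (2 * L)\<rfloor>"
  have n0: "0 \<le> \<lfloor>T / (2 * L)\<rfloor>" using T L by simp
  have n1: "real n * (2 * L) \<le> T" "T < (real n + 1) * (2 * L)"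
    using L n0 by (simp_all add: n_def pos_le_divide_eq[symmetric] pos_divide_less_eq[symmetric])
  have pn: "w (x + real m * (2 * L)) = w x" for x m
  proof (induction m)
    case (Suc m)
    have "x + real (Suc m) * (2 * L) = (x + real m * (2 * L)) + 2 * L" by (simp add: algebra_simps)
    then show ?case by (metis Suc per2)
  qed simp
  have "T = real n * (2 * L)"
  proof (rule ccontr)
    assume "T \<noteq> real n * (2 * L)"
    then have "w a < w (a + (T - real n * (2 * L)))"
      using n1 by (intro gt) (auto simp: algebra_simps)
    moreover have "w (a + (T - real n * (2 * L))) = w a"
      using pn[of "a + (T - real n * (2 * L))" n] per[of a] by simp
    ultimately show False by simp
  qed
  moreover from this have "n \<ge> 1" using T by (cases n) auto
  ultimately show ?thesis using that[of L n a] L wa pos a ga by (simp add: algebra_simps)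
qed

text \<open>Sturm comparison with \<open>sin (k (x - a))\<close>: the Wronskian \<open>W\<close> vanishes at \<open>a\<close> and decreases strictly up to
\<open>a + \<pi> / k\<close>, where it equals \<open>k y \<ge> 0\<close> if \<open>y\<close> has not changed sign by then.\<close>

lemma sturm_gap_less:
  fixes y y' q :: "real \<Rightarrow> real"
  assumes y: "\<And>x. (y has_real_derivative y' x) (at x)"
    and y': "\<And>x. (y' has_real_derivative - q x * y x) (at x)"
    and k: "k > 0" and L: "L > 0"
    and bd: "y a = 0" "y (a + L) = 0" and pos: "\<And>x. a < x \<Longrightarrow> x < a + L \<Longrightarrow> y x > 0"
    and q: "\<And>x. a < x \<Longrightarrow> x < a + L \<Longrightarrow> q x > k\<^sup>2"
  shows "L < pi / k"
proof (rule ccontr)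
  assume "\<not> ?thesis"
  then have le: "pi / k \<le> L" by simp
  define W where "W x = y' x * sin (k * (x - a)) - k * y x * cos (k * (x - a))" for x
  have der: "(W has_real_derivative (k\<^sup>2 - q x) * y x * sin (k * (x - a))) (at x)" for x
    unfolding W_def
    by (rule derivative_eq_intros refl y y' | simp)+ (simp add: algebra_simps power2_eq_square)
  have "W (a + pi / k) < W a"
  proof (rule DERIV_neg_imp_decreasing_open[of a "a + pi / k" W])
    fix x assume x: "a < x" "x < a + pi / k"
    have "sin (k * (x - a)) > 0"
      using x k by (intro sin_gt_zero) (auto simp: field_simps)
    moreover have "y x > 0" "q x > k\<^sup>2" using pos[of x] q[of x] x le by auto
    ultimately have "(k\<^sup>2 - q x) * y x * sin (k * (x - a)) < 0"
      by (intro mult_neg_pos) auto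
    then show "\<exists>z. (W has_real_derivative z) (at x) \<and> z < 0" using der by blast
  next
    show "continuous_on {a..a + pi / k} W"
      using der by (meson DERIV_isCont continuous_at_imp_continuous_on)
  qed (use k in auto)
  moreover have "W a = 0" by (simp add: W_def bd)
  moreover have "W (a + pi / k) = k * y (a + pi / k)" using k by (simp add: W_def)
  moreover have "y (a + pi / k) \<ge> 0"
    using pos[of "a + pi / k"] bd k le by (cases "pi / k = L") (auto intro: less_imp_le)
  ultimately show False using k by (simp add: mult_less_0_iff)
qed

text \<open>The reverse comparison: now the Wronskian increases strictly, whereas at the zero \<open>a + L \<le> a + \<pi> / k\<close> of \<open>y\<close>
it equals \<open>y' sin (k L)\<close>, a product of factors of opposite sign.\<close>

lemma sturm_gap_greater:
  fixes y y' q :: "real \<Rightarrow> real"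
  assumes y: "\<And>x. (y has_real_derivative y' x) (at x)"
    and y': "\<And>x. (y' has_real_derivative - q x * y x) (at x)"
    and k: "k > 0" and L: "L > 0"
    and bd: "y a = 0" "y (a + L) = 0" and pos: "\<And>x. a < x \<Longrightarrow> x < a + L \<Longrightarrow> y x > 0"
    and q: "\<And>x. a < x \<Longrightarrow> x < a + L \<Longrightarrow> q x < k\<^sup>2"
  shows "pi / k < L"
proof (rule ccontr)
  assume "\<not> ?thesis"
  then have le: "L \<le> pi / k" by simp
  define W where "W x = y' x * sin (k * (x - a)) - k * y x * cos (k * (x - a))" for x
  have der: "(W has_real_derivative (k\<^sup>2 - q x) * y x * sin (k * (x - a))) (at x)" for x
    unfolding W_def
    by (rule derivative_eq_intros refl y y' | simp)+ (simp add: algebra_simps power2_eq_square)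
  have "W a < W (a + L)"
  proof (rule DERIV_pos_imp_increasing_open[of a "a + L" W])
    fix x assume x: "a < x" "x < a + L"
    have "k * (x - a) < k * (pi / k)" using x le k by (intro mult_strict_left_mono) auto
    then have "sin (k * (x - a)) > 0"
      using x k by (intro sin_gt_zero) auto
    moreover have "y x > 0" "q x < k\<^sup>2" using pos[of x] q[of x] x by auto
    ultimately have "(k\<^sup>2 - q x) * y x * sin (k * (x - a)) > 0" by simp
    then show "\<exists>z. (W has_real_derivative z) (at x) \<and> z > 0" using der by blast
  next
    show "continuous_on {a..a + L} W"
      using der by (meson DERIV_isCont continuous_at_imp_continuous_on)
  qed (use L in auto)
  moreover have "W a = 0" by (simp add: W_def bd)
  moreover have "W (a + L) = y' (a + L) * sin (k * L)" by (simp add: W_def bd)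
  moreover have "sin (k * L) \<ge> 0"
    using k L le by (intro sin_ge_zero) (auto simp: field_simps)
  moreover have "y' (a + L) \<le> 0"
  proof (rule ccontr)
    assume "\<not> ?thesis"
    then obtain d where d: "d > 0" "\<And>h. 0 < h \<Longrightarrow> h < d \<Longrightarrow> y (a + L - h) < y (a + L)"
      using DERIV_pos_inc_left[OF y[of "a + L"]] by auto
    define h where "h = min (d/2) (L/2)"
    have "0 < h" "h < d" "h < L" using d L by (auto simp: h_def)
    then show False using d(2)[of h] pos[of "a + L - h"] bd by auto
  qed
  ultimately show False by (simp add: zero_less_mult_iff)
qed

section \<open>Frequencies of the steady angular profiles\<close>

definition mems_force :: "real \<Rightarrow> real \<Rightarrow> real \<Rightarrow> real \<Rightarrow> real" where
  "mems_force lam b p x = b\<^sup>2 * x - lam * x powr (- p)"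

definition mems_force' :: "real \<Rightarrow> real \<Rightarrow> real \<Rightarrow> real \<Rightarrow> real" where
  "mems_force' lam b p x = b\<^sup>2 + p * lam * x powr (- p - 1)"

lemma mems_force_deriv:
  assumes "x > 0"
  shows "(mems_force lam b p has_real_derivative mems_force' lam b p x) (at x)"
  unfolding mems_force_def[abs_def] mems_force'_def
  by (rule derivative_eq_intros refl has_real_derivative_powr assms | simp)+

lemma mems_force_mono:
  assumes "x > 0" "x \<le> y" "lam \<ge> 0" "p \<ge> 0"
  shows "mems_force lam b p x \<le> mems_force lam b p y"
proof -
  have "y powr (- p) \<le> x powr (- p)" using assms by (intro powr_mono2') auto
  then show ?thesis using assms
    by (auto simp: mems_force_def intro!: diff_mono mult_left_mono)
qed

lemma mems_force_lipschitz:
  assumes c: "c1 > 0" and "lam \<ge> 0" "p \<ge> 0" and xy: "x \<in> {c1..c2}" "y \<in> {c1..c2}"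
  shows "\<bar>mems_force lam b p x - mems_force lam b p y\<bar> \<le> mems_force' lam b p c1 * \<bar>x - y\<bar>"
proof -
  have "norm (mems_force lam b p x - mems_force lam b p y) \<le> mems_force' lam b p c1 * norm (x - y)"
  proof (rule field_differentiable_bound[OF convex_real_interval(5)[of c1 c2] _ _ xy])
    fix z assume z: "z \<in> {c1..c2}"
    then have "z > 0" using c by auto
    then show "(mems_force lam b p has_field_derivative mems_force' lam b p z) (at z within {c1..c2})"
      using mems_force_deriv has_field_derivative_at_within by blast
    have "z powr (- p - 1) \<le> c1 powr (- p - 1)"
      using z c assms by (intro powr_mono2') auto
    then show "norm (mems_force' lam b p z) \<le> mems_force' lam b p c1"
      using assms by (auto simp: mems_force'_def intro!: mult_left_mono)
  qed
  then show ?thesis by simp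
qed

text \<open>Besides \<open>w'\<close> itself, which solves the linearised equation, each product \<open>w\<^sup>q w'\<close> solves a linear
equation. The potential contains \<open>w'\<close> only through \<open>(w' / w)\<^sup>2\<close>, and \<open>q\<close> is a free parameter; this
freedom is what makes the bounds in \<open>steady_frequency\<close> sharp.\<close>

lemma weighted_velocity_derivs:
  assumes w: "solves_ode (mems_force lam b p) w w'" and pos: "\<And>x. w x > 0"
  shows "((\<lambda>x. w x powr q * w' x) has_real_derivative
           q * w x powr (q - 1) * (w' x)\<^sup>2 - w x powr q * mems_force lam b p (w x)) (at x)"
    and "((\<lambda>x. q * w x powr (q - 1) * (w' x)\<^sup>2 - w x powr q * mems_force lam b p (w x))
           has_real_derivative
           - ((3 * q + 1) * b\<^sup>2 - (3 * q - p) * lam * w x powr (- p - 1)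
               - q * (q - 1) * (w' x / w x)\<^sup>2) * (w x powr q * w' x)) (at x)"
proof -
  note d = solves_odeD[OF w]
  have dp: "((\<lambda>x. w x powr r) has_real_derivative r * w x powr (r - 1) * w' x) (at x)" for r
    by (rule DERIV_chain2[OF has_real_derivative_powr[OF pos] d(1)])
  have df: "((\<lambda>x. mems_force lam b p (w x)) has_real_derivative mems_force' lam b p (w x) * w' x) (at x)"
    by (rule DERIV_chain2[OF mems_force_deriv[OF pos] d(1)])
  show "((\<lambda>x. w x powr q * w' x) has_real_derivative
           q * w x powr (q - 1) * (w' x)\<^sup>2 - w x powr q * mems_force lam b p (w x)) (at x)"
    by (rule derivative_eq_intros refl dp d | simp)+ (simp add: power2_eq_square algebra_simps)
  have e: "w x powr (r - 1) = w x powr r / w x" for r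
    using pos[of x] by (simp add: powr_diff)
  have e2: "w x powr (q - 2) = w x powr q / (w x * w x)"
    using pos[of x] by (simp add: powr_diff power2_eq_square)
  show "((\<lambda>x. q * w x powr (q - 1) * (w' x)\<^sup>2 - w x powr q * mems_force lam b p (w x))
           has_real_derivative
           - ((3 * q + 1) * b\<^sup>2 - (3 * q - p) * lam * w x powr (- p - 1)
               - q * (q - 1) * (w' x / w x)\<^sup>2) * (w x powr q * w' x)) (at x)"
    apply (rule dp d df refl derivative_eq_intros)+
    using pos[of x]
    by (simp add: mems_force_def mems_force'_def e e2 field_simps power2_eq_square)
qed

text \<open>Here \<open>\<pi> / n\<close> is the distance of consecutive critical points of \<open>w\<close>. The three bounds are the limits of the
frequency for small oscillations (\<open>b \<surd>(p + 1)\<close>), for large energy when \<open>p \<ge> 1\<close> (\<open>2 b\<close>, a half-wave of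
the harmonic oscillator bouncing off the singularity), and for orbits approaching \<open>0\<close> when \<open>p < 1\<close>
(\<open>b (p + 1)\<close>). Sturm comparison shows that the frequency lies strictly between them, without any
monotonicity of the period in the energy.\<close>

lemma steady_frequency:
  fixes lam b p c1 c2 :: real and w w' :: "real \<Rightarrow> real"
  assumes w: "solves_ode (mems_force lam b p) w w'" and per: "\<And>x. w (x + 2 * pi) = w x"
    and rng: "\<And>x. w x \<in> {c1..c2}" and c1: "c1 > 0"
    and lam: "lam > 0" and p: "p > 0" and b: "b > 0"
    and nonconst: "\<not> (\<forall>x y. w x = w y)"
  obtains n :: nat where "n \<ge> 1"
    "p < 3 \<Longrightarrow> b * sqrt (p + 1) < n \<and> n < 2 * b"
    "p > 3 \<Longrightarrow> 2 * b < n \<and> n < b * sqrt (p + 1)"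
    "p < 1 \<Longrightarrow> n < b * (p + 1)"
proof -
  let ?g = "mems_force lam b p"
  have pos: "w x > 0" for x using rng[of x] c1 by auto
  have mono: "?g x \<le> ?g y" if "x \<in> {c1..c2}" "y \<in> {c1..c2}" "x \<le> y" for x y
    using that c1 lam p by (intro mems_force_mono) auto
  have lip: "\<bar>?g x - ?g y\<bar> \<le> mems_force' lam b p c1 * \<bar>x - y\<bar>"
    if "x \<in> {c1..c2}" "y \<in> {c1..c2}" for x y
    using mems_force_lipschitz[OF c1 _ _ that] lam p by auto
  have twopi: "2 * pi > 0" by simp
  obtain a L n where L: "L > 0" and n: "n \<ge> (1::nat)" "2 * real n * L = 2 * pi"
    and wa: "w' a = 0" and wL: "w' (a + L) = 0"
    and w'pos: "\<And>x. a < x \<Longrightarrow> x < a + L \<Longrightarrow> w' x > 0"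
    and min: "\<And>x. w a \<le> w x" and ga: "?g (w a) < 0"
    by (rule solves_ode_half_period[OF w twopi per rng mono lip nonconst]) blast+
  have nL: "real n = pi / L" using n(2) L by (simp add: field_simps)
  define Q where "Q q x = (3 * q + 1) * b\<^sup>2 - (3 * q - p) * lam * w x powr (- p - 1)
               - q * (q - 1) * (w' x / w x)\<^sup>2" for q x
  have gt: "real n > k" if k: "k > 0" and Q: "\<And>x. a < x \<Longrightarrow> x < a + L \<Longrightarrow> Q q x > k\<^sup>2" for k q
  proof -
    have "L < pi / k"
      by (rule sturm_gap_less[OF weighted_velocity_derivs[OF w pos, where q = q, folded Q_def] k L _ _ _ Q])
         (use wa wL w'pos in \<open>auto intro!: mult_pos_pos simp: pos pos[THEN less_imp_neq, THEN not_sym]\<close>)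
    then show ?thesis unfolding nL using k L
      by (simp add: pos_less_divide_eq pos_divide_less_eq mult.commute)
  qed
  have lt: "real n < k" if k: "k > 0" and Q: "\<And>x. a < x \<Longrightarrow> x < a + L \<Longrightarrow> Q q x < k\<^sup>2" for k q
  proof -
    have "pi / k < L"
      by (rule sturm_gap_greater[OF weighted_velocity_derivs[OF w pos, where q = q, folded Q_def] k L _ _ _ Q])
         (use wa wL w'pos in \<open>auto intro!: mult_pos_pos simp: pos pos[THEN less_imp_neq, THEN not_sym]\<close>)
    then show ?thesis unfolding nL using k L
      by (simp add: pos_less_divide_eq pos_divide_less_eq mult.commute)
  qed
  have wpos: "lam * w x powr (- p - 1) > 0" for x using lam pos[of x] by simp
  \<comment> \<open>\<open>q = 1\<close> removes the term with \<open>w' / w\<close>, and \<open>q = p / 3\<close> the term with the power of \<open>w\<close>\<close>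
  have Q1: "Q 1 x = (2 * b)\<^sup>2 + (p - 3) * (lam * w x powr (- p - 1))" for x
    by (simp add: Q_def power_mult_distrib algebra_simps)
  have Q3: "Q (p / 3) x = (b * sqrt (p + 1))\<^sup>2 + p / 9 * (3 - p) * (w' x / w x)\<^sup>2" for x
  proof -
    define R where "R = (w' x / w x)\<^sup>2"
    show ?thesis
      using p unfolding Q_def R_def[symmetric] by (simp add: power_mult_distrib field_simps power2_eq_square)
  qed
  have ratio: "(w' x / w x)\<^sup>2 > 0" if "a < x" "x < a + L" for x
    using w'pos[OF that] pos[of x] by (simp add: zero_less_power)
  have s: "b * sqrt (p + 1) > 0" using b p by simp
  have A: "p < 3 \<Longrightarrow> b * sqrt (p + 1) < n \<and> n < 2 * b"
  proof
    assume p3: "p < 3"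
    show "b * sqrt (p + 1) < n"
    proof (rule gt[OF s, of "p / 3"])
      fix x assume "a < x" "x < a + L"
      from ratio[OF this] show "(b * sqrt (p + 1))\<^sup>2 < Q (p / 3) x"
        unfolding Q3 using p p3 by simp
    qed
    show "n < 2 * b"
    proof (rule lt[of "2 * b" 1])
      show "Q 1 x < (2 * b)\<^sup>2" for x
        unfolding Q1 using mult_neg_pos[OF _ wpos[of x], of "p - 3"] p3 by simp
    qed (use b in simp)
  qed
  have B: "p > 3 \<Longrightarrow> 2 * b < n \<and> n < b * sqrt (p + 1)"
  proof
    assume p3: "p > 3"
    show "n < b * sqrt (p + 1)"
    proof (rule lt[OF s, of "p / 3"])
      fix x assume "a < x" "x < a + L"
      from ratio[OF this] show "(b * sqrt (p + 1))\<^sup>2 > Q (p / 3) x"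
        unfolding Q3 using p p3 mult_neg_pos[of "p / 9 * (3 - p)" "(w' x / w x)\<^sup>2"]
        by (simp add: mult_pos_neg)
    qed
    show "2 * b < n"
    proof (rule gt[of "2 * b" 1])
      show "Q 1 x > (2 * b)\<^sup>2" for x
        unfolding Q1 using mult_pos_pos[OF _ wpos[of x], of "p - 3"] p3 by simp
    qed (use b in simp)
  qed
  have C: "p < 1 \<Longrightarrow> n < b * (p + 1)"
  proof -
    assume p1: "p < 1"
    \<comment> \<open>twice the conserved energy: it is negative because the orbit has a positive minimum, and for \<open>q = p\<close>
    it can be used to eliminate the power of \<open>w\<close> from the potential\<close>
    define e where "e x = (w' x)\<^sup>2 + b\<^sup>2 * (w x)\<^sup>2 - 2 * lam / (1 - p) * w x powr (1 - p)" for x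
    have "(e has_real_derivative 0) (at x)" for x
    proof -
      have dp: "((\<lambda>x. w x powr (1 - p)) has_real_derivative (1 - p) * w x powr (1 - p - 1) * w' x) (at x)"
        by (rule DERIV_chain2[OF has_real_derivative_powr[OF pos] solves_odeD(1)[OF w]])
      show ?thesis unfolding e_def
        apply (rule refl dp solves_odeD[OF w] derivative_eq_intros)+
        using p1 by (simp add: mems_force_def field_simps)
    qed
    then have ec: "e x = e a" for x using DERIV_isconst_all by blast
    have ee: "e x = (w' x)\<^sup>2 + (w x)\<^sup>2 * (b\<^sup>2 - 2 / (1 - p) * (lam * w x powr (- p - 1)))" for x
    proof -
      have "w x powr (1 - p) = w x powr (2 + (- p - 1))" by simp
      also have "\<dots> = (w x)\<^sup>2 * w x powr (- p - 1)"
        unfolding powr_add using pos[of x] by simp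
      finally show ?thesis by (simp add: e_def algebra_simps)
    qed
    have e_neg: "e a < 0"
    proof -
      have "w a powr (- p) = w a * w a powr (- p - 1)"
        using pos[of a] by (simp add: powr_diff)
      then have "w a * b\<^sup>2 < w a * (lam * w a powr (- p - 1))"
        using ga by (simp add: mems_force_def algebra_simps)
      then have "b\<^sup>2 < lam * w a powr (- p - 1)" using pos[of a] by simp
      also have "\<dots> \<le> 2 / (1 - p) * (lam * w a powr (- p - 1))"
        using p p1 wpos[of a] by (simp add: pos_le_divide_eq mult_le_cancel_right1 del: times_divide_eq_left)
      finally show ?thesis unfolding ee wa using pos[of a] by (simp add: mult_pos_neg)
    qed
    show "n < b * (p + 1)"
    proof (rule lt[of "b * (p + 1)" p])
      fix x
      define N where "N = lam * w x powr (- p - 1)"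
      define c where "c = e a / (w x)\<^sup>2"
      define d where "d = N / (1 - p)"
      have ratio_eq: "(w' x / w x)\<^sup>2 = c - b\<^sup>2 + 2 * d"
        using ee[of x] ec[of x] pos[of x] by (simp add: N_def c_def d_def field_simps)
      have N_eq: "N = (1 - p) * d" using p1 by (simp add: d_def)
      have "Q p x = (3 * p + 1) * b\<^sup>2 - 2 * p * N - p * (p - 1) * (w' x / w x)\<^sup>2"
        by (simp add: Q_def N_def)
      also have "\<dots> = (b * (p + 1))\<^sup>2 + p * (1 - p) * (e a / (w x)\<^sup>2)"
        unfolding ratio_eq N_eq c_def[symmetric] by (simp add: algebra_simps power2_eq_square)
      also have "\<dots> < (b * (p + 1))\<^sup>2"
        using p p1 e_neg pos[of x] by (simp add: mult_pos_neg divide_neg_pos)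
      finally show "Q p x < (b * (p + 1))\<^sup>2" .
    qed (use b p in simp)
  qed
  show ?thesis using that[OF n(1) A B C] by blast
qed

section \<open>The Ermakov-Pinney case and the rigid parameter region\<close>

lemma cos_sin_squares_pos:
  fixes a b x :: real
  assumes "a > 0" "b > 0"
  shows "a * (cos x)\<^sup>2 + b * (sin x)\<^sup>2 > 0"
proof (cases "sin x = 0")
  case True
  then have "cos x \<noteq> 0" using sin_zero_abs_cos_one[of x] by auto
  then show ?thesis using assms by (intro add_pos_nonneg) auto
next
  case False
  then show ?thesis using assms by (intro add_nonneg_pos) auto
qed

lemma profile_pos:
  fixes \<epsilon> x :: real
  assumes "\<epsilon> > 0"
  shows "\<epsilon> * (cos x)\<^sup>2 + inverse \<epsilon> * (sin x)\<^sup>2 > 0"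
  using assms by (intro cos_sin_squares_pos) auto

lemma w_profile_pos:
  assumes "\<epsilon> > 0" "lam > 0" "b > 0"
  shows "w_profile lam b \<epsilon> a x > 0"
  using profile_pos[OF assms(1)] assms by (simp add: w_profile_def)

text \<open>With \<open>N\<close> the expression under the root, \<open>k\<^sup>4 = lam / b\<^sup>2\<close> and \<open>w = k \<surd>N\<close>, the claim \<open>w'' = - b\<^sup>2 w + lam w\<^sup>-\<^sup>3\<close>
amounts to a polynomial identity between \<open>cos\<^sup>2\<close>, \<open>sin\<^sup>2\<close>, \<open>\<epsilon>\<close> and \<open>\<epsilon>\<^sup>-\<^sup>1\<close>.\<close>

lemma w_profile_solves:
  assumes \<epsilon>: "\<epsilon> > 0" and lam: "lam > 0" and b: "b > 0"
  shows "solves_ode (mems_force lam b 3) (w_profile lam b \<epsilon> a)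
           (\<lambda>x. (lam / b\<^sup>2) powr (1 / 4) * (b * (inverse \<epsilon> - \<epsilon>) * (sin (b * (x + a)) * cos (b * (x + a)))
              / sqrt (\<epsilon> * (cos (b * (x + a)))\<^sup>2 + inverse \<epsilon> * (sin (b * (x + a)))\<^sup>2)))"
    (is "solves_ode _ _ ?w'")
  unfolding solves_ode_def
proof (intro allI conjI)
  fix x
  define k where "k = (lam / b\<^sup>2) powr (1 / 4)"
  define e where "e = inverse \<epsilon>"
  define N where "N x = \<epsilon> * (cos (b * (x + a)))\<^sup>2 + e * (sin (b * (x + a)))\<^sup>2" for x
  have Npos: "N x > 0" for x unfolding N_def e_def by (rule profile_pos[OF \<epsilon>])
  define s where "s = sin (b * (x + a))"
  define c where "c = cos (b * (x + a))"
  have sc: "c\<^sup>2 + s\<^sup>2 = 1" by (simp add: s_def c_def)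
  have ee: "e * \<epsilon> = 1" using \<epsilon> by (simp add: e_def)
  have dN: "(N has_real_derivative 2 * b * (e - \<epsilon>) * (s * c)) (at x)"
    unfolding N_def[abs_def] s_def c_def
    by (auto intro!: derivative_eq_intros simp: algebra_simps)
  have dS: "((\<lambda>x. sqrt (N x)) has_real_derivative b * (e - \<epsilon>) * (s * c) / sqrt (N x)) (at x)"
  proof -
    have "((\<lambda>x. sqrt (N x)) has_real_derivative inverse (sqrt (N x)) / 2 * (2 * b * (e - \<epsilon>) * (s * c))) (at x)"
      by (rule DERIV_chain2[OF DERIV_real_sqrt[OF Npos] dN])
    also have "inverse (sqrt (N x)) / 2 * (2 * b * (e - \<epsilon>) * (s * c)) = b * (e - \<epsilon>) * (s * c) / sqrt (N x)"
      using Npos[of x] by (simp add: field_simps)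
    finally show ?thesis .
  qed
  have w: "w_profile lam b \<epsilon> a = (\<lambda>x. k * sqrt (N x))"
    by (simp add: fun_eq_iff w_profile_def k_def N_def e_def)
  have w': "?w' = (\<lambda>x. k * (b * (e - \<epsilon>) * (sin (b * (x + a)) * cos (b * (x + a))) / sqrt (N x)))"
    by (simp add: k_def N_def e_def)
  show "(w_profile lam b \<epsilon> a has_real_derivative ?w' x) (at x)"
    unfolding w using DERIV_cmult[OF dS, of k] by (simp add: s_def c_def k_def N_def e_def)
  have k4: "k ^ 4 = lam / b\<^sup>2"
    using lam b by (simp add: k_def powr_power)
  have kpos: "k > 0" using lam b by (simp add: k_def)
  have S: "sqrt (N x) > 0" "sqrt (N x) ^ 2 = N x" using Npos[of x] by simp_all
  have dsc: "((\<lambda>x. sin (b * (x + a)) * cos (b * (x + a))) has_real_derivative b * (c\<^sup>2 - s\<^sup>2)) (at x)"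
    unfolding s_def c_def
    by (auto intro!: derivative_eq_intros simp: algebra_simps power2_eq_square)
  define D where "D = (b * (c\<^sup>2 - s\<^sup>2) * sqrt (N x) - s * c * (b * (e - \<epsilon>) * (s * c) / sqrt (N x)))
      / (sqrt (N x) * sqrt (N x))"
  have "((\<lambda>x. sin (b * (x + a)) * cos (b * (x + a)) / sqrt (N x)) has_real_derivative D) (at x)"
    unfolding D_def using DERIV_divide[OF dsc dS] S by (simp add: s_def c_def)
  from DERIV_cmult[OF DERIV_cmult[OF this, of "b * (e - \<epsilon>)"], of k]
  have "(?w' has_real_derivative k * (b * (e - \<epsilon>) * D)) (at x)" unfolding w' by simp
  moreover have "k * (b * (e - \<epsilon>) * D) = - mems_force lam b 3 (w_profile lam b \<epsilon> a x)"
  proof -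
    define S where "S = sqrt (N x)"
    have Sp: "S > 0" and S2: "S\<^sup>2 = \<epsilon> * c\<^sup>2 + e * s\<^sup>2"
      using Npos[of x] unfolding S_def by (simp_all add: N_def s_def c_def)
    have key: "(e - \<epsilon>) * ((c\<^sup>2 - s\<^sup>2) * S\<^sup>2 - (e - \<epsilon>) * (s * c)\<^sup>2) = 1 - (S\<^sup>2)\<^sup>2"
      unfolding S2 using sc ee by algebra
    have "k * (b * (e - \<epsilon>) * D)
       = k * b\<^sup>2 * ((e - \<epsilon>) * ((c\<^sup>2 - s\<^sup>2) * S\<^sup>2 - (e - \<epsilon>) * (s * c)\<^sup>2)) / S ^ 3"
      unfolding D_def S_def[symmetric] using Sp by (simp add: field_simps power2_eq_square power3_eq_cube)
    also have "\<dots> = k * b\<^sup>2 * (1 - S ^ 4) / S ^ 3"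
      unfolding key by simp
    also have "\<dots> = - (b\<^sup>2 * (k * S) - lam * (k * S) powr (- 3))"
    proof -
      have p: "(k * S) powr (- 3) = inverse ((k * S) ^ 3)"
        using kpos Sp by (simp add: powr_minus)
      have l: "lam = k ^ 4 * b\<^sup>2" using k4 b by simp
      show ?thesis unfolding p l using kpos Sp by (simp add: field_simps eval_nat_numeral)
    qed
    finally show ?thesis by (simp add: mems_force_def w S_def)
  qed
  ultimately show "(?w' has_real_derivative - mems_force lam b 3 (w_profile lam b \<epsilon> a x)) (at x)"
    by simp
qed

lemma w_profile_range:
  assumes \<epsilon>: "\<epsilon> > 0" "\<epsilon> \<le> 1"
  shows "w_profile lam b \<epsilon> a x \<in> {(lam / b\<^sup>2) powr (1 / 4) * sqrt \<epsilon> .. (lam / b\<^sup>2) powr (1 / 4) * sqrt (inverse \<epsilon>)}"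
proof -
  define P where "P = (cos (b * (x + a)))\<^sup>2"
  define Q where "Q = (sin (b * (x + a)))\<^sup>2"
  have PQ: "P \<ge> 0" "Q \<ge> 0" "P + Q = 1" by (simp_all add: P_def Q_def)
  have e: "\<epsilon> \<le> inverse \<epsilon>" using assms by (meson one_le_inverse order_trans)
  have "\<epsilon> * P + \<epsilon> * Q \<le> \<epsilon> * P + inverse \<epsilon> * Q" "\<epsilon> * P + inverse \<epsilon> * Q \<le> inverse \<epsilon> * P + inverse \<epsilon> * Q"
    using e PQ by (simp_all add: mult_right_mono)
  then have "\<epsilon> \<le> \<epsilon> * P + inverse \<epsilon> * Q" "\<epsilon> * P + inverse \<epsilon> * Q \<le> inverse \<epsilon>"
    using PQ(3) by (simp_all add: distrib_left[symmetric])
  then show ?thesis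
    unfolding w_profile_def P_def Q_def by (auto intro!: mult_left_mono)
qed

lemma sin_sq_shift_int: "(sin (x + of_int i * pi))\<^sup>2 = (sin x)\<^sup>2"
proof -
  have "sin (of_int i * pi) = 0" using sin_zero_iff_int2 by blast
  then show ?thesis
    using sin_cos_squared_add[of "of_int i * pi"] by (simp add: sin_add power_mult_distrib)
qed

lemma cos_sq_shift_int: "(cos (x + of_int i * pi))\<^sup>2 = (cos x)\<^sup>2"
  using sin_sq_shift_int[of x i] by (simp add: cos_squared_eq)

lemma sin_cos_shift_int: "sin (x + of_int i * pi) * cos (x + of_int i * pi) = sin x * cos x"
proof -
  have s: "sin (of_int i * pi) = 0" using sin_zero_iff_int2 by blast
  then have c: "cos (of_int i * pi) * cos (of_int i * pi) = 1"
    using sin_cos_squared_add[of "of_int i * pi"] by (simp add: power2_eq_square)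
  have "sin (x + of_int i * pi) * cos (x + of_int i * pi)
      = sin x * cos x * (cos (of_int i * pi) * cos (of_int i * pi))"
    by (simp add: sin_add cos_add s)
  then show ?thesis by (simp add: c)
qed

text \<open>Choose \<open>\<epsilon>\<close> so that the minimum of \<open>w_profile\<close> is the minimum of \<open>w\<close>, and the phase \<open>a\<close> so that both are
attained at the same point; then the Cauchy data there agree. The minimum does not exceed the constant
solution because the force is not positive there, and this gives \<open>\<epsilon> \<le> 1\<close>.\<close>

lemma steady_cubic_is_profile:
  assumes w: "solves_ode (mems_force lam b 3) w w'" and per: "\<And>x. w (x + 2 * pi) = w x"
    and rng: "\<And>x. w x \<in> {c1..c2}" and c1: "c1 > 0" and lam: "lam > 0" and b: "b > 0"
  obtains \<epsilon> a where "\<epsilon> \<in> {0<..1}" "a \<in> {0..<pi / b}" "w = w_profile lam b \<epsilon> a"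
proof -
  let ?g = "mems_force lam b 3"
  have pos: "w x > 0" for x using rng[of x] c1 by auto
  have mono: "?g x \<le> ?g y" if "x \<in> {c1..c2}" "y \<in> {c1..c2}" "x \<le> y" for x y
    using that c1 lam by (intro mems_force_mono) auto
  have twopi: "2 * pi > 0" by simp
  obtain a0 where a0: "w' a0 = 0" "?g (w a0) \<le> 0"
    using solves_ode_periodic_min[OF w twopi per rng mono] by blast
  define k where "k = (lam / b\<^sup>2) powr (1 / 4)"
  have k4: "k ^ 4 = lam / b\<^sup>2" using lam b by (simp add: k_def powr_power)
  have kpos: "k > 0" using lam b by (simp add: k_def)
  define m where "m = w a0"
  have m: "m > 0" using pos by (simp add: m_def)
  have mk: "m \<le> k"
  proof -
    have "m powr (- 3) = inverse (m ^ 3)" using m by (simp add: powr_minus)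
    then have "b\<^sup>2 * m \<le> lam * inverse (m ^ 3)" using a0(2) by (simp add: mems_force_def m_def)
    then have "m ^ 4 \<le> lam / b\<^sup>2" using m b by (simp add: field_simps eval_nat_numeral)
    then have "m ^ 4 \<le> k ^ 4" by (simp add: k4)
    then show ?thesis using power_mono_iff[of m k 4] m kpos by simp
  qed
  define \<epsilon> where "\<epsilon> = (m / k)\<^sup>2"
  have \<epsilon>: "\<epsilon> > 0" "\<epsilon> \<le> 1" using m kpos mk by (auto simp: \<epsilon>_def intro!: power_le_one)
  have pb: "pi / b > 0" using b by simp
  obtain i where i: "- a0 + of_int i * (pi / b) \<in> {0..<pi / b}" using obtain_period_shift[OF pb] by blast
  define a where "a = - a0 + of_int i * (pi / b)"
  have ph: "b * (a0 + a) = of_int i * pi" using b by (simp add: a_def)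
  have s0: "sin (of_int i * pi) = 0" using sin_zero_iff_int2 by blast
  then have c0: "(cos (of_int i * pi))\<^sup>2 = 1" using sin_cos_squared_add[of "of_int i * pi"] by simp
  define d1 where "d1 = min c1 (k * sqrt \<epsilon>)"
  define d2 where "d2 = max c2 (k * sqrt (inverse \<epsilon>))"
  have d1: "d1 > 0" using c1 kpos \<epsilon> by (simp add: d1_def)
  have lip: "\<bar>?g x - ?g y\<bar> \<le> mems_force' lam b 3 d1 * \<bar>x - y\<bar>"
    if "x \<in> {d1..d2}" "y \<in> {d1..d2}" for x y
    using mems_force_lipschitz[OF d1 _ _ that] lam by auto
  have "w = w_profile lam b \<epsilon> a"
  proof (rule solves_ode_unique[OF w w_profile_solves[OF \<epsilon>(1) lam b] _ _ lip, where a = a0])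
    show "w x \<in> {d1..d2}" for x using rng[of x] by (auto simp: d1_def d2_def)
    show "w_profile lam b \<epsilon> a x \<in> {d1..d2}" for x
      using w_profile_range[OF \<epsilon>, of lam b a x] by (auto simp: d1_def d2_def k_def)
    show "w a0 = w_profile lam b \<epsilon> a a0"
      using m kpos by (simp add: w_profile_def ph s0 c0 k_def[symmetric] \<epsilon>_def m_def)
  qed (simp_all add: ph s0 a0)
  then show ?thesis using that[of \<epsilon> a] \<epsilon> i by (simp add: a_def)
qed

lemma w_profile_one: "w_profile lam b 1 a x = (lam / b\<^sup>2) powr (1 / 4)"
  by (simp add: w_profile_def)

lemma w_profile_periodic_imp:
  assumes per: "\<And>x. w_profile lam b \<epsilon> a (x + 2 * pi) = w_profile lam b \<epsilon> a x"
    and \<epsilon>: "\<epsilon> \<in> {0<..1}" and lam: "lam > 0" and b: "b > 0"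
  shows "\<epsilon> = 1 \<or> (\<exists>i. 2 * b = of_int i)"
proof (rule disjCI)
  assume "\<not> (\<exists>i. 2 * b = of_int i)"
  then have s: "sin (2 * b * pi) \<noteq> 0" by (simp add: sin_zero_iff_int2)
  have "b * (- a + 2 * pi + a) = 2 * b * pi" by simp
  with per[of "- a"] have "\<epsilon> * (cos (2 * b * pi))\<^sup>2 + inverse \<epsilon> * (sin (2 * b * pi))\<^sup>2 = \<epsilon>"
    using lam b by (simp add: w_profile_def ac_simps)
  then have "(inverse \<epsilon> - \<epsilon>) * (sin (2 * b * pi))\<^sup>2 = 0"
    by (simp add: cos_squared_eq algebra_simps)
  with s have "inverse \<epsilon> = \<epsilon>" by simp
  then have "\<epsilon> * \<epsilon> = 1" using \<epsilon> by (metis greaterThanAtMost_iff less_irrefl right_inverse)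
  then show "\<epsilon> = 1" using \<epsilon> by (auto simp: square_eq_1_iff)
qed

text \<open>The integrand is the angular velocity of the point \<open>(\<surd>\<epsilon> cos y, sin y / \<surd>\<epsilon>)\<close> with \<open>y = b (x + a)\<close>,
divided by \<open>b\<close>. Its polar angle is \<open>y\<close> plus a \<open>\<pi>\<close>-periodic correction, which \<open>F\<close> writes as an
\<open>arctan\<close> with nowhere vanishing denominator; so the integral does not depend on \<open>\<epsilon>\<close>.\<close>

lemma has_integral_profile_inverse:
  assumes \<epsilon>: "\<epsilon> > 0" and b: "b > 0" "2 * b = of_int i"
  shows "((\<lambda>x. 1 / (\<epsilon> * (cos (b * (x + a)))\<^sup>2 + inverse \<epsilon> * (sin (b * (x + a)))\<^sup>2)) has_integral (2 * pi)) {0..2 * pi}"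
proof -
  define e where "e = inverse \<epsilon>"
  have e: "e > 0" and ee: "e * \<epsilon> = 1" using \<epsilon> by (simp_all add: e_def)
  define n where "n y = (e - 1) * (sin y * cos y)" for y
  define d where "d y = (cos y)\<^sup>2 + e * (sin y)\<^sup>2" for y
  define F where "F x = x + arctan (n (b * (x + a)) / d (b * (x + a))) / b" for x
  have dpos: "d y > 0" for y
    using cos_sin_squares_pos[of 1 e y] e by (simp add: d_def)
  have "((\<lambda>x. 1 / (\<epsilon> * (cos (b * (x + a)))\<^sup>2 + e * (sin (b * (x + a)))\<^sup>2)) has_integral (F (2 * pi) - F 0)) {0..2 * pi}"
  proof (rule fundamental_theorem_of_calculus)
    fix x
    define y where "y = b * (x + a)"
    define s where "s = sin y"
    define c where "c = cos y"
    have sc: "c\<^sup>2 + s\<^sup>2 = 1" by (simp add: s_def c_def)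
    have dn: "(n has_real_derivative (e - 1) * (c\<^sup>2 - s\<^sup>2)) (at y)"
      unfolding n_def[abs_def] s_def c_def
      by (auto intro!: derivative_eq_intros simp: algebra_simps power2_eq_square)
    have dd: "(d has_real_derivative 2 * (e - 1) * (s * c)) (at y)"
      unfolding d_def[abs_def] s_def c_def
      by (auto intro!: derivative_eq_intros simp: algebra_simps)
    define q where "q = ((e - 1) * (c\<^sup>2 - s\<^sup>2) * d y - n y * (2 * (e - 1) * (s * c))) / (d y * d y)"
    have dq: "((\<lambda>y. n y / d y) has_real_derivative q) (at y)"
      using DERIV_divide[OF dn dd] dpos[of y] by (simp add: q_def)
    have dy: "((\<lambda>x. b * (x + a)) has_real_derivative b) (at x)"
      by (auto intro!: derivative_eq_intros)
    have "((\<lambda>x. arctan (n (b * (x + a)) / d (b * (x + a)))) has_real_derivative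
        inverse (1 + (n y / d y)\<^sup>2) * (q * b)) (at x)"
      unfolding y_def
      by (rule DERIV_chain2[OF DERIV_arctan]) (use DERIV_chain2[of "\<lambda>y. n y / d y", OF _ dy] dq y_def in simp)
    then have "(F has_real_derivative 1 + inverse (1 + (n y / d y)\<^sup>2) * (q * b) / b) (at x)"
      unfolding F_def[abs_def] by (intro DERIV_add DERIV_ident DERIV_cdivide)
    also have "1 + inverse (1 + (n y / d y)\<^sup>2) * (q * b) / b = 1 / (\<epsilon> * c\<^sup>2 + e * s\<^sup>2)"
    proof -
      have nd: "n y = (e - 1) * (s * c)" "d y = c\<^sup>2 + e * s\<^sup>2" by (simp_all add: n_def d_def s_def c_def)
      define m where "m = c\<^sup>2 + e\<^sup>2 * s\<^sup>2"
      have m1: "(d y)\<^sup>2 + (n y)\<^sup>2 = m"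
        unfolding nd m_def using sc by algebra
      have m2: "(e - 1) * (c\<^sup>2 - s\<^sup>2) * d y - n y * (2 * (e - 1) * (s * c)) = e - m"
        unfolding nd m_def using sc by algebra
      have m3: "m * \<epsilon> = \<epsilon> * c\<^sup>2 + e * s\<^sup>2"
        unfolding m_def using ee by algebra
      have mpos: "m > 0" unfolding m1[symmetric] using dpos[of y] by (simp add: add_pos_nonneg)
      have "inverse (1 + (n y / d y)\<^sup>2) * q = (e - m) / m"
      proof -
        have "1 + (n y / d y)\<^sup>2 = m / (d y * d y)"
          unfolding m1[symmetric] using dpos[of y] by (simp add: field_simps power2_eq_square)
        then show ?thesis unfolding q_def m2 using dpos[of y] mpos by simp
      qed
      then have "1 + inverse (1 + (n y / d y)\<^sup>2) * (q * b) / b = 1 + (e - m) / m"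
        using b by (simp add: mult.assoc[symmetric])
      also have "\<dots> = e / m" using mpos by (simp add: field_simps)
      also have "\<dots> = 1 / (m * \<epsilon>)" using \<epsilon> mpos by (simp add: e_def field_simps)
      finally show ?thesis by (simp add: m3)
    qed
    finally have "(F has_real_derivative 1 / (\<epsilon> * (cos (b * (x + a)))\<^sup>2 + e * (sin (b * (x + a)))\<^sup>2)) (at x)"
      by (simp add: s_def c_def y_def)
    then show "(F has_vector_derivative 1 / (\<epsilon> * (cos (b * (x + a)))\<^sup>2 + e * (sin (b * (x + a)))\<^sup>2)) (at x within {0..2 * pi})"
      by (simp add: has_real_derivative_iff_has_vector_derivative has_vector_derivative_at_within)
  qed simp
  moreover have "F (2 * pi) - F 0 = 2 * pi"
  proof -
    have "b * (2 * pi + a) = b * a + (2 * b) * pi" by (simp add: algebra_simps)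
    then have *: "b * (2 * pi + a) = b * a + of_int i * pi" by (simp add: b)
    show ?thesis unfolding F_def n_def d_def *
      by (simp add: sin_sq_shift_int cos_sq_shift_int sin_cos_shift_int)
  qed
  ultimately show ?thesis by (simp add: e_def)
qed

lemma steady_const_value:
  assumes w: "solves_ode (mems_force lam b p) w w'" and const: "\<forall>x y. w x = w y"
    and pos: "\<And>x. w x > 0" and lam: "lam > 0" and b: "b > 0" and p: "p > 0"
  shows "w x = (lam / b\<^sup>2) powr (1 / (p + 1))"
proof -
  have wc: "w = (\<lambda>y. w x)" using const by blast
  have "w' y = 0" for y
    using solves_odeD(1)[OF w, of y] wc DERIV_const DERIV_unique by metis
  then have "w' = (\<lambda>y. 0)" by blast
  then have "mems_force lam b p (w x) = 0"
    using solves_odeD(2)[OF w, of x] DERIV_const DERIV_unique by (metis neg_equal_0_iff_equal)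
  then have e: "b\<^sup>2 * w x = lam * w x powr (- p)" by (simp add: mems_force_def)
  have "w x powr (p + 1) = w x powr p * w x" using pos[of x] by (simp add: powr_add)
  also have "\<dots> = lam / b\<^sup>2" using e pos[of x] b by (simp add: powr_minus field_simps)
  finally have "lam / b\<^sup>2 = w x powr (p + 1)" by simp
  then show ?thesis using pos[of x] p by (simp add: powr_powr)
qed

text \<open>In each case the conditions defining the region leave no room for the integer \<open>n\<close> of \<open>steady_frequency\<close>:
its bounds lie in an interval \<open>[j, j + 1]\<close> with \<open>j\<close> the integer in the definition, or its upper
bound is at most \<open>1\<close>. For \<open>p = 3\<close> the bounds coincide and the explicit profiles decide.\<close>

lemma steady_constant:
  assumes M: "(\<alpha>, p) \<in> \<M>" and beta: "b = (\<alpha> + 2) / (p + 1)"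
    and w: "solves_ode (mems_force lam b p) w w'" and per: "\<And>x. w (x + 2 * pi) = w x"
    and rng: "\<And>x. w x \<in> {c1..c2}" and c1: "c1 > 0"
    and lam: "lam > 0" and p: "p > 0" and al: "\<alpha> > -2"
  shows "w x = w y"
proof (rule ccontr)
  assume "w x \<noteq> w y"
  then have nonconst: "\<not> (\<forall>x y. w x = w y)" by blast
  have b: "b > 0" using al p by (simp add: beta)
  have bp: "b * (p + 1) = \<alpha> + 2" using p by (simp add: beta)
  define s where "s = sqrt (p + 1)"
  have s: "s > 0" "s\<^sup>2 = p + 1" using p by (simp_all add: s_def)
  have bs: "s * (b * s) = \<alpha> + 2"
  proof -
    have "s * (b * s) = b * s\<^sup>2" by (simp add: power2_eq_square)
    then show ?thesis using bp s(2) by simp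
  qed
  obtain n :: nat where n: "n \<ge> 1"
    "p < 3 \<Longrightarrow> b * s < n \<and> n < 2 * b"
    "p > 3 \<Longrightarrow> 2 * b < n \<and> n < b * s"
    "p < 1 \<Longrightarrow> n < b * (p + 1)"
    unfolding s_def using steady_frequency[OF w per rng c1 lam p b nonconst] by blast
  have n1: "real n \<ge> 1" using n(1) by simp
  have sq_le: "real_of_int j \<le> b * s" if "j \<ge> 1" "p \<le> ((\<alpha> + 2) / real_of_int j)\<^sup>2 - 1" for j
  proof -
    have "s\<^sup>2 \<le> ((\<alpha> + 2) / real_of_int j)\<^sup>2" using that s by simp
    then have "s \<le> (\<alpha> + 2) / real_of_int j"
      by (rule power2_le_imp_le) (use that al in simp)
    then have "s * real_of_int j \<le> s * (b * s)" unfolding bs using that by (simp add: pos_le_divide_eq)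
    then show ?thesis using s by simp
  qed
  have sq_ge: "b * s \<le> c" if "c > 0" "((\<alpha> + 2) / c)\<^sup>2 - 1 \<le> p" for c
  proof -
    have "((\<alpha> + 2) / c)\<^sup>2 \<le> s\<^sup>2" using that s by simp
    then have "(\<alpha> + 2) / c \<le> s" by (rule power2_le_imp_le) (use s in simp)
    then have "s * (b * s) \<le> s * c" unfolding bs using that by (simp add: pos_divide_le_eq)
    then show ?thesis using s by simp
  qed
  have between: False if "real_of_int j < real n" "real n < real_of_int j + 1" for j
  proof -
    have "real_of_int j < real_of_int (int n)" "real_of_int (int n) < real_of_int (j + 1)"
      using that by simp_all
    then have "j < int n" "int n < j + 1" by (simp_all only: of_int_less_iff)
    then show False by simp
  qed
  from M consider "(\<alpha>, p) \<in> \<M>\<^sub>1" | "(\<alpha>, p) \<in> \<M>\<^sub>2" | "(\<alpha>, p) \<in> \<M>\<^sub>3" | "(\<alpha>, p) \<in> \<M>\<^sub>4"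
    unfolding \<M>_def by blast
  then show False
  proof cases
    case 1
    then have p1: "p < 1" and c: "\<alpha> \<le> -1 \<or> (\<exists>j::int. j \<ge> 1 \<and> \<alpha> \<le> real_of_int j - 1 \<and> p \<le> ((\<alpha> + 2) / real_of_int j)\<^sup>2 - 1)"
      by (auto simp: \<M>\<^sub>1_def)
    from c show False
    proof
      assume "\<alpha> \<le> -1" then show False using n(4)[OF p1] n1 bp by linarith
    next
      assume "\<exists>j::int. j \<ge> 1 \<and> \<alpha> \<le> real_of_int j - 1 \<and> p \<le> ((\<alpha> + 2) / real_of_int j)\<^sup>2 - 1"
      then obtain j :: int where j: "j \<ge> 1" "\<alpha> \<le> real_of_int j - 1" "p \<le> ((\<alpha> + 2) / real_of_int j)\<^sup>2 - 1" by blast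
      show False using between[of j] sq_le[OF j(1,3)] n(2) n(4)[OF p1] bp j(2) p1 by linarith
    qed
  next
    case 2
    then have p3: "p < 3" and c: "p \<ge> 2 * \<alpha> + 3 \<or> (\<exists>j::int. j \<ge> 1 \<and> 2 * (\<alpha> + 2) / (real_of_int j + 1) - 1 \<le> p \<and>
                p \<le> ((\<alpha> + 2) / real_of_int j)\<^sup>2 - 1)"
      by (auto simp: \<M>\<^sub>2_def)
    from c show False
    proof
      assume "p \<ge> 2 * \<alpha> + 3"
      then have "2 * b \<le> 1" using p by (simp add: beta field_simps)
      then show False using n(2)[OF p3] n1 by linarith
    next
      assume "\<exists>j::int. j \<ge> 1 \<and> 2 * (\<alpha> + 2) / (real_of_int j + 1) - 1 \<le> p \<and> p \<le> ((\<alpha> + 2) / real_of_int j)\<^sup>2 - 1"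
      then obtain j :: int where j: "j \<ge> 1" "2 * (\<alpha> + 2) / (real_of_int j + 1) - 1 \<le> p"
        "p \<le> ((\<alpha> + 2) / real_of_int j)\<^sup>2 - 1" by blast
      have "2 * b \<le> real_of_int j + 1" using j(1,2) p by (simp add: beta field_simps)
      then show False using between[of j] sq_le[OF j(1,3)] n(2)[OF p3] by linarith
    qed
  next
    case 3
    then have p3: "p = 3" and al': "\<alpha> \<notin> {2 * real k | k::nat. True}" by (auto simp: \<M>\<^sub>3_def)
    obtain \<epsilon> a where e: "\<epsilon> \<in> {0<..1}" and wp: "w = w_profile lam b \<epsilon> a"
      using steady_cubic_is_profile[OF w[unfolded p3] per rng c1 lam b] by blast
    have "\<epsilon> \<noteq> 1" using nonconst wp by (auto simp: w_profile_one)
    then obtain i where i: "2 * b = of_int i"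
      using w_profile_periodic_imp[OF per[unfolded wp] e lam b] by blast
    then have "\<alpha> = 2 * of_int i - 2" using bp p3 by simp
    moreover have "i \<ge> 1" using i b by (metis int_one_le_iff_zero_less mult_pos_pos of_int_0_less_iff zero_less_numeral)
    ultimately have "\<alpha> = 2 * real (nat (i - 1))" by simp
    then show False using al' by blast
  next
    case 4
    then have p3: "p > 3" and c: "p \<ge> (\<alpha> + 2)\<^sup>2 - 1 \<or>
      (\<exists>j::int. j \<ge> 1 \<and> ((\<alpha> + 2) / (real_of_int j + 1))\<^sup>2 - 1 \<le> p \<and> p \<le> 2 * (\<alpha> + 2) / real_of_int j - 1)"
      by (auto simp: \<M>\<^sub>4_def)
    from c show False
    proof
      assume "p \<ge> (\<alpha> + 2)\<^sup>2 - 1"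
      then have "b * s \<le> 1" using sq_ge[of 1] by simp
      then show False using n(3)[OF p3] n1 by linarith
    next
      assume "\<exists>j::int. j \<ge> 1 \<and> ((\<alpha> + 2) / (real_of_int j + 1))\<^sup>2 - 1 \<le> p \<and> p \<le> 2 * (\<alpha> + 2) / real_of_int j - 1"
      then obtain j :: int where j: "j \<ge> 1" "((\<alpha> + 2) / (real_of_int j + 1))\<^sup>2 - 1 \<le> p"
        "p \<le> 2 * (\<alpha> + 2) / real_of_int j - 1" by blast
      have "real_of_int j \<le> 2 * b" using j(1,3) p by (simp add: beta field_simps)
      then show False using between[of j] sq_ge[OF _ j(2)] n(3)[OF p3] j(1) by linarith
    qed
  qed
qed

section \<open>Calculus for functions of two variables\<close>

lemma has_integral_FTC:
  fixes F f :: "real \<Rightarrow> real"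
  assumes "a \<le> b" "\<And>x. (F has_real_derivative f x) (at x)"
  shows "(f has_integral (F b - F a)) {a..b}"
  using assms by (intro fundamental_theorem_of_calculus)
    (auto simp: has_real_derivative_iff_has_vector_derivative[symmetric] intro: has_field_derivative_at_within)

lemma integral_upper_deriv:
  fixes f :: "real \<Rightarrow> real"
  assumes "a < x" "\<And>A. continuous_on A f"
  shows "((\<lambda>x. integral {a..x} f) has_real_derivative f x) (at x)"
proof -
  have "((\<lambda>x. integral {a..x} f) has_real_derivative f x) (at x within {a..x + 1})"
    by (rule integral_has_real_derivative) (use assms in auto)
  moreover have "x \<in> interior {a..x + 1}" using assms by simp
  ultimately show ?thesis using at_within_interior by metis
qed

text \<open>Joint continuity, stated for curried functions so that partial derivatives can be handled separately in each
argument.\<close>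

definition cont2 :: "(real \<Rightarrow> real \<Rightarrow> real) \<Rightarrow> bool" where
  "cont2 f \<longleftrightarrow> continuous_on UNIV (\<lambda>z. f (fst z) (snd z))"

lemma cont2_compose:
  assumes "cont2 f" "continuous_on S p" "continuous_on S q"
  shows "continuous_on S (\<lambda>z. f (p z) (q z))"
  using continuous_on_compose2[OF assms(1)[unfolded cont2_def], of S "\<lambda>z. (p z, q z)"] assms(2,3)
  by (auto intro: continuous_on_Pair)

lemma leibniz_cont2:
  assumes der: "\<And>t x. ((\<lambda>s. f s x) has_real_derivative f' t x) (at t)"
    and f: "cont2 f" and f': "cont2 f'"
  shows "((\<lambda>s. integral {a..b} (f s)) has_real_derivative integral {a..b} (f' t)) (at t)"
proof -
  have "((\<lambda>s. integral (cbox a b) (f s)) has_field_derivative integral (cbox a b) (f' t)) (at t within UNIV)"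
  proof (rule leibniz_rule_field_derivative)
    show "f s integrable_on cbox a b" for s
      using cont2_compose[OF f, of "{a..b}" "\<lambda>x. s" "\<lambda>x. x"]
      by (auto intro!: integrable_continuous_real continuous_intros)
    show "continuous_on (UNIV \<times> cbox a b) (\<lambda>(x, t). f' x t)"
      using f' unfolding cont2_def split_beta by (rule continuous_on_subset) auto
  qed (use der in auto)
  then show ?thesis by simp
qed

lemma continuous_on_integral_cont2:
  assumes f: "cont2 f"
  shows "continuous_on S (\<lambda>s. integral {a..b} (f s))"
proof -
  have "continuous_on UNIV (\<lambda>s. integral (cbox a b) (f s))"
    by (rule integral_continuous_on_param)
       (use f in \<open>auto simp: cont2_def split_beta intro: continuous_on_subset\<close>)
  then show ?thesis by (auto intro: continuous_on_subset)
qed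

lemma integral_swap_cont2:
  assumes "cont2 f"
  shows "integral {a..b} (\<lambda>x. integral {c..d} (\<lambda>y. f x y)) = integral {c..d} (\<lambda>y. integral {a..b} (\<lambda>x. f x y))"
  using integral_swap_continuous[of a c b d f] assms
  by (auto simp: cont2_def split_beta intro: continuous_on_subset)

lemma integral_period_shift:
  fixes f :: "real \<Rightarrow> real"
  assumes cont: "continuous_on UNIV f" and per: "\<And>x. f (x + T) = f x" and T: "T > 0"
  shows "integral {a..a + T} f = integral {0..T} f"
proof -
  define F where "F a = integral {0..T} (\<lambda>x. f (a + x))" for a
  have cf: "continuous_on S f" for S using cont continuous_on_subset by blast
  have F: "F a = integral {a..a + T} f" for a
    unfolding F_def using integral_shift_real_ivl[of a "-a" "a + T" f] 
    by (simp add: algebra_simps integral_shift_real_ivl[of "a" "a" "a + T" f, simplified])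
  have comb: "integral {x..y} f + integral {y..z} f = integral {x..z} f" if "x \<le> y" "y \<le> z" for x y z
    by (rule Henstock_Kurzweil_Integration.integral_combine[OF that]) (intro integrable_continuous_real cf)
  obtain k where k: "a + of_int k * T \<in> {0..<T}" using obtain_period_shift[OF T] by blast
  define c where "c = a + of_int k * T"
  have "F a = F c"
    unfolding F_def c_def using periodic_add_of_int[of f T, OF per]
    by (intro integral_cong) (metis add.assoc add.commute)
  also have "\<dots> = integral {c..T} f + integral {T..c + T} f"
    unfolding F using comb[of c T "c + T"] k T by (simp add: c_def)
  also have "integral {T..c + T} f = integral {0..c} (\<lambda>x. f (x + T))"
    using integral_shift_real_ivl[of T T "c + T" f] by simp
  also have "\<dots> = integral {0..c} f" by (simp add: per)
  also have "integral {c..T} f + integral {0..c} f = integral {0..T} f"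
    using k comb[of 0 c T] by (simp add: c_def)
  finally show ?thesis by (simp add: F)
qed

lemma integral_abs_le:
  fixes f :: "real \<Rightarrow> real"
  assumes "continuous_on {a..b} f" "continuous_on {a..b} h" "\<And>x. x \<in> {a..b} \<Longrightarrow> \<bar>f x\<bar> \<le> h x"
  shows "\<bar>integral {a..b} f\<bar> \<le> integral {a..b} h"
  using integral_norm_bound_integral[of f "{a..b}" h] assms by (auto intro: integrable_continuous_real)

lemma integral_subinterval_le:
  fixes f :: "real \<Rightarrow> real"
  assumes "continuous_on {a..b} f" "{c..d} \<subseteq> {a..b}" "\<And>x. x \<in> {a..b} \<Longrightarrow> 0 \<le> f x"
  shows "integral {c..d} f \<le> integral {a..b} f"
  using assms continuous_on_subset[OF assms(1,2)]
  by (intro integral_subset_le integrable_continuous_real) auto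

lemma deriv_diff_le_integral:
  fixes F f h :: "real \<Rightarrow> real"
  assumes F: "\<And>x. (F has_real_derivative f x) (at x)" and f: "\<And>S. continuous_on S f"
    and h: "continuous_on {a..b} h" and le: "\<And>x. x \<in> {a..b} \<Longrightarrow> \<bar>f x\<bar> \<le> h x"
    and xy: "x \<in> {a..b}" "y \<in> {a..b}"
  shows "\<bar>F x - F y\<bar> \<le> integral {a..b} h"
proof -
  have *: "\<bar>F y - F x\<bar> \<le> integral {a..b} h" if "x \<le> y" "x \<in> {a..b}" "y \<in> {a..b}" for x y
  proof -
    have "\<bar>F y - F x\<bar> = \<bar>integral {x..y} f\<bar>"
      using has_integral_FTC[OF that(1) F] by (simp add: integral_unique)
    also have "\<dots> \<le> integral {x..y} h"
      using that le by (intro integral_abs_le f continuous_on_subset[OF h]) auto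
    also have "\<dots> \<le> integral {a..b} h"
      using that le by (intro integral_subinterval_le h) (auto intro: order_trans[OF abs_ge_zero])
    finally show ?thesis .
  qed
  show ?thesis
  proof (cases "x \<le> y")
    case True
    then show ?thesis using *[of x y] xy by (simp add: abs_minus_commute)
  next
    case False
    then show ?thesis using *[of y x] xy by simp
  qed
qed


text \<open>Differentiate \<open>f t y - f t a = \<integral>\<^sub>a\<^sup>y f\<^sub>x\<close> first in \<open>t\<close> under the integral and then in \<open>y\<close>.\<close>

lemma mixed_partials_eq:
  fixes f ft fx ftx fxt :: "real \<Rightarrow> real \<Rightarrow> real"
  assumes ft: "\<And>t x. ((\<lambda>s. f s x) has_real_derivative ft t x) (at t)"
    and fx: "\<And>t x. (f t has_real_derivative fx t x) (at x)"
    and fxt: "\<And>t x. ((\<lambda>s. fx s x) has_real_derivative fxt t x) (at t)"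
    and ftx: "\<And>t x. (ft t has_real_derivative ftx t x) (at x)"
    and cont: "cont2 fx" "cont2 fxt"
  shows "ftx t x = fxt t x"
proof -
  define a where "a = x - 1"
  have eq: "ft t y - ft t a = integral {a..y} (fxt t)" if "a \<le> y" for y
  proof -
    have "(\<lambda>s. integral {a..y} (fx s)) = (\<lambda>s. f s y - f s a)"
      using has_integral_FTC[OF that fx] by (simp add: integral_unique fun_eq_iff)
    then have "((\<lambda>s. f s y - f s a) has_real_derivative integral {a..y} (fxt t)) (at t)"
      using leibniz_cont2[OF fxt cont, of a y t] by simp
    moreover have "((\<lambda>s. f s y - f s a) has_real_derivative ft t y - ft t a) (at t)"
      by (intro DERIV_diff ft)
    ultimately show ?thesis using DERIV_unique by blast
  qed
  have "((\<lambda>y. integral {a..y} (fxt t)) has_real_derivative fxt t x) (at x)"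
    by (rule integral_upper_deriv)
       (auto simp: a_def intro!: cont2_compose[OF cont(2)] continuous_intros)
  then have "((\<lambda>y. ft t y - ft t a) has_real_derivative fxt t x) (at x)"
    by (rule has_field_derivative_transform_within_open[of _ _ _ "{a<..}"]) (auto simp: eq, simp add: a_def)
  moreover have "((\<lambda>y. ft t y - ft t a) has_real_derivative ftx t x - 0) (at x)"
    by (intro DERIV_diff ftx DERIV_const)
  ultimately show ?thesis using DERIV_unique by fastforce
qed

text \<open>In \<open>t = ln r\<close> and the angle \<open>x\<close> the Laplacian is conformal: \<open>U\<^sub>t\<^sub>t + U\<^sub>x\<^sub>x = e\<^sup>2\<^sup>t \<Delta>u\<close>. The first-order terms
and the mixed second derivatives of \<open>u\<close> cancel in this sum.\<close>

locale polar_partials =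
  fixes u :: "real ^ 2 \<Rightarrow> real" and Ut Ux Utt Utx Uxx :: "real \<Rightarrow> real \<Rightarrow> real"
  assumes deriv_t: "\<And>t x. ((\<lambda>s. u (polar (exp s) x)) has_real_derivative Ut t x) (at t)"
    and deriv_x: "\<And>t x. ((\<lambda>y. u (polar (exp t) y)) has_real_derivative Ux t x) (at x)"
    and deriv_tt: "\<And>t x. ((\<lambda>s. Ut s x) has_real_derivative Utt t x) (at t)"
    and deriv_xt: "\<And>t x. ((\<lambda>s. Ux s x) has_real_derivative Utx t x) (at t)"
    and deriv_tx: "\<And>t x. (Ut t has_real_derivative Utx t x) (at x)"
    and deriv_xx: "\<And>t x. (Ux t has_real_derivative Uxx t x) (at x)"
    and cont: "cont2 (\<lambda>t x. u (polar (exp t) x))" "cont2 Ut" "cont2 Ux" "cont2 Utt" "cont2 Utx" "cont2 Uxx"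
    and conformal: "\<And>t x. Utt t x + Uxx t x = exp (2 * t) * laplacian u (polar (exp t) x)"

section \<open>Compactness of almost steady profiles\<close>

lemma continuous_on_Icc_bounded:
  fixes f :: "real \<Rightarrow> real"
  assumes "continuous_on {a..b} f"
  obtains K where "\<And>x. x \<in> {a..b} \<Longrightarrow> \<bar>f x\<bar> \<le> K"
proof -
  obtain K where "\<forall>y\<in>f ` {a..b}. norm y \<le> K"
    using compact_imp_bounded[OF compact_continuous_image[OF assms compact_Icc]]
    unfolding bounded_iff by blast
  then show ?thesis by (intro that[of K]) auto
qed

text \<open>The local form in which the limit equation arises: on each interval of length \<open>T\<close> the function is given by
Taylor's formula with integral remainder, with an unspecified slope \<open>c\<close> at the left end point.\<close>

lemma ode_of_integral_equation:
  fixes w g :: "real \<Rightarrow> real"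
  assumes w: "continuous_on UNIV w" and g: "continuous_on S g" and rng: "\<And>x. w x \<in> S" and T: "T > 0"
    and eq: "\<And>a. \<exists>c. \<forall>x\<in>{a..a + T}. w x = w a + c * (x - a) - integral {a..x} (\<lambda>s. (x - s) * g (w s))"
  shows "\<exists>w'. solves_ode g w w'"
proof -
  have cg: "continuous_on A (\<lambda>s. g (w s))" for A
    using continuous_on_compose2[OF g w] rng continuous_on_subset by blast
  have loc: "(w has_real_derivative c - integral {a..y} (\<lambda>s. g (w s))) (at y)"
    if c: "\<forall>x\<in>{a..a + T}. w x = w a + c * (x - a) - integral {a..x} (\<lambda>s. (x - s) * g (w s))"
      and y: "y \<in> {a<..<a + T}" for a c y
  proof -
    define F where "F x = w a + c * (x - a) - (x * integral {a..x} (\<lambda>s. g (w s)) - integral {a..x} (\<lambda>s. s * g (w s)))" for x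
    have Fw: "F x = w x" if "x \<in> {a<..<a + T}" for x
    proof -
      have "integral {a..x} (\<lambda>s. (x - s) * g (w s)) = integral {a..x} (\<lambda>s. x * g (w s) - s * g (w s))"
        by (simp add: algebra_simps)
      also have "\<dots> = integral {a..x} (\<lambda>s. x * g (w s)) - integral {a..x} (\<lambda>s. s * g (w s))"
        by (intro integral_diff integrable_continuous_real continuous_intros cg)
      finally show ?thesis using bspec[OF c, of x] that by (simp add: F_def)
    qed
    have "(F has_real_derivative c - integral {a..y} (\<lambda>s. g (w s))) (at y)"
      unfolding F_def
      by (rule derivative_eq_intros refl integral_upper_deriv[of a y] continuous_intros cg | use y in simp)+
    then show ?thesis
      by (rule has_field_derivative_transform_within_open[of _ _ _ "{a<..<a + T}"]) (use y Fw in auto)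
  qed
  have "solves_ode g w (deriv w)"
    unfolding solves_ode_def
  proof (intro allI conjI)
    fix x
    define a where "a = x - T / 2"
    obtain c where c: "\<forall>x\<in>{a..a + T}. w x = w a + c * (x - a) - integral {a..x} (\<lambda>s. (x - s) * g (w s))"
      using eq by blast
    have x: "x \<in> {a<..<a + T}" using T by (auto simp: a_def field_simps)
    have d: "deriv w y = c - integral {a..y} (\<lambda>s. g (w s))" if "y \<in> {a<..<a + T}" for y
      using loc[OF c that] by (rule DERIV_imp_deriv)
    show "(w has_real_derivative deriv w x) (at x)"
      using loc[OF c x] d[OF x] by simp
    have "((\<lambda>y. c - integral {a..y} (\<lambda>s. g (w s))) has_real_derivative - g (w x)) (at x)"
      by (rule derivative_eq_intros refl integral_upper_deriv[of a x] cg | use x in simp)+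
    then show "(deriv w has_real_derivative - g (w x)) (at x)"
      by (rule has_field_derivative_transform_within_open[of _ _ _ "{a<..<a + T}"]) (use x d in auto)
  qed
  then show ?thesis by blast
qed

text \<open>By Rolle's theorem \<open>V'\<close> vanishes somewhere in a period, and its variation over a period is at most the
integral of \<open>\<bar>R\<bar> + \<bar>g (V)\<bar>\<close>.\<close>

lemma almost_solutions_equilipschitz:
  fixes V V' R :: "nat \<Rightarrow> real \<Rightarrow> real" and g :: "real \<Rightarrow> real"
  assumes V: "\<And>n x. (V n has_real_derivative V' n x) (at x)"
    and V': "\<And>n x. (V' n has_real_derivative R n x - g (V n x)) (at x)"
    and R: "\<And>n. continuous_on UNIV (R n)"
    and g: "continuous_on {c1..c2} g" and rng: "\<And>n x. V n x \<in> {c1..c2}"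
    and T: "T > 0" and per: "\<And>n x. V n (x + T) = V n x"
    and lim: "(\<lambda>n. integral {0..T} (\<lambda>x. \<bar>R n x\<bar>)) \<longlonglongrightarrow> 0"
  obtains B where "\<And>n x y. \<bar>V n x - V n y\<bar> \<le> B * \<bar>x - y\<bar>"
proof -
  have cV: "continuous_on S (V n)" for S n
    using V by (meson DERIV_isCont continuous_at_imp_continuous_on)
  have cg: "continuous_on S (\<lambda>x. g (V n x))" for S n
    using continuous_on_compose2[OF g cV] rng by blast
  have cR: "continuous_on S (R n)" for S n using R continuous_on_subset by blast
  obtain K where K: "\<And>x. x \<in> {c1..c2} \<Longrightarrow> \<bar>g x\<bar> \<le> K"
    using continuous_on_Icc_bounded[OF g] by blast
  obtain B0 where B0: "\<And>n. \<bar>integral {0..T} (\<lambda>x. \<bar>R n x\<bar>)\<bar> \<le> B0"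
    using convergent_imp_Bseq[OF convergentI[OF lim]] by (auto simp: Bseq_def)
  define B where "B = B0 + K * T"
  have V'per: "V' n (x + T) = V' n x" for n x by (rule periodic_deriv[OF V per])
  have B1: "\<bar>V' n x\<bar> \<le> B" if x: "x \<in> {0..T}" for n x
  proof -
    have "\<exists>z. 0 < z \<and> z < T \<and> (V n has_real_derivative 0) (at z)"
    proof (rule Rolle[OF T])
      show "V n 0 = V n T" using per[of n 0] by simp
      show "continuous_on {0..T} (V n)" by (rule cV)
      show "V n differentiable (at x)" for x using V real_differentiable_def by blast
    qed
    then obtain z where z: "0 < z" "z < T" "V' n z = 0" using V DERIV_unique by blast
    have "\<bar>V' n x - V' n z\<bar> \<le> integral {0..T} (\<lambda>x. \<bar>R n x\<bar> + K)"
    proof (rule deriv_diff_le_integral[OF V'])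
      show "\<bar>R n x - g (V n x)\<bar> \<le> \<bar>R n x\<bar> + K" for x
        using K[OF rng[of n x]] by linarith
    qed (use x z in \<open>auto intro!: continuous_intros cg cR\<close>)
    also have "\<dots> = integral {0..T} (\<lambda>x. \<bar>R n x\<bar>) + integral {0..T} (\<lambda>x. K)"
      by (intro integral_add integrable_continuous_real continuous_intros cR)
    also have "\<dots> \<le> B" using B0[of n] T by (simp add: B_def)
    finally show ?thesis by (simp add: z)
  qed
  have B2: "\<bar>V' n x\<bar> \<le> B" for n x
  proof -
    obtain k where "x + of_int k * T \<in> {0..<T}" using obtain_period_shift[OF T] by blast
    then show ?thesis using B1[of "x + of_int k * T" n] periodic_add_of_int[of "V' n" T x k] V'per by simp
  qed
  have "norm (V n x - V n y) \<le> B * norm (x - y)" for n x y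
    by (rule field_differentiable_bound[of UNIV]) (use V B2 in auto)
  then show ?thesis using that[of B] by simp
qed

text \<open>Arzela-Ascoli gives a limit of the functions. Their slopes \<open>V' n a\<close> converge as well, because Taylor's
formula over a period expresses them through values of \<open>V n\<close> and integrals that converge.\<close>

lemma almost_solutions_converge:
  fixes V V' R :: "nat \<Rightarrow> real \<Rightarrow> real" and g :: "real \<Rightarrow> real"
  assumes V: "\<And>n x. (V n has_real_derivative V' n x) (at x)"
    and V': "\<And>n x. (V' n has_real_derivative R n x - g (V n x)) (at x)"
    and R: "\<And>n. continuous_on UNIV (R n)"
    and g: "continuous_on {c1..c2} g" and rng: "\<And>n x. V n x \<in> {c1..c2}"
    and T: "T > 0" and per: "\<And>n x. V n (x + T) = V n x"
    and lim: "(\<lambda>n. integral {0..T} (\<lambda>x. \<bar>R n x\<bar>)) \<longlonglongrightarrow> 0"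
  obtains r w w' where "strict_mono (r :: nat \<Rightarrow> nat)" "\<And>x. (\<lambda>n. V (r n) x) \<longlonglongrightarrow> w x" "solves_ode g w w'"
    "\<And>x. w x \<in> {c1..c2}" "\<And>x. w (x + T) = w x"
proof -
  have cV: "continuous_on S (V n)" for S n
    using V by (meson DERIV_isCont continuous_at_imp_continuous_on)
  have cg: "continuous_on S (\<lambda>x. g (V n x))" for S n
    using continuous_on_compose2[OF g cV] rng by blast
  have cR: "continuous_on S (R n)" for S n using R continuous_on_subset by blast
  obtain K where K: "\<And>x. x \<in> {c1..c2} \<Longrightarrow> \<bar>g x\<bar> \<le> K"
    using continuous_on_Icc_bounded[OF g] by blast
  obtain B where B: "\<And>n x y. \<bar>V n x - V n y\<bar> \<le> B * \<bar>x - y\<bar>"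
    using almost_solutions_equilipschitz[OF V V' R g rng T per lim] by blast
  have "\<bar>V 0 0 - V 0 1\<bar> \<le> B" using B[of 0 0 1] by simp
  then have B0: "B \<ge> 0" by linarith
  have "\<exists>w0 r. strict_mono (r :: nat \<Rightarrow> nat) \<and>
      (\<forall>e. 0 < e \<longrightarrow> (\<exists>N. \<forall>n x. n \<ge> N \<and> x \<in> {0..T} \<longrightarrow> norm (V (r n) x - w0 x) < e))"
  proof (rule Arzela_Ascoli[of "{0..T}" V "max \<bar>c1\<bar> \<bar>c2\<bar>"])
    show "norm (V n x) \<le> max \<bar>c1\<bar> \<bar>c2\<bar>" for n x
      using rng[of n x] by auto
    show "\<exists>d. 0 < d \<and> (\<forall>n y. y \<in> {0..T} \<and> norm (x - y) < d \<longrightarrow> norm (V n x - V n y) < e)"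
      if "0 < e" for x e
    proof (intro exI[of _ "e / (B + 1)"] conjI allI impI)
      fix n y assume "y \<in> {0..T} \<and> norm (x - y) < e / (B + 1)"
      then have "(B + 1) * \<bar>x - y\<bar> < e" using B0 by (simp add: field_simps)
      moreover have "\<bar>V n x - V n y\<bar> \<le> (B + 1) * \<bar>x - y\<bar>"
        using B[of n x y] mult_right_mono[of B "B + 1" "\<bar>x - y\<bar>"] by linarith
      ultimately show "norm (V n x - V n y) < e" by simp
    qed (use that B0 in simp)
    fix w0 :: "real \<Rightarrow> real" and r :: "nat \<Rightarrow> nat"
    assume "strict_mono r"
      "\<And>e. 0 < e \<Longrightarrow> \<exists>N. \<forall>n x. n \<ge> N \<and> x \<in> {0..T} \<longrightarrow> norm (V (r n) x - w0 x) < e"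
    then show ?thesis by blast
  qed (rule compact_Icc)
  then obtain w0 r where r: "strict_mono (r :: nat \<Rightarrow> nat)"
    and w0: "\<And>e. 0 < e \<Longrightarrow> \<exists>N. \<forall>n x. n \<ge> N \<and> x \<in> {0..T} \<longrightarrow> norm (V (r n) x - w0 x) < e"
    by blast
  define w where "w x = lim (\<lambda>n. V (r n) x)" for x
  have w: "(\<lambda>n. V (r n) x) \<longlonglongrightarrow> w x" for x
  proof -
    obtain k where k: "x + of_int k * T \<in> {0..<T}" using obtain_period_shift[OF T] by blast
    have "V n (x + of_int k * T) = V n x" for n by (rule periodic_add_of_int) (rule per)
    moreover have "(\<lambda>n. V (r n) (x + of_int k * T)) \<longlonglongrightarrow> w0 (x + of_int k * T)"
    proof (rule LIMSEQ_I)
      fix e :: real assume "0 < e"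
      from w0[OF this] obtain N where "\<forall>n x. n \<ge> N \<and> x \<in> {0..T} \<longrightarrow> norm (V (r n) x - w0 x) < e" ..
      then show "\<exists>N. \<forall>n\<ge>N. norm (V (r n) (x + of_int k * T) - w0 (x + of_int k * T)) < e"
        using k by (intro exI[of _ N]) auto
    qed
    ultimately have *: "(\<lambda>n. V (r n) x) \<longlonglongrightarrow> w0 (x + of_int k * T)" by simp
    show ?thesis unfolding w_def limI[OF *] by (rule *)
  qed
  have wrng: "w x \<in> {c1..c2}" for x
    by (rule closed_sequentially[OF closed_atLeastAtMost _ w]) (rule rng)
  have wper: "w (x + T) = w x" for x by (simp add: w_def per)
  have wB: "\<bar>w x - w y\<bar> \<le> B * \<bar>x - y\<bar>" for x y
    by (rule LIMSEQ_le_const2[OF tendsto_rabs[OF tendsto_diff[OF w w]]]) (use B in blast)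
  have wc: "continuous_on UNIV w"
  proof (rule lipschitz_on_continuous_on)
    show "B-lipschitz_on UNIV w"
      using wB B0 by (intro lipschitz_onI) (auto simp: dist_real_def)
  qed
  have glim: "(\<lambda>n. g (V (r n) x)) \<longlonglongrightarrow> g (w x)" for x
    by (rule continuous_on_tendsto_compose[OF g w wrng]) (use rng in auto)
  \<comment> \<open>pass to the limit in Taylor's formula for \<open>V n\<close> on \<open>[a, a + T]\<close>\<close>
  have "\<exists>c. \<forall>x\<in>{a..a + T}. w x = w a + c * (x - a) - integral {a..x} (\<lambda>s. (x - s) * g (w s))" for a
  proof -
    have Vint: "V n x = V n a + V' n a * (x - a) + integral {a..x} (\<lambda>s. (x - s) * R n s)
                  - integral {a..x} (\<lambda>s. (x - s) * g (V n s))" if "a \<le> x" for n x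
    proof -
      have "((\<lambda>s. (x - s) * (R n s - g (V n s))) has_integral
              ((V n x + V' n x * (x - x)) - (V n a + V' n a * (x - a)))) {a..x}"
      proof (rule has_integral_FTC[OF that])
        fix s
        show "((\<lambda>s. V n s + V' n s * (x - s)) has_real_derivative (x - s) * (R n s - g (V n s))) (at s)"
          by (rule derivative_eq_intros refl V V' | simp)+
      qed
      then have "V n x - (V n a + V' n a * (x - a)) = integral {a..x} (\<lambda>s. (x - s) * R n s - (x - s) * g (V n s))"
        by (simp add: integral_unique right_diff_distrib)
      also have "\<dots> = integral {a..x} (\<lambda>s. (x - s) * R n s) - integral {a..x} (\<lambda>s. (x - s) * g (V n s))"
        by (intro integral_diff integrable_continuous_real continuous_intros cR cg)
      finally show ?thesis by simp
    qed
    have Rper: "R n (x + T) = R n x" for n x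
      using periodic_deriv[OF V' periodic_deriv[OF V per], of n x] per[of n x] by simp
    have Rlim: "(\<lambda>n. integral {a..x} (\<lambda>s. (x - s) * R (r n) s)) \<longlonglongrightarrow> 0" if x: "x \<in> {a..a + T}" for x
    proof (rule Lim_null_comparison)
      have "(\<lambda>n. T * integral {0..T} (\<lambda>x. \<bar>R (r n) x\<bar>)) \<longlonglongrightarrow> T * 0"
        using LIMSEQ_subseq_LIMSEQ[OF lim r] by (intro tendsto_intros) (simp add: o_def)
      then show "(\<lambda>n. T * integral {0..T} (\<lambda>x. \<bar>R (r n) x\<bar>)) \<longlonglongrightarrow> 0" by simp
      have "norm (integral {a..x} (\<lambda>s. (x - s) * R n s)) \<le> T * integral {0..T} (\<lambda>x. \<bar>R n x\<bar>)" for n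
      proof -
        have "\<bar>integral {a..x} (\<lambda>s. (x - s) * R n s)\<bar> \<le> integral {a..x} (\<lambda>s. T * \<bar>R n s\<bar>)"
          using x by (intro integral_abs_le continuous_intros cR) (auto simp: abs_mult intro!: mult_right_mono)
        also have "\<dots> \<le> integral {a..a + T} (\<lambda>s. T * \<bar>R n s\<bar>)"
          using x T by (intro integral_subinterval_le continuous_intros cR) auto
        also have "\<dots> = T * integral {a..a + T} (\<lambda>s. \<bar>R n s\<bar>)" by simp
        also have "integral {a..a + T} (\<lambda>s. \<bar>R n s\<bar>) = integral {0..T} (\<lambda>s. \<bar>R n s\<bar>)"
          by (rule integral_period_shift) (use Rper T in \<open>auto intro!: continuous_intros cR\<close>)
        finally show ?thesis by simp
      qed
      then show "\<forall>\<^sub>F n in sequentially. norm (integral {a..x} (\<lambda>s. (x - s) * R (r n) s))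
                   \<le> T * integral {0..T} (\<lambda>x. \<bar>R (r n) x\<bar>)" by simp
    qed
    have gint: "(\<lambda>n. integral {a..x} (\<lambda>s. (x - s) * g (V (r n) s))) \<longlonglongrightarrow> integral {a..x} (\<lambda>s. (x - s) * g (w s))"
      if x: "x \<in> {a..a + T}" for x
    proof (rule dominated_convergence(2)[where h = "\<lambda>s. T * K"])
      show "(\<lambda>s. (x - s) * g (V (r n) s)) integrable_on {a..x}" for n
        by (intro integrable_continuous_real continuous_intros cg)
      show "norm ((x - s) * g (V (r n) s)) \<le> T * K" if "s \<in> {a..x}" for n s
        using that x K[OF rng] by (auto simp: abs_mult intro!: mult_mono)
      show "(\<lambda>n. (x - s) * g (V (r n) s)) \<longlonglongrightarrow> (x - s) * g (w s)" for s
        by (intro tendsto_intros glim)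
    qed auto
    \<comment> \<open>the limit of \<open>V' n a\<close>, read off from the formula at the right end point\<close>
    define c where "c = (w (a + T) - w a + integral {a..a + T} (\<lambda>s. (a + T - s) * g (w s))) / T"
    have c: "(\<lambda>n. V' (r n) a) \<longlonglongrightarrow> c"
    proof -
      have "V' n a = (V n (a + T) - V n a - integral {a..a + T} (\<lambda>s. (a + T - s) * R n s)
              + integral {a..a + T} (\<lambda>s. (a + T - s) * g (V n s))) / T" for n
        using Vint[of "a + T" n] T by (simp add: field_simps)
      moreover have "(\<lambda>n. (V (r n) (a + T) - V (r n) a - integral {a..a + T} (\<lambda>s. (a + T - s) * R (r n) s)
              + integral {a..a + T} (\<lambda>s. (a + T - s) * g (V (r n) s))) / T)
         \<longlonglongrightarrow> (w (a + T) - w a - 0 + integral {a..a + T} (\<lambda>s. (a + T - s) * g (w s))) / T"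
        using T by (intro tendsto_intros w Rlim gint) auto
      ultimately show ?thesis by (simp add: c_def)
    qed
    show ?thesis
    proof (intro exI[of _ c] ballI)
      fix x assume x: "x \<in> {a..a + T}"
      have "(\<lambda>n. V (r n) a + V' (r n) a * (x - a) + integral {a..x} (\<lambda>s. (x - s) * R (r n) s)
                  - integral {a..x} (\<lambda>s. (x - s) * g (V (r n) s)))
            \<longlonglongrightarrow> w a + c * (x - a) + 0 - integral {a..x} (\<lambda>s. (x - s) * g (w s))"
        by (intro tendsto_intros w c Rlim gint x)
      then have "(\<lambda>n. V (r n) x) \<longlonglongrightarrow> w a + c * (x - a) + 0 - integral {a..x} (\<lambda>s. (x - s) * g (w s))"
        using Vint[of x] x by simp
      then show "w x = w a + c * (x - a) - integral {a..x} (\<lambda>s. (x - s) * g (w s))"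
        using LIMSEQ_unique[OF w[of x]] by simp
    qed
  qed
  then obtain w' where "solves_ode g w w'"
    using ode_of_integral_equation[OF wc g wrng T] by blast
  then show ?thesis using that r w wrng wper by blast
qed

section \<open>Bounded entire solutions on the cylinder are stationary\<close>

text \<open>A weight on \<open>[-1, 1]\<close> of total mass \<open>1\<close> that vanishes at both ends together with its derivative, so that
two integrations by parts produce no boundary terms. A polynomial suffices, since all integrals below are
taken over \<open>[-1, 1]\<close>.\<close>

definition bump :: "real \<Rightarrow> real" where "bump t = 15 / 16 * (1 - t\<^sup>2)\<^sup>2"
definition bump' :: "real \<Rightarrow> real" where "bump' t = - (15 / 4) * t * (1 - t\<^sup>2)"
definition bump'' :: "real \<Rightarrow> real" where "bump'' t = - (15 / 4) * (1 - 3 * t\<^sup>2)"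

lemma bump_deriv: "(bump has_real_derivative bump' t) (at t)" "(bump' has_real_derivative bump'' t) (at t)"
proof -
  show "(bump has_real_derivative bump' t) (at t)"
    unfolding bump_def[abs_def] bump'_def
    by (auto intro!: derivative_eq_intros simp: field_simps)
  show "(bump' has_real_derivative bump'' t) (at t)"
    unfolding bump'_def[abs_def] bump''_def
    by (auto intro!: derivative_eq_intros simp: field_simps power2_eq_square)
qed

lemma continuous_bump [continuous_intros]:
  assumes "continuous_on S f"
  shows "continuous_on S (\<lambda>x. bump (f x))" "continuous_on S (\<lambda>x. bump' (f x))" "continuous_on S (\<lambda>x. bump'' (f x))"
  unfolding bump_def bump'_def bump''_def by (intro continuous_intros assms)+

lemma bump_ends [simp]: "bump (- 1) = 0" "bump 1 = 0" "bump' (- 1) = 0" "bump' 1 = 0"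
  by (simp_all add: bump_def bump'_def)

lemma bump_nonneg [simp]: "0 \<le> bump t" by (simp add: bump_def)

lemma bump_bounds:
  assumes "t \<in> {-1..1}"
  shows "\<bar>bump t\<bar> \<le> 1" "\<bar>bump' t\<bar> \<le> 15 / 4" "\<bar>bump'' t\<bar> \<le> 15 / 2"
proof -
  have t: "\<bar>t\<bar> \<le> 1" using assms by auto
  then have t2: "0 \<le> t\<^sup>2" "t\<^sup>2 \<le> 1" by (simp_all add: abs_square_le_1)
  have "(1 - t\<^sup>2)\<^sup>2 \<le> 1" using t2 by (intro power_le_one) auto
  then show "\<bar>bump t\<bar> \<le> 1" by (simp add: bump_def)
  have "\<bar>t\<bar> * \<bar>1 - t\<^sup>2\<bar> \<le> 1 * 1" using t t2 by (intro mult_mono) auto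
  then show "\<bar>bump' t\<bar> \<le> 15 / 4" by (simp add: bump'_def abs_mult)
  show "\<bar>bump'' t\<bar> \<le> 15 / 2"
  proof -
    have "\<bar>1 - 3 * t\<^sup>2\<bar> \<le> 2" unfolding abs_le_iff using t2 by linarith
    then show ?thesis unfolding bump''_def abs_mult by simp
  qed
qed

lemma bump_integral: "(bump has_integral 1) {-1..1}"
proof -
  have "(bump has_integral ((\<lambda>t. 15 / 16 * (t - 2 / 3 * t ^ 3 + t ^ 5 / 5)) 1
      - (\<lambda>t. 15 / 16 * (t - 2 / 3 * t ^ 3 + t ^ 5 / 5)) (- 1))) {-1..1}"
  proof (rule has_integral_FTC)
    show "((\<lambda>t. 15 / 16 * (t - 2 / 3 * t ^ 3 + t ^ 5 / 5)) has_real_derivative bump x) (at x)" for x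
      unfolding bump_def
      by (rule derivative_eq_intros refl | simp)+ (simp add: algebra_simps power2_eq_square power4_eq_xxxx)
  qed simp
  then show ?thesis by simp
qed

lemma bump_by_parts:
  fixes F f :: "real \<Rightarrow> real"
  assumes F: "\<And>t. (F has_real_derivative f t) (at t)" and f: "\<And>S. continuous_on S f"
  shows "integral {-1..1} (\<lambda>t. bump t * f (s + t)) = - integral {-1..1} (\<lambda>t. bump' t * F (s + t))"
    and "integral {-1..1} (\<lambda>t. bump' t * f (s + t)) = - integral {-1..1} (\<lambda>t. bump'' t * F (s + t))"
proof -
  have cF: "continuous_on S F" for S
    using F by (meson DERIV_isCont continuous_at_imp_continuous_on)
  have cF': "continuous_on S (\<lambda>t. F (s + t))" "continuous_on S (\<lambda>t. f (s + t))" for S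
    by (auto intro!: continuous_on_compose2[OF cF[of UNIV]] continuous_on_compose2[OF f[of UNIV]] continuous_intros)
  have dF: "((\<lambda>t. F (s + t)) has_real_derivative f (s + t)) (at t)" for t
    using DERIV_shift[of F "f (s + t)" t s] F[of "t + s"] by (simp add: add.commute)
  have *: "integral {-1..1} (\<lambda>t. h t * f (s + t)) = - integral {-1..1} (\<lambda>t. h' t * F (s + t))"
    if h: "\<And>t. (h has_real_derivative h' t) (at t)" "h (- 1) = 0" "h 1 = 0" "continuous_on {-1..1} h'" for h h' :: "real \<Rightarrow> real"
  proof -
    have ch: "continuous_on {-1..1} h"
      using h(1) by (meson DERIV_isCont continuous_at_imp_continuous_on)
    have "((\<lambda>t. h t * f (s + t) + h' t * F (s + t)) has_integral (h 1 * F (s + 1) - h (- 1) * F (s + (- 1)))) {-1..1}"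
    proof (rule has_integral_FTC)
      show "((\<lambda>t. h t * F (s + t)) has_real_derivative h t * f (s + t) + h' t * F (s + t)) (at t)" for t
        by (rule derivative_eq_intros refl h(1) dF | simp)+
    qed simp
    then have "integral {-1..1} (\<lambda>t. h t * f (s + t) + h' t * F (s + t)) = 0"
      using h by (simp add: integral_unique)
    moreover have "integral {-1..1} (\<lambda>t. h t * f (s + t) + h' t * F (s + t))
       = integral {-1..1} (\<lambda>t. h t * f (s + t)) + integral {-1..1} (\<lambda>t. h' t * F (s + t))"
      by (intro integral_add integrable_continuous_real continuous_intros ch h(4) cF')
    ultimately show ?thesis by simp
  qed
  show "integral {-1..1} (\<lambda>t. bump t * f (s + t)) = - integral {-1..1} (\<lambda>t. bump' t * F (s + t))"
    by (rule *) (auto intro!: bump_deriv continuous_intros)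
  show "integral {-1..1} (\<lambda>t. bump' t * f (s + t)) = - integral {-1..1} (\<lambda>t. bump'' t * F (s + t))"
    by (rule *) (auto intro!: bump_deriv continuous_intros)
qed

text \<open>A \<open>C\<^sup>2\<close> solution of \<open>v\<^sub>t\<^sub>t + 2 b v\<^sub>t + v\<^sub>x\<^sub>x + g (v) = 0\<close>, periodic in \<open>x\<close>, for all times \<open>t\<close>, with
values in a compact interval on which \<open>g\<close> is \<open>C\<^sup>1\<close>. The partial derivatives are separate functions, and the
symmetry of the mixed ones is expressed by the single function \<open>vtx\<close>.\<close>

locale damped_cylinder =
  fixes v vt vx vtt vtx vxx :: "real \<Rightarrow> real \<Rightarrow> real" and g g' G :: "real \<Rightarrow> real" and b c1 c2 :: real
  assumes vt: "\<And>t x. ((\<lambda>s. v s x) has_real_derivative vt t x) (at t)"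
    and vx: "\<And>t x. (v t has_real_derivative vx t x) (at x)"
    and vtt: "\<And>t x. ((\<lambda>s. vt s x) has_real_derivative vtt t x) (at t)"
    and vxt: "\<And>t x. ((\<lambda>s. vx s x) has_real_derivative vtx t x) (at t)"
    and vtx: "\<And>t x. (vt t has_real_derivative vtx t x) (at x)"
    and vxx: "\<And>t x. (vx t has_real_derivative vxx t x) (at x)"
    and cont: "cont2 v" "cont2 vt" "cont2 vx" "cont2 vtt" "cont2 vtx" "cont2 vxx"
    and per: "\<And>t x. v t (x + 2 * pi) = v t x"
    and eq: "\<And>t x. vtt t x + 2 * b * vt t x + vxx t x + g (v t x) = 0"
    and b: "b > 0"
    and rng: "\<And>t x. v t x \<in> {c1..c2}"
    and G: "\<And>y. y \<in> {c1..c2} \<Longrightarrow> (G has_real_derivative g y) (at y)"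
    and g: "\<And>y. y \<in> {c1..c2} \<Longrightarrow> (g has_real_derivative g' y) (at y)"
    and g': "continuous_on {c1..c2} g'"
begin

lemma cont_g: "continuous_on {c1..c2} g"
  using g by (meson DERIV_isCont continuous_at_imp_continuous_on)

lemma cont_G: "continuous_on {c1..c2} G"
  using G by (meson DERIV_isCont continuous_at_imp_continuous_on)

lemmas [continuous_intros] = cont[THEN cont2_compose]

lemma continuous_composed [continuous_intros]:
  assumes "continuous_on S p" "continuous_on S q"
  shows "continuous_on S (\<lambda>z. g (v (p z) (q z)))" "continuous_on S (\<lambda>z. G (v (p z) (q z)))"
  using cont2_compose[OF cont(1) assms] rng
  by (auto intro: continuous_on_compose2[OF cont_g] continuous_on_compose2[OF cont_G])

lemma periodic_derivs: "vt t (x + 2 * pi) = vt t x" "vx t (x + 2 * pi) = vx t x"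
proof -
  show "vx t (x + 2 * pi) = vx t x" by (rule periodic_deriv[OF vx per])
  have "((\<lambda>s. v s x) has_real_derivative vt t (x + 2 * pi)) (at t)"
    using vt[of "x + 2 * pi" t] by (simp add: per)
  then show "vt t (x + 2 * pi) = vt t x" using vt DERIV_unique by blast
qed

definition J :: "(real \<Rightarrow> real) \<Rightarrow> real" where "J f = integral {0..2 * pi} f"

text \<open>The density that remains of the energy density \<open>G (v) + (v\<^sub>t\<^sup>2 - v\<^sub>x\<^sup>2) / 2\<close> of a steady profile when
\<open>\<integral> v\<^sub>x\<^sup>2 = \<integral> v g (v)\<close> is used to eliminate the derivative.\<close>

definition H :: "real \<Rightarrow> real" where "H y = G y - y * g y / 2"

text \<open>The functions of time that carry the argument: the dissipation \<open>D\<close>, its angular counterpart \<open>X\<close>, the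
energy \<open>E\<close>, half the squared norm \<open>A\<close> of \<open>v\<close> in \<open>L\<^sup>2\<close> with its two derivatives, and the operator \<open>W\<close> that
averages a function of time over \<open>[s - 1, s + 1]\<close>.\<close>

definition D where "D t = J (\<lambda>x. (vt t x)\<^sup>2)"
definition X where "X t = J (\<lambda>x. (vx t x)\<^sup>2)"
definition E where "E t = J (\<lambda>x. (vt t x)\<^sup>2 / 2 - (vx t x)\<^sup>2 / 2 + G (v t x))"
definition A where "A t = J (\<lambda>x. (v t x)\<^sup>2 / 2)"
definition A' where "A' t = J (\<lambda>x. v t x * vt t x)"
definition A'' where "A'' t = J (\<lambda>x. (vt t x)\<^sup>2 + v t x * vtt t x)"
definition W :: "(real \<Rightarrow> real) \<Rightarrow> real \<Rightarrow> real" where "W f s = integral {-1..1} (\<lambda>t. bump t * f (s + t))"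

lemma J_add: "continuous_on {0..2*pi} f \<Longrightarrow> continuous_on {0..2*pi} h \<Longrightarrow> J (\<lambda>x. f x + h x) = J f + J h"
  unfolding J_def by (intro integral_add integrable_continuous_real)

lemma J_cmult: "J (\<lambda>x. c * f x) = c * J f"
  unfolding J_def by simp

lemma J_linear:
  assumes "continuous_on {0..2*pi} f" "continuous_on {0..2*pi} h" "continuous_on {0..2*pi} k" "continuous_on {0..2*pi} l"
  shows "J (\<lambda>x. p * f x + q * h x + r * k x + u * l x) = p * J f + q * J h + r * J k + u * J l"
proof -
  have c: "continuous_on {0..2*pi} (\<lambda>x. p * f x)" "continuous_on {0..2*pi} (\<lambda>x. q * h x)"
    "continuous_on {0..2*pi} (\<lambda>x. r * k x)" "continuous_on {0..2*pi} (\<lambda>x. u * l x)"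
    by (intro continuous_intros assms)+
  show ?thesis
    unfolding J_add[OF continuous_on_add[OF continuous_on_add[OF c(1,2)] c(3)] c(4)]
      J_add[OF continuous_on_add[OF c(1,2)] c(3)] J_add[OF c(1,2)] J_cmult by (rule refl)
qed

lemma J_mono: "continuous_on {0..2*pi} f \<Longrightarrow> continuous_on {0..2*pi} h \<Longrightarrow> (\<And>x. f x \<le> h x) \<Longrightarrow> J f \<le> J h"
  unfolding J_def by (intro integral_le integrable_continuous_real)

lemma J_deriv_periodic:
  assumes "\<And>x. (F has_real_derivative f x) (at x)" "F (2 * pi) = F 0"
  shows "J f = 0"
  using has_integral_FTC[of 0 "2 * pi" F f] assms by (simp add: J_def integral_unique)

lemma J_leibniz:
  assumes "\<And>t x. ((\<lambda>s. f s x) has_real_derivative f' t x) (at t)"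
    and "continuous_on UNIV (\<lambda>z. f (fst z) (snd z))" "continuous_on UNIV (\<lambda>z. f' (fst z) (snd z))"
  shows "((\<lambda>t. J (f t)) has_real_derivative J (f' t)) (at t)"
  unfolding J_def by (rule leibniz_cont2) (use assms in \<open>auto simp: cont2_def\<close>)

lemma J_continuous:
  fixes f :: "real \<Rightarrow> real \<Rightarrow> real"
  assumes "continuous_on UNIV (\<lambda>z. f (fst z) (snd z))"
  shows "continuous_on S (\<lambda>t. J (f t))"
  unfolding J_def by (rule continuous_on_integral_cont2) (use assms in \<open>auto simp: cont2_def\<close>)

text \<open>After differentiation under the integral, the equation turns the integrand into \<open>- 2 b v\<^sub>t\<^sup>2\<close> minus the
\<open>x\<close>-derivative of \<open>v\<^sub>x v\<^sub>t\<close>, which integrates to zero over a period.\<close>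

lemma energy_deriv: "(E has_real_derivative - 2 * b * D t) (at t)"
proof -
  have dG: "((\<lambda>s. G (v s x)) has_real_derivative g (v t x) * vt t x) (at t)" for t x
    by (rule DERIV_chain2[OF G[OF rng] vt])
  have "(E has_real_derivative J (\<lambda>x. vt t x * vtt t x - vx t x * vtx t x + g (v t x) * vt t x)) (at t)"
    unfolding E_def[abs_def]
  proof (rule J_leibniz)
    show "((\<lambda>s. (vt s x)\<^sup>2 / 2 - (vx s x)\<^sup>2 / 2 + G (v s x)) has_real_derivative
        vt t x * vtt t x - vx t x * vtx t x + g (v t x) * vt t x) (at t)" for t x
      by (rule refl dG vtt vxt derivative_eq_intros | simp)+
  qed (intro continuous_intros; simp)+
  also have "(\<lambda>x. vt t x * vtt t x - vx t x * vtx t x + g (v t x) * vt t x)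
      = (\<lambda>x. (- 2 * b) * (vt t x)\<^sup>2 + (- 1) * (vx t x * vtx t x + vxx t x * vt t x))"
  proof
    fix x
    have *: "g (v t x) = - vtt t x - 2 * b * vt t x - vxx t x" using eq[of t x] by simp
    show "vt t x * vtt t x - vx t x * vtx t x + g (v t x) * vt t x
      = (- 2 * b) * (vt t x)\<^sup>2 + (- 1) * (vx t x * vtx t x + vxx t x * vt t x)"
      unfolding * by (simp add: algebra_simps power2_eq_square)
  qed
  also have "J \<dots> = (- 2 * b) * D t + (- 1) * J (\<lambda>x. vx t x * vtx t x + vxx t x * vt t x)"
    unfolding D_def J_cmult[symmetric] by (intro J_add continuous_intros)
  also have "J (\<lambda>x. vx t x * vtx t x + vxx t x * vt t x) = 0"
  proof (rule J_deriv_periodic)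
    show "((\<lambda>x. vx t x * vt t x) has_real_derivative vx t x * vtx t x + vxx t x * vt t x) (at x)" for x
      by (rule refl vtx vxx derivative_eq_intros | simp)+
    show "vx t (2 * pi) * vt t (2 * pi) = vx t 0 * vt t 0"
      using periodic_derivs[of t 0] by simp
  qed
  finally show ?thesis by simp
qed

lemma A_deriv: "(A has_real_derivative A' t) (at t)" "(A' has_real_derivative A'' t) (at t)"
proof -
  show "(A has_real_derivative A' t) (at t)"
    unfolding A_def[abs_def] A'_def
  proof (rule J_leibniz)
    show "((\<lambda>s. (v s x)\<^sup>2 / 2) has_real_derivative v t x * vt t x) (at t)" for t x
      by (rule refl vt derivative_eq_intros | simp)+
  qed (intro continuous_intros; simp)+
  show "(A' has_real_derivative A'' t) (at t)"
    unfolding A'_def[abs_def] A''_def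
  proof (rule J_leibniz)
    show "((\<lambda>s. v s x * vt s x) has_real_derivative (vt t x)\<^sup>2 + v t x * vtt t x) (at t)" for t x
      by (rule refl vt vtt derivative_eq_intros | simp add: power2_eq_square)+
  qed (intro continuous_intros; simp)+
qed

lemma continuous_1d:
  "continuous_on S D" "continuous_on S X" "continuous_on S E" "continuous_on S A" "continuous_on S A'" "continuous_on S A''"
  "continuous_on S (\<lambda>t. J (\<lambda>x. v t x * g (v t x)))" "continuous_on S (\<lambda>t. J (\<lambda>x. H (v t x)))"
  unfolding D_def[abs_def] X_def[abs_def] E_def[abs_def] A_def[abs_def] A'_def[abs_def] A''_def[abs_def] H_def
  by (intro J_continuous continuous_intros; simp)+

text \<open>The equation tested with \<open>v\<close>.\<close>

lemma virial_identity: "A'' t + 2 * b * A' t + J (\<lambda>x. v t x * g (v t x)) = D t + X t"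
proof -
  have "J (\<lambda>x. v t x * vxx t x + (vx t x)\<^sup>2) = 0"
  proof (rule J_deriv_periodic)
    show "((\<lambda>x. v t x * vx t x) has_real_derivative v t x * vxx t x + (vx t x)\<^sup>2) (at x)" for x
      by (rule refl vx vxx derivative_eq_intros | simp add: power2_eq_square)+
    show "v t (2 * pi) * vx t (2 * pi) = v t 0 * vx t 0"
      using periodic_derivs[of t 0] per[of t 0] by simp
  qed
  moreover have "J (\<lambda>x. 1 * ((vt t x)\<^sup>2 + v t x * vtt t x) + (2 * b) * (v t x * vt t x) + 1 * (v t x * g (v t x))
        + 1 * (v t x * vxx t x + (vx t x)\<^sup>2))
      = 1 * A'' t + (2 * b) * A' t + 1 * J (\<lambda>x. v t x * g (v t x)) + 1 * J (\<lambda>x. v t x * vxx t x + (vx t x)\<^sup>2)"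
    (is "J ?f = _")
    unfolding A''_def A'_def by (intro J_linear continuous_intros)
  moreover have "?f = (\<lambda>x. (vt t x)\<^sup>2 + (vx t x)\<^sup>2)"
  proof
    fix x
    have *: "g (v t x) = - vtt t x - 2 * b * vt t x - vxx t x" using eq[of t x] by simp
    show "?f x = (vt t x)\<^sup>2 + (vx t x)\<^sup>2"
      unfolding * by (simp add: algebra_simps power2_eq_square)
  qed
  moreover have "J (\<lambda>x. (vt t x)\<^sup>2 + (vx t x)\<^sup>2) = D t + X t"
    unfolding D_def X_def by (intro J_add continuous_intros)
  ultimately show ?thesis by simp
qed

text \<open>Eliminating \<open>v\<^sub>x\<close> between the energy and the virial identity leaves \<open>D\<close>, a functional of the values of \<open>v\<close>
alone, and time derivatives that are harmless after averaging.\<close>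

lemma energy_identity: "E t + A'' t / 2 + b * A' t = D t + J (\<lambda>x. H (v t x))"
proof -
  have "E t = J (\<lambda>x. 1 / 2 * (vt t x)\<^sup>2 + (- 1 / 2) * (vx t x)\<^sup>2 + 1 * H (v t x) + 1 / 2 * (v t x * g (v t x)))"
    unfolding E_def H_def by (rule arg_cong[where f = J]) (auto simp: field_simps)
  also have "\<dots> = 1 / 2 * D t + (- 1 / 2) * X t + 1 * J (\<lambda>x. H (v t x)) + 1 / 2 * J (\<lambda>x. v t x * g (v t x))"
    unfolding D_def X_def H_def by (intro J_linear continuous_intros; simp)
  finally show ?thesis using virial_identity[of t] by (simp add: algebra_simps)
qed

lemma D_nonneg: "0 \<le> D t" "0 \<le> X t"
  unfolding D_def X_def J_def by (intro integral_nonneg integrable_continuous_real continuous_intros; simp)+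

lemma integral_D:
  "integral {-1..1} (\<lambda>t. D (s + t)) = (E (s - 1) - E (s + 1)) / (2 * b)"
proof -
  have "((\<lambda>t. D (s + t)) has_integral (- E (s + 1) / (2 * b) - (- E (s + (- 1)) / (2 * b)))) {-1..1}"
  proof (rule has_integral_FTC)
    fix t
    have "((\<lambda>t. E (s + t)) has_real_derivative - 2 * b * D (s + t)) (at t)"
      using DERIV_shift[of E "- 2 * b * D (s + t)" t s] energy_deriv[of "t + s"] by (simp add: add.commute)
    then have "((\<lambda>t. - E (s + t) / (2 * b)) has_real_derivative - (- 2 * b * D (s + t)) / (2 * b)) (at t)"
      by (intro DERIV_cdivide DERIV_minus)
    then show "((\<lambda>t. - E (s + t) / (2 * b)) has_real_derivative D (s + t)) (at t)" using b by simp
  qed simp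
  then show ?thesis by (simp add: integral_unique diff_divide_distrib)
qed

lemma energy_antimono: "s \<le> t \<Longrightarrow> E t \<le> E s"
proof -
  assume "s \<le> t"
  then have "- E s \<le> - E t"
  proof (rule DERIV_nonneg_imp_nondecreasing)
    show "\<exists>y. ((\<lambda>x. - E x) has_real_derivative y) (at x) \<and> 0 \<le> y" for x
      using DERIV_minus[OF energy_deriv[of x]] b D_nonneg(1)[of x] by (intro exI[of _ "2 * b * D x"]) auto
  qed
  then show ?thesis by simp
qed

lemma cont_shift:
  assumes "\<And>S. continuous_on S (f :: real \<Rightarrow> real)"
  shows "continuous_on S (\<lambda>t. f (s + t))"
  by (rule continuous_on_compose2[OF assms[of UNIV]]) (auto intro!: continuous_intros)

lemma W_add:
  assumes "\<And>S. continuous_on S f" "\<And>S. continuous_on S h"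
  shows "W (\<lambda>t. f t + h t) s = W f s + W h s"
  unfolding W_def distrib_left
  by (intro integral_add integrable_continuous_real continuous_intros cont_shift assms)

lemma W_cmult: "W (\<lambda>t. c * f t) s = c * W f s"
  unfolding W_def by (simp add: mult.left_commute)

lemma W_linear:
  assumes "\<And>S. continuous_on S f" "\<And>S. continuous_on S h" "\<And>S. continuous_on S k" "\<And>S. continuous_on S l"
  shows "W (\<lambda>t. p * f t + q * h t + r * k t + u * l t) s = p * W f s + q * W h s + r * W k s + u * W l s"
proof -
  have c: "continuous_on S (\<lambda>t. p * f t)" "continuous_on S (\<lambda>t. q * h t)"
    "continuous_on S (\<lambda>t. r * k t)" "continuous_on S (\<lambda>t. u * l t)" for S
    by (intro continuous_intros assms)+
  show ?thesis
    unfolding W_add[OF continuous_on_add[OF continuous_on_add[OF c(1,2)] c(3)] c(4)]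
      W_add[OF continuous_on_add[OF c(1,2)] c(3)] W_add[OF c(1,2)] W_cmult by (rule refl)
qed

lemma W_mono:
  assumes "\<And>S. continuous_on S f" "\<And>S. continuous_on S h" "\<And>t. t \<in> {-1..1} \<Longrightarrow> f (s + t) \<le> h (s + t)"
  shows "W f s \<le> W h s"
  unfolding W_def
  by (intro integral_le integrable_continuous_real continuous_intros cont_shift assms mult_left_mono) auto

lemma W_const: "W (\<lambda>t. c) s = c"
  unfolding W_def using bump_integral by (simp add: integral_unique)

lemma W_close:
  assumes "\<And>S. continuous_on S f" "\<And>t. t \<in> {-1..1} \<Longrightarrow> \<bar>f (s + t) - a\<bar> \<le> m"
  shows "\<bar>W f s - a\<bar> \<le> m"
proof -
  have "W f s \<le> W (\<lambda>t. a + m) s" "W (\<lambda>t. a - m) s \<le> W f s"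
    using assms(2) by (intro W_mono assms(1) continuous_intros; force simp: abs_le_iff)+
  then show ?thesis unfolding W_const by simp
qed

lemma energy_between: "E (s + 1) \<le> W E s" "W E s \<le> E (s - 1)"
  using W_mono[of "\<lambda>t. E (s + 1)" E s] W_mono[of E "\<lambda>t. E (s - 1)" s] energy_antimono continuous_1d
  by (simp_all add: W_const)

lemma W_A'': "W A'' s = - integral {-1..1} (\<lambda>t. bump' t * A' (s + t))"
  "W A'' s = integral {-1..1} (\<lambda>t. bump'' t * A (s + t))"
  "W A' s = - integral {-1..1} (\<lambda>t. bump' t * A (s + t))"
  unfolding W_def
  using bump_by_parts(1)[OF A_deriv(2) continuous_1d(6)] bump_by_parts(2)[OF A_deriv(1) continuous_1d(5)]
    bump_by_parts(1)[OF A_deriv(1) continuous_1d(5)] by simp_all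

lemma W_E: "W E s = W D s + W (\<lambda>t. J (\<lambda>x. H (v t x))) s - W A'' s / 2 - b * W A' s"
proof -
  have *: "E = (\<lambda>t. 1 * D t + 1 * J (\<lambda>x. H (v t x)) + (- 1 / 2) * A'' t + (- b) * A' t)"
    using energy_identity by (simp add: fun_eq_iff algebra_simps)
  have "W E s = 1 * W D s + 1 * W (\<lambda>t. J (\<lambda>x. H (v t x))) s + (- 1 / 2) * W A'' s + (- b) * W A' s"
    unfolding * by (intro W_linear continuous_1d)
  then show ?thesis by simp
qed

lemma J_bound:
  assumes "continuous_on {0..2 * pi} f" "\<And>x. \<bar>f x\<bar> \<le> m"
  shows "\<bar>J f\<bar> \<le> 2 * pi * m"
  using integral_abs_le[of 0 "2 * pi" f "\<lambda>x. m"] assms by (simp add: J_def)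

lemma weighted_bound:
  fixes c f :: "real \<Rightarrow> real"
  assumes "\<And>t. t \<in> {-1..1} \<Longrightarrow> \<bar>c t\<bar> \<le> k" "continuous_on {-1..1} c" "\<And>S. continuous_on S f"
  shows "\<bar>integral {-1..1} (\<lambda>t. c t * f (s + t))\<bar> \<le> k * integral {-1..1} (\<lambda>t. \<bar>f (s + t)\<bar>)"
proof -
  have "\<bar>integral {-1..1} (\<lambda>t. c t * f (s + t))\<bar> \<le> integral {-1..1} (\<lambda>t. k * \<bar>f (s + t)\<bar>)"
  proof (rule integral_abs_le)
    show "\<bar>c t * f (s + t)\<bar> \<le> k * \<bar>f (s + t)\<bar>" if "t \<in> {-1..1}" for t
      unfolding abs_mult using assms(1)[OF that] by (intro mult_right_mono) auto
  qed (intro continuous_intros cont_shift assms(2,3))+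
  then show ?thesis by simp
qed

lemma weighted_bound_const:
  fixes c f :: "real \<Rightarrow> real"
  assumes "\<And>t. t \<in> {-1..1} \<Longrightarrow> \<bar>c t\<bar> \<le> k" "continuous_on {-1..1} c" "\<And>S. continuous_on S f"
    and "\<And>t. \<bar>f t\<bar> \<le> m" "k \<ge> 0"
  shows "\<bar>integral {-1..1} (\<lambda>t. c t * f (s + t))\<bar> \<le> k * (2 * m)"
proof -
  have "integral {-1..1} (\<lambda>t. \<bar>f (s + t)\<bar>) \<le> integral {-1..1} (\<lambda>t :: real. m)"
    by (intro integral_le integrable_continuous_real continuous_intros cont_shift assms)
  then show ?thesis
    using weighted_bound[OF assms(1-3), of s] mult_left_mono[OF _ assms(5)] by (fastforce intro: order_trans)
qed

text \<open>Averaging the virial identity moves all time derivatives to the bump, which bounds the average of \<open>D + X\<close>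
and hence of \<open>D\<close>; averaging the energy identity then bounds the average of \<open>E\<close>. As \<open>E\<close> is decreasing, it
lies between its averages over the neighbouring windows.\<close>

lemma energy_bounded: "\<exists>C. \<forall>s. \<bar>E s\<bar> \<le> C"
proof -
  have "continuous_on {c1..c2} (\<lambda>y. y * g y)" "continuous_on {c1..c2} H" "continuous_on {c1..c2} (\<lambda>y. y\<^sup>2 / 2)"
    unfolding H_def[abs_def] by (intro continuous_intros cont_g cont_G; simp)+
  note cont_yg = this
  obtain Kg where Kg: "\<And>y. y \<in> {c1..c2} \<Longrightarrow> \<bar>y * g y\<bar> \<le> Kg"
    using continuous_on_Icc_bounded[OF cont_yg(1)] by blast
  obtain KH where KH: "\<And>y. y \<in> {c1..c2} \<Longrightarrow> \<bar>H y\<bar> \<le> KH"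
    using continuous_on_Icc_bounded[OF cont_yg(2)] by blast
  obtain Kv where Kv: "\<And>y. y \<in> {c1..c2} \<Longrightarrow> \<bar>y\<^sup>2 / 2\<bar> \<le> Kv"
    using continuous_on_Icc_bounded[OF cont_yg(3)] by blast
  define a where "a = 2 * pi * Kv"
  define k where "k = 2 * pi * Kg"
  define h where "h = 2 * pi * KH"
  have a: "\<bar>A t\<bar> \<le> a" for t
    unfolding A_def a_def by (intro J_bound continuous_intros Kv rng) auto
  have k: "\<bar>J (\<lambda>x. v t x * g (v t x))\<bar> \<le> k" for t
    unfolding k_def by (intro J_bound continuous_intros Kg rng)
  have h: "\<bar>J (\<lambda>x. H (v t x))\<bar> \<le> h" for t
    unfolding h_def H_def using KH[OF rng] by (intro J_bound continuous_intros) (auto simp: H_def)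
  have 1: "\<bar>W A'' s\<bar> \<le> 15 / 2 * (2 * a)" for s
    unfolding W_A''(2)
    by (rule weighted_bound_const[OF bump_bounds(3)]) (auto intro!: continuous_intros continuous_1d a)
  have 2: "\<bar>W A' s\<bar> \<le> 15 / 4 * (2 * a)" for s
    unfolding W_A''(3) abs_minus_cancel
    by (rule weighted_bound_const[OF bump_bounds(2)]) (auto intro!: continuous_intros continuous_1d a)
  have 3: "\<bar>W (\<lambda>t. J (\<lambda>x. v t x * g (v t x))) s\<bar> \<le> k" for s
    using W_close[OF continuous_1d(7), of s 0 k] k by simp
  have 4: "\<bar>W (\<lambda>t. J (\<lambda>x. H (v t x))) s\<bar> \<le> h" for s
    using W_close[OF continuous_1d(8), of s 0 h] h by simp
  have 5: "0 \<le> W D s" for s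
    using W_mono[of "\<lambda>t. 0" D s] D_nonneg continuous_1d by (simp add: W_const)
  have 6: "W D s \<le> \<bar>W A'' s\<bar> + 2 * b * \<bar>W A' s\<bar> + k" for s
  proof -
    have "W D s \<le> W (\<lambda>t. D t + X t) s"
      by (intro W_mono continuous_intros continuous_1d) (simp add: D_nonneg)
    also have "\<dots> = W (\<lambda>t. 1 * A'' t + (2 * b) * A' t + 1 * J (\<lambda>x. v t x * g (v t x)) + 0 * D t) s"
      by (simp add: virial_identity[symmetric])
    also have "\<dots> = 1 * W A'' s + (2 * b) * W A' s + 1 * W (\<lambda>t. J (\<lambda>x. v t x * g (v t x))) s + 0 * W D s"
      by (intro W_linear continuous_1d)
    also have "(2 * b) * W A' s \<le> 2 * b * \<bar>W A' s\<bar>" using b by simp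
    finally show ?thesis using 3[of s] by linarith
  qed
  define C where "C = 2 * (15 / 2 * (2 * a)) + 3 * (b * (15 / 4 * (2 * a))) + k + h"
  have C: "\<bar>W E s\<bar> \<le> C" for s
  proof -
    have "\<bar>b * W A' s\<bar> \<le> b * (15 / 4 * (2 * a))" using 2[of s] b by (simp add: abs_mult)
    then have "b * \<bar>W A' s\<bar> \<le> b * (15 / 4 * (2 * a))" "\<bar>b * W A' s\<bar> \<le> b * (15 / 4 * (2 * a))"
      using b by (simp_all add: abs_mult)
    then show ?thesis
      using 1[of s] 3[of s] 4[of s] 5[of s] 6[of s] unfolding W_E C_def by linarith
  qed
  have "\<bar>E s\<bar> \<le> C" for s
  proof -
    show ?thesis using energy_between[of s] energy_between[of "s - 1"] energy_between[of "s + 1"]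
        C[of "s - 1"] C[of "s + 1"] by simp
  qed
  then show ?thesis by blast
qed

text \<open>\<open>M s x\<close> bounds the oscillation of \<open>v\<close> in time over the window around \<open>s\<close> at the angle \<open>x\<close>; \<open>V s\<close> is the
averaged profile over that window, with \<open>x\<close>-derivatives \<open>V' s\<close> and \<open>V'' s\<close>.\<close>

definition M where "M s x = integral {-1..1} (\<lambda>t. \<bar>vt (s + t) x\<bar>)"
definition V where "V s x = W (\<lambda>t. v t x) s"
definition V' where "V' s x = W (\<lambda>t. vx t x) s"
definition V'' where "V'' s x = W (\<lambda>t. vxx t x) s"

lemma cont_x:
  "continuous_on S (\<lambda>t. v t x)" "continuous_on S (\<lambda>t. vt t x)" "continuous_on S (\<lambda>t. vtt t x)"
  "continuous_on S (\<lambda>t. vx t x)" "continuous_on S (\<lambda>t. vxx t x)" "continuous_on S (\<lambda>t. g (v t x))" "continuous_on S (\<lambda>t. H (v t x))"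
  unfolding H_def by (intro continuous_intros; simp)+

lemma cont_M: "continuous_on S (M s)"
  unfolding M_def[abs_def]
  by (rule continuous_on_integral_cont2) (unfold cont2_def, intro continuous_intros)

lemma V_deriv: "(V s has_real_derivative V' s x) (at x)" "(V' s has_real_derivative V'' s x) (at x)"
proof -
  show "(V s has_real_derivative V' s x) (at x)"
    unfolding V_def[abs_def] V'_def W_def
  proof (rule leibniz_cont2)
    show "((\<lambda>x. bump t * v (s + t) x) has_real_derivative bump t * vx (s + t) x) (at x)" for t x
      by (rule DERIV_cmult vx)+
  qed (unfold cont2_def, (intro continuous_intros)+)
  show "(V' s has_real_derivative V'' s x) (at x)"
    unfolding V'_def[abs_def] V''_def W_def
  proof (rule leibniz_cont2)
    show "((\<lambda>x. bump t * vx (s + t) x) has_real_derivative bump t * vxx (s + t) x) (at x)" for t x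
      by (rule DERIV_cmult vxx)+
  qed (unfold cont2_def, (intro continuous_intros)+)
qed

lemma cont_V: "continuous_on S (V s)" "continuous_on S (V'' s)"
proof -
  show "continuous_on S (V s)" using V_deriv by (meson DERIV_isCont continuous_at_imp_continuous_on)
  show "continuous_on S (V'' s)"
    unfolding V''_def[abs_def] W_def
    by (rule continuous_on_integral_cont2) (unfold cont2_def, intro continuous_intros)
qed

lemma V_per: "V s (x + 2 * pi) = V s x"
  by (simp add: V_def per)

lemma v_oscillation:
  assumes "t \<in> {-1..1}" "t' \<in> {-1..1}"
  shows "\<bar>v (s + t) x - v (s + t') x\<bar> \<le> M s x"
proof -
  have d: "((\<lambda>t. v (s + t) x) has_real_derivative vt (s + t) x) (at t)" for t
    using DERIV_shift[of "\<lambda>t. v t x" "vt (s + t) x" t s] vt[of x "t + s"] by (simp add: add.commute)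
  show ?thesis unfolding M_def
    by (rule deriv_diff_le_integral[OF d _ _ _ assms]) (auto intro!: continuous_intros)
qed

lemma V_close:
  assumes "t \<in> {-1..1}"
  shows "\<bar>v (s + t) x - V s x\<bar> \<le> M s x"
  using W_close[OF cont_x(1), of s x "v (s + t) x" "M s x"] v_oscillation[OF _ assms]
  by (simp add: V_def abs_minus_commute)

lemma V_rng: "V s x \<in> {c1..c2}"
proof -
  have "W (\<lambda>t. c1) s \<le> V s x" "V s x \<le> W (\<lambda>t. c2) s"
    unfolding V_def using rng by (intro W_mono cont_x continuous_intros; auto)+
  then show ?thesis by (simp add: W_const)
qed

lemma lipschitz_of_deriv:
  fixes f f' :: "real \<Rightarrow> real"
  assumes f: "\<And>y. y \<in> {c1..c2} \<Longrightarrow> (f has_real_derivative f' y) (at y)" and c: "continuous_on {c1..c2} f'"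
  obtains K where "K \<ge> 0" "\<And>y z. y \<in> {c1..c2} \<Longrightarrow> z \<in> {c1..c2} \<Longrightarrow> \<bar>f y - f z\<bar> \<le> K * \<bar>y - z\<bar>"
proof -
  obtain K where K: "\<And>x. x \<in> {c1..c2} \<Longrightarrow> \<bar>f' x\<bar> \<le> K"
    using continuous_on_Icc_bounded[OF c] by blast
  have "norm (f y - f z) \<le> \<bar>K\<bar> * norm (y - z)" if "y \<in> {c1..c2}" "z \<in> {c1..c2}" for y z
  proof (rule field_differentiable_bound[OF convex_real_interval(5) _ _ that])
    fix x assume x: "x \<in> {c1..c2}"
    show "(f has_field_derivative f' x) (at x within {c1..c2})"
      using f[OF x] has_field_derivative_at_within by blast
    show "norm (f' x) \<le> \<bar>K\<bar>" using K[OF x] by simp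
  qed
  then show ?thesis using that[of "\<bar>K\<bar>"] by simp
qed

lemma W_composed_close:
  assumes lip: "\<And>y z. y \<in> {c1..c2} \<Longrightarrow> z \<in> {c1..c2} \<Longrightarrow> \<bar>f y - f z\<bar> \<le> K * \<bar>y - z\<bar>"
    and K: "K \<ge> 0" and f: "\<And>S. continuous_on S (\<lambda>t. f (v t x))"
  shows "\<bar>W (\<lambda>t. f (v t x)) s - f (V s x)\<bar> \<le> K * M s x"
proof (rule W_close[OF f])
  fix t :: real assume t: "t \<in> {-1..1}"
  have "\<bar>f (v (s + t) x) - f (V s x)\<bar> \<le> K * \<bar>v (s + t) x - V s x\<bar>" by (rule lip[OF rng V_rng])
  also have "\<dots> \<le> K * M s x" by (intro mult_left_mono V_close t K)
  finally show "\<bar>f (v (s + t) x) - f (V s x)\<bar> \<le> K * M s x" .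
qed

text \<open>The averaged profile solves the steady equation up to a multiple of the oscillation: the term \<open>v\<^sub>t\<^sub>t\<close> is
integrated by parts once, and averaging commutes with \<open>g\<close> up to the Lipschitz constant of \<open>g\<close>.\<close>

lemma V_almost_steady: "\<exists>C\<ge>0. \<forall>s x. \<bar>V'' s x + g (V s x)\<bar> \<le> C * M s x"
proof -
  obtain K where K: "K \<ge> 0"
    "\<And>y z. y \<in> {c1..c2} \<Longrightarrow> z \<in> {c1..c2} \<Longrightarrow> \<bar>g y - g z\<bar> \<le> K * \<bar>y - z\<bar>"
    using lipschitz_of_deriv[OF g g'] by blast
  have "\<bar>V'' s x + g (V s x)\<bar> \<le> (15 / 4 + 2 * b * 1 + K) * M s x" for s x
  proof -
    have e: "(\<lambda>t. vxx t x) = (\<lambda>t. (-1) * vtt t x + (- 2 * b) * vt t x + (-1) * g (v t x) + 0 * v t x)"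
      using eq[of _ x] by (simp add: fun_eq_iff algebra_simps eq_neg_iff_add_eq_0)
    have "V'' s x = (-1) * W (\<lambda>t. vtt t x) s + (- 2 * b) * W (\<lambda>t. vt t x) s + (-1) * W (\<lambda>t. g (v t x)) s + 0 * W (\<lambda>t. v t x) s"
      unfolding V''_def e by (intro W_linear cont_x)
    moreover have "W (\<lambda>t. vtt t x) s = - integral {-1..1} (\<lambda>t. bump' t * vt (s + t) x)"
      unfolding W_def by (rule bump_by_parts(1)[OF vtt cont_x(3)])
    moreover have "\<bar>integral {-1..1} (\<lambda>t. bump' t * vt (s + t) x)\<bar> \<le> 15 / 4 * M s x"
      unfolding M_def by (rule weighted_bound[OF bump_bounds(2)]) (auto intro!: continuous_intros)
    moreover have "\<bar>W (\<lambda>t. vt t x) s\<bar> \<le> 1 * M s x"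
      unfolding M_def W_def by (rule weighted_bound[OF bump_bounds(1)]) (auto intro!: continuous_intros)
    then have "\<bar>2 * b * W (\<lambda>t. vt t x) s\<bar> \<le> 2 * b * 1 * M s x" using b by (simp add: abs_mult)
    moreover have "\<bar>W (\<lambda>t. g (v t x)) s - g (V s x)\<bar> \<le> K * M s x"
      by (rule W_composed_close[OF K(2,1) cont_x(6)])
    ultimately show ?thesis unfolding distrib_right by linarith
  qed
  moreover have "0 \<le> 15 / 4 + 2 * b * 1 + K" using b K by simp
  ultimately show ?thesis by blast
qed

lemma J_M: "J (M s) = integral {-1..1} (\<lambda>t. J (\<lambda>x. \<bar>vt (s + t) x\<bar>))"
  unfolding J_def M_def by (rule integral_swap_cont2) (unfold cont2_def, intro continuous_intros)

lemma M_nonneg: "0 \<le> M s x"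
  unfolding M_def by (intro integral_nonneg integrable_continuous_real continuous_intros) auto

lemma J_M_nonneg: "0 \<le> J (M s)"
  unfolding J_def by (intro integral_nonneg integrable_continuous_real cont_M M_nonneg)

text \<open>The inequality \<open>\<bar>y\<bar> \<le> \<delta> + y\<^sup>2 / (4 \<delta>)\<close> controls the oscillation by the dissipation, which is an energy
difference.\<close>

lemma J_M_bound:
  assumes "\<delta> > 0"
  shows "J (M s) \<le> 4 * pi * \<delta> + (E (s - 1) - E (s + 1)) / (2 * b) / (4 * \<delta>)"
proof -
  have *: "J (\<lambda>x. \<bar>vt t x\<bar>) \<le> 2 * pi * \<delta> + 1 / (4 * \<delta>) * D t" for t
  proof -
    have p: "\<bar>y\<bar> \<le> \<delta> + 1 / (4 * \<delta>) * y\<^sup>2" for y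
    proof -
      have "(\<bar>y\<bar> - 2 * \<delta>)\<^sup>2 = y\<^sup>2 - 4 * \<delta> * \<bar>y\<bar> + 4 * \<delta> * \<delta>"
        by (simp add: power2_diff) (simp add: power2_eq_square)
      then have "4 * \<delta> * \<bar>y\<bar> \<le> 4 * \<delta> * \<delta> + y\<^sup>2"
        using zero_le_power2[of "\<bar>y\<bar> - 2 * \<delta>"] by linarith
      then show ?thesis using assms by (simp add: field_simps)
    qed
    have "J (\<lambda>x. \<bar>vt t x\<bar>) \<le> J (\<lambda>x. \<delta> + 1 / (4 * \<delta>) * (vt t x)\<^sup>2)"
      by (intro J_mono continuous_intros p)
    also have "\<dots> = J (\<lambda>x. \<delta>) + J (\<lambda>x. 1 / (4 * \<delta>) * (vt t x)\<^sup>2)"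
      by (intro J_add continuous_intros)
    also have "\<dots> = 2 * pi * \<delta> + 1 / (4 * \<delta>) * D t"
      unfolding J_cmult D_def by (simp add: J_def)
    finally show ?thesis .
  qed
  have "J (M s) \<le> integral {-1..1} (\<lambda>t. 2 * pi * \<delta> + 1 / (4 * \<delta>) * D (s + t))"
    unfolding J_M
  proof (intro integral_le integrable_continuous_real)
    show "continuous_on {-1..1} (\<lambda>t. J (\<lambda>x. \<bar>vt (s + t) x\<bar>))"
      by (rule J_continuous) (intro continuous_intros)
    show "continuous_on {-1..1} (\<lambda>t. 2 * pi * \<delta> + 1 / (4 * \<delta>) * D (s + t))"
      by (intro continuous_intros cont_shift continuous_1d)
  qed (rule *)
  also have "\<dots> = integral {-1..1} (\<lambda>t :: real. 2 * pi * \<delta>) + integral {-1..1} (\<lambda>t. 1 / (4 * \<delta>) * D (s + t))"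
    by (intro integral_add integrable_continuous_real continuous_intros cont_shift continuous_1d)
  also have "\<dots> = 4 * pi * \<delta> + 1 / (4 * \<delta>) * integral {-1..1} (\<lambda>t. D (s + t))" by simp
  finally show ?thesis unfolding integral_D by (simp add: mult.commute)
qed

lemma J_M_tendsto_0:
  assumes "(\<lambda>n. E (s n - 1)) \<longlonglongrightarrow> e" "(\<lambda>n. E (s n + 1)) \<longlonglongrightarrow> e"
  shows "(\<lambda>n. J (M (s n))) \<longlonglongrightarrow> 0"
proof (rule LIMSEQ_I)
  fix \<epsilon> :: real assume \<epsilon>: "0 < \<epsilon>"
  define \<delta> where "\<delta> = \<epsilon> / (8 * pi)"
  have \<delta>: "\<delta> > 0" "4 * pi * \<delta> = \<epsilon> / 2" using \<epsilon> by (simp_all add: \<delta>_def)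
  have "(\<lambda>n. (E (s n - 1) - E (s n + 1)) / (2 * b) / (4 * \<delta>)) \<longlonglongrightarrow> (e - e) / (2 * b) / (4 * \<delta>)"
    using assms b \<delta> by (intro tendsto_intros) auto
  then have "(\<lambda>n. (E (s n - 1) - E (s n + 1)) / (2 * b) / (4 * \<delta>)) \<longlonglongrightarrow> 0" by simp
  from LIMSEQ_D[OF this, of "\<epsilon> / 2"] \<epsilon> obtain N where
    N: "\<And>n. n \<ge> N \<Longrightarrow> norm ((E (s n - 1) - E (s n + 1)) / (2 * b) / (4 * \<delta>) - 0) < \<epsilon> / 2" by auto
  show "\<exists>no. \<forall>n\<ge>no. norm (J (M (s n)) - 0) < \<epsilon>"
  proof (intro exI allI impI)
    fix n assume "n \<ge> N"
    from N[OF this] J_M_bound[OF \<delta>(1), of "s n"] J_M_nonneg[of "s n"] \<delta>(2)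
    show "norm (J (M (s n)) - 0) < \<epsilon>" unfolding real_norm_def by linarith
  qed
qed

lemma W_E_close_steady: "\<exists>C. \<forall>s. \<bar>W E s - J (\<lambda>x. H (V s x))\<bar> \<le> C * J (M s) + (E (s - 1) - E (s + 1)) / (2 * b)"
proof -
  define H' where "H' y = g y - (g y + y * g' y) / 2" for y
  have dH: "(H has_real_derivative H' y) (at y)" if "y \<in> {c1..c2}" for y
    unfolding H_def[abs_def] H'_def
    by (rule derivative_eq_intros refl G[OF that] g[OF that] | simp)+
  have cH': "continuous_on {c1..c2} H'"
    unfolding H'_def[abs_def] by (intro continuous_intros cont_g g') auto
  obtain K where K: "K \<ge> 0"
    "\<And>y z. y \<in> {c1..c2} \<Longrightarrow> z \<in> {c1..c2} \<Longrightarrow> \<bar>H y - H z\<bar> \<le> K * \<bar>y - z\<bar>"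
    using lipschitz_of_deriv[OF dH cH'] by blast
  have cont_H: "continuous_on {c1..c2} H"
    using dH by (meson DERIV_isCont continuous_at_imp_continuous_on)
  have cHV: "continuous_on S (\<lambda>x. H (V s x))" for S s
    by (rule continuous_on_compose2[OF cont_H cont_V(1)]) (use V_rng in auto)
  define c where "c = max \<bar>c1\<bar> \<bar>c2\<bar>"
  have c: "\<bar>v t x\<bar> \<le> c" for t x using rng[of t x] by (auto simp: c_def)
  have h: "\<bar>W (\<lambda>t. J (\<lambda>x. H (v t x))) s - J (\<lambda>x. H (V s x))\<bar> \<le> K * J (M s)" for s
  proof -
    have "W (\<lambda>t. J (\<lambda>x. H (v t x))) s = integral {-1..1} (\<lambda>t. integral {0..2*pi} (\<lambda>x. bump t * H (v (s + t) x)))"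
      unfolding W_def J_def by simp
    also have "\<dots> = J (\<lambda>x. W (\<lambda>t. H (v t x)) s)"
      unfolding W_def J_def H_def
      by (rule integral_swap_cont2) (unfold cont2_def, intro continuous_intros; simp)
    finally have e: "W (\<lambda>t. J (\<lambda>x. H (v t x))) s = J (\<lambda>x. W (\<lambda>t. H (v t x)) s)" .
    have cW: "continuous_on S (\<lambda>x. W (\<lambda>t. H (v t x)) s)" for S
      unfolding W_def H_def
      by (rule continuous_on_integral_cont2) (unfold cont2_def, intro continuous_intros; simp)
    have "W (\<lambda>t. J (\<lambda>x. H (v t x))) s - J (\<lambda>x. H (V s x)) = J (\<lambda>x. W (\<lambda>t. H (v t x)) s - H (V s x))"
      unfolding e unfolding J_def by (intro integral_diff[symmetric] integrable_continuous_real cW cHV)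
    also have "\<bar>\<dots>\<bar> \<le> J (\<lambda>x. K * M s x)"
      unfolding J_def
      by (intro integral_abs_le continuous_intros cW cHV cont_M W_composed_close[OF K(2,1) cont_x(7)])
    finally show ?thesis by (simp add: J_cmult)
  qed
  have A': "integral {-1..1} (\<lambda>t. \<bar>A' (s + t)\<bar>) \<le> c * J (M s)" for s
  proof -
    have 1: "\<bar>A' t\<bar> \<le> c * J (\<lambda>x. \<bar>vt t x\<bar>)" for t
    proof -
      have "\<bar>A' t\<bar> \<le> J (\<lambda>x. c * \<bar>vt t x\<bar>)"
        unfolding A'_def J_def
        by (intro integral_abs_le continuous_intros) (auto simp: abs_mult intro!: mult_right_mono c)
      then show ?thesis by (simp add: J_cmult)
    qed
    have cJ: "continuous_on {-1..1} (\<lambda>t. J (\<lambda>x. \<bar>vt (s + t) x\<bar>))"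
      by (rule J_continuous) (intro continuous_intros)
    have "integral {-1..1} (\<lambda>t. \<bar>A' (s + t)\<bar>) \<le> integral {-1..1} (\<lambda>t. c * J (\<lambda>x. \<bar>vt (s + t) x\<bar>))"
      by (intro integral_le integrable_continuous_real continuous_intros cJ cont_shift continuous_1d 1)
    then show ?thesis by (simp add: J_M)
  qed
  have A1: "\<bar>W A'' s\<bar> \<le> 15 / 4 * (c * J (M s))" for s
  proof -
    have "\<bar>W A'' s\<bar> \<le> 15 / 4 * integral {-1..1} (\<lambda>t. \<bar>A' (s + t)\<bar>)"
      unfolding W_A''(1) abs_minus_cancel
      by (rule weighted_bound[OF bump_bounds(2)]) (auto intro!: continuous_intros continuous_1d)
    then show ?thesis using A'[of s] by linarith
  qed
  have A2: "\<bar>W A' s\<bar> \<le> c * J (M s)" for s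
  proof -
    have "\<bar>W A' s\<bar> \<le> 1 * integral {-1..1} (\<lambda>t. \<bar>A' (s + t)\<bar>)"
      unfolding W_def
      by (rule weighted_bound[OF bump_bounds(1)]) (auto intro!: continuous_intros continuous_1d)
    then show ?thesis using A'[of s] by linarith
  qed
  have D1: "\<bar>W D s\<bar> \<le> (E (s - 1) - E (s + 1)) / (2 * b)" for s
  proof -
    have "\<bar>W D s\<bar> \<le> 1 * integral {-1..1} (\<lambda>t. \<bar>D (s + t)\<bar>)"
      unfolding W_def
      by (rule weighted_bound[OF bump_bounds(1)]) (auto intro!: continuous_intros continuous_1d)
    then show ?thesis using D_nonneg integral_D[of s] by simp
  qed
  have "\<bar>W E s - J (\<lambda>x. H (V s x))\<bar> \<le> (K + 15 / 8 * c + b * c) * J (M s) + (E (s - 1) - E (s + 1)) / (2 * b)" for s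
  proof -
    have "\<bar>b * W A' s\<bar> \<le> b * (c * J (M s))" using A2[of s] b by (simp add: abs_mult)
    then show ?thesis unfolding W_E
      using h[of s] A1[of s] D1[of s] by (simp add: distrib_right)
  qed
  then show ?thesis by blast
qed

text \<open>Along times where the energy stabilises, a subsequence of averaged profiles converges to a steady profile,
and the limit of the energy is the functional \<open>\<integral> H\<close> of that profile.\<close>

lemma steady_limit:
  assumes e: "(\<lambda>n. E (s n - 1)) \<longlonglongrightarrow> e" "(\<lambda>n. E (s n + 1)) \<longlonglongrightarrow> e"
  obtains w w' where "solves_ode g w w'" "\<And>x. w x \<in> {c1..c2}" "\<And>x. w (x + 2 * pi) = w x"
    "J (\<lambda>x. H (w x)) = e"
proof -
  note M0 = J_M_tendsto_0[OF e]
  obtain C where C: "C \<ge> 0" "\<And>s x. \<bar>V'' s x + g (V s x)\<bar> \<le> C * M s x"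
    using V_almost_steady by blast
  define R where "R n x = V'' (s n) x + g (V (s n) x)" for n x
  have cR: "continuous_on S (R n)" for S n
    unfolding R_def[abs_def]
    by (intro continuous_intros cont_V continuous_on_compose2[OF cont_g cont_V(1)]) (use V_rng in auto)
  have R0: "(\<lambda>n. integral {0..2*pi} (\<lambda>x. \<bar>R n x\<bar>)) \<longlonglongrightarrow> 0"
  proof (rule Lim_null_comparison)
    have "norm (J (\<lambda>x. \<bar>R n x\<bar>)) \<le> C * J (M (s n))" for n
    proof -
      have "\<bar>J (\<lambda>x. \<bar>R n x\<bar>)\<bar> \<le> J (\<lambda>x. C * M (s n) x)"
        unfolding J_def by (intro integral_abs_le continuous_intros cR cont_M) (simp add: R_def C)
      then show ?thesis by (simp add: J_cmult)
    qed
    then show "\<forall>\<^sub>F n in sequentially. norm (integral {0..2*pi} (\<lambda>x. \<bar>R n x\<bar>)) \<le> C * J (M (s n))"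
      unfolding J_def[of "\<lambda>x. \<bar>R _ x\<bar>"] by simp
    show "(\<lambda>n. C * J (M (s n))) \<longlonglongrightarrow> 0" using tendsto_mult_left[OF M0, of C] by simp
  qed
  have twopi: "2 * pi > 0" by simp
  obtain r w w' where r: "strict_mono (r :: nat \<Rightarrow> nat)" and w: "\<And>x. (\<lambda>n. V (s (r n)) x) \<longlonglongrightarrow> w x"
    and sol: "solves_ode g w w'" "\<And>x. w x \<in> {c1..c2}" "\<And>x. w (x + 2 * pi) = w x"
  proof (rule almost_solutions_converge[of "\<lambda>n. V (s n)" "\<lambda>n. V' (s n)" R g c1 c2 "2 * pi"])
    show "(V (s n) has_real_derivative V' (s n) x) (at x)" for n x by (rule V_deriv)
    show "(V' (s n) has_real_derivative R n x - g (V (s n) x)) (at x)" for n x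
      using V_deriv(2)[of "s n" x] by (simp add: R_def)
  qed (use cR cont_g V_rng V_per R0 in auto)
  have cont_H: "continuous_on {c1..c2} H"
    unfolding H_def[abs_def] by (intro continuous_intros cont_g cont_G) auto
  obtain K where K: "\<And>y. y \<in> {c1..c2} \<Longrightarrow> \<bar>H y\<bar> \<le> K"
    using continuous_on_Icc_bounded[OF cont_H] by blast
  have "(\<lambda>n. J (\<lambda>x. H (V (s (r n)) x))) \<longlonglongrightarrow> J (\<lambda>x. H (w x))"
    unfolding J_def
  proof (rule dominated_convergence(2)[where h = "\<lambda>x. K"])
    show "(\<lambda>x. H (V (s (r n)) x)) integrable_on {0..2*pi}" for n
      by (intro integrable_continuous_real continuous_on_compose2[OF cont_H cont_V(1)]) (use V_rng in auto)
    show "norm (H (V (s (r n)) x)) \<le> K" for n x using K[OF V_rng] by simp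
    show "(\<lambda>n. H (V (s (r n)) x)) \<longlonglongrightarrow> H (w x)" for x
      by (rule continuous_on_tendsto_compose[OF cont_H w sol(2)]) (use V_rng in auto)
  qed auto
  moreover have "(\<lambda>n. J (\<lambda>x. H (V (s n) x))) \<longlonglongrightarrow> e"
  proof -
    obtain C where C: "\<And>s. \<bar>W E s - J (\<lambda>x. H (V s x))\<bar> \<le> C * J (M s) + (E (s - 1) - E (s + 1)) / (2 * b)"
      using W_E_close_steady by blast
    have "(\<lambda>n. W E (s n)) \<longlonglongrightarrow> e"
    proof (rule tendsto_sandwich[OF _ _ e(2) e(1)])
      show "\<forall>\<^sub>F n in sequentially. E (s n + 1) \<le> W E (s n)"
        "\<forall>\<^sub>F n in sequentially. W E (s n) \<le> E (s n - 1)" by (simp_all add: energy_between)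
    qed
    moreover have "(\<lambda>n. W E (s n) - J (\<lambda>x. H (V (s n) x))) \<longlonglongrightarrow> 0"
    proof (rule Lim_null_comparison)
      show "\<forall>\<^sub>F n in sequentially. norm (W E (s n) - J (\<lambda>x. H (V (s n) x)))
          \<le> C * J (M (s n)) + (E (s n - 1) - E (s n + 1)) / (2 * b)" using C by simp
      have "(\<lambda>n. C * J (M (s n)) + (E (s n - 1) - E (s n + 1)) / (2 * b)) \<longlonglongrightarrow> C * 0 + (e - e) / (2 * b)"
        using b by (intro tendsto_intros M0 e) auto
      then show "(\<lambda>n. C * J (M (s n)) + (E (s n - 1) - E (s n + 1)) / (2 * b)) \<longlonglongrightarrow> 0" by simp
    qed
    ultimately have "(\<lambda>n. W E (s n) - (W E (s n) - J (\<lambda>x. H (V (s n) x)))) \<longlonglongrightarrow> e - 0"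
      by (rule tendsto_diff)
    then show ?thesis by simp
  qed
  then have "(\<lambda>n. J (\<lambda>x. H (V (s (r n)) x))) \<longlonglongrightarrow> e"
    using LIMSEQ_subseq_LIMSEQ[OF _ r] by (fastforce simp: o_def)
  ultimately have "J (\<lambda>x. H (w x)) = e" using LIMSEQ_unique by blast
  then show ?thesis using that sol by blast
qed

text \<open>The energy has the same limit \<open>h\<close> at both ends of time and is decreasing, hence constant; so the dissipation
vanishes.\<close>

theorem stationary:
  assumes same: "\<And>w w'. solves_ode g w w' \<Longrightarrow> (\<And>x. w x \<in> {c1..c2}) \<Longrightarrow> (\<And>x. w (x + 2 * pi) = w x)
    \<Longrightarrow> J (\<lambda>x. H (w x)) = h"
  shows "vt t x = 0"
proof -
  obtain C where C: "\<And>s. \<bar>E s\<bar> \<le> C" using energy_bounded by blast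
  have C': "E s \<le> C" "- C \<le> E s" for s using C[of s] by linarith+
  have "decseq (\<lambda>n. E (real n))" "\<forall>n. - C \<le> E (real n)"
    using C' by (simp_all add: decseq_def energy_antimono)
  from decseq_convergent[OF this] obtain e where e: "(\<lambda>n. E (real n)) \<longlonglongrightarrow> e" by metis
  have e1: "(\<lambda>n. E (real n + 1)) \<longlonglongrightarrow> e" using LIMSEQ_Suc[OF e] by (simp add: add.commute)
  have e2: "(\<lambda>n. E (real n - 1)) \<longlonglongrightarrow> e" by (rule LIMSEQ_imp_Suc) (use e in simp)
  have he: "e = h"
    by (rule steady_limit[OF e2 e1]) (use same in blast)
  have "incseq (\<lambda>n. E (- real n))" "\<forall>n. E (- real n) \<le> C"
    using C' by (simp_all add: incseq_def energy_antimono)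
  from incseq_convergent[OF this] obtain f where f: "(\<lambda>n. E (- real n)) \<longlonglongrightarrow> f" by metis
  have f1: "(\<lambda>n. E (- real n - 1)) \<longlonglongrightarrow> f" using LIMSEQ_Suc[OF f] by (simp add: minus_diff_commute)
  have f2: "(\<lambda>n. E (- real n + 1)) \<longlonglongrightarrow> f" by (rule LIMSEQ_imp_Suc) (use f in simp)
  have hf: "f = h"
    by (rule steady_limit[OF f1 f2]) (use same in blast)
  have Eh: "E s = h" for s
  proof (rule antisym)
    obtain N where N: "s \<le> real N" "- s \<le> real N" using real_arch_simple[of "max s (- s)"] by auto
    have "\<forall>n\<ge>N. E (real n) \<le> E s" "\<forall>n\<ge>N. E s \<le> E (- real n)"
      using N by (auto intro!: energy_antimono)
    then show "h \<le> E s" "E s \<le> h"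
      using LIMSEQ_le_const2[OF e] LIMSEQ_le_const[OF f] he hf by blast+
  qed
  have "E = (\<lambda>s. h)" using Eh by blast
  then have "- 2 * b * D t = 0" using energy_deriv[of t] DERIV_const DERIV_unique by metis
  then have D0: "integral {0..2*pi} (\<lambda>x. (vt t x)\<^sup>2) = 0" using b by (simp add: D_def J_def)
  have z: "(vt t x)\<^sup>2 = 0" if "x \<in> {0..2*pi}" for x
  proof -
    have "continuous_on {0..2*pi} (\<lambda>x. (vt t x)\<^sup>2)" by (intro continuous_intros)
    from integral_eq_0_iff[OF this] D0 that show ?thesis by simp
  qed
  have twopi: "2 * pi > 0" by simp
  obtain k where "x + of_int k * (2 * pi) \<in> {0..<2 * pi}" using obtain_period_shift[OF twopi] by blast
  then show ?thesis
    using z[of "x + of_int k * (2 * pi)"] periodic_add_of_int[of "vt t" "2 * pi" x k] periodic_derivs by simp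
qed

end

section \<open>Continuously differentiable functions and polar coordinates in the plane\<close>

lemma has_derivative_cong_open:
  assumes "open S" "x \<in> S" "\<And>y. y \<in> S \<Longrightarrow> u y = v y"
  shows "(u has_derivative D) (at x) \<longleftrightarrow> (v has_derivative D) (at x)"
  using has_derivative_transform_within_open[of u D x UNIV S v]
    has_derivative_transform_within_open[of v D x UNIV S u] assms by auto

lemma frechet_derivative_cong_open:
  assumes "open S" "x \<in> S" "\<And>y. y \<in> S \<Longrightarrow> u y = v y"
  shows "frechet_derivative u (at x) = frechet_derivative v (at x)"
  unfolding frechet_derivative_def using has_derivative_cong_open[OF assms] by simp

lemma Ck_on_cong:
  assumes S: "open S" and "\<And>x. x \<in> S \<Longrightarrow> u x = v x" and "Ck_on k S u"
  shows "Ck_on k S v"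
  using assms(2,3)
proof (induction k arbitrary: u v)
  case 0
  then show ?case using continuous_on_cong[of S S u v] by simp
next
  case (Suc k)
  have "v differentiable at x" if "x \<in> S" for x
  proof -
    have "u differentiable at x" using Suc.prems(2) that by simp
    then obtain D where "(u has_derivative D) (at x)" by (auto simp: differentiable_def)
    then have "(v has_derivative D) (at x)"
      using has_derivative_cong_open[of S x u v D] S that Suc.prems(1) by blast
    then show ?thesis by (auto simp: differentiable_def)
  qed
  moreover have "Ck_on k S (\<lambda>x. frechet_derivative v (at x) h)" for h
  proof (rule Suc.IH)
    show "Ck_on k S (\<lambda>x. frechet_derivative u (at x) h)" using Suc.prems(2) by simp
    show "frechet_derivative u (at x) h = frechet_derivative v (at x) h" if "x \<in> S" for x
      using frechet_derivative_cong_open[OF S that Suc.prems(1)] by simp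
  qed
  ultimately show ?case by simp
qed

lemma Ck_on_SucD: "Ck_on (Suc k) S u \<Longrightarrow> Ck_on k S u"
proof (induction k arbitrary: u)
  case 0
  then show ?case
    by (auto intro!: continuous_at_imp_continuous_on differentiable_imp_continuous_within)
next
  case (Suc k)
  then have "u differentiable at x" if "x \<in> S" for x using that by simp
  moreover have "Ck_on k S (\<lambda>x. frechet_derivative u (at x) h)" for h
    using Suc.IH[of "\<lambda>x. frechet_derivative u (at x) h"] Suc.prems by simp
  ultimately show ?case by simp
qed

lemma Ck_on_SucI:
  assumes S: "open S" and der: "\<And>x. x \<in> S \<Longrightarrow> (u has_derivative D x) (at x)"
    and D: "\<And>h. Ck_on k S (\<lambda>x. D x h)"
  shows "Ck_on (Suc k) S u"
proof -
  have "Ck_on k S (\<lambda>x. frechet_derivative u (at x) h)" for h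
    by (rule Ck_on_cong[OF S _ D[of h]]) (use frechet_derivative_at[OF der] in auto)
  then show ?thesis using der by (auto simp: differentiable_def)
qed

lemma Ck_on_SucE:
  assumes "Ck_on (Suc k) S u"
  shows "x \<in> S \<Longrightarrow> (u has_derivative frechet_derivative u (at x)) (at x)"
    and "Ck_on k S (\<lambda>x. frechet_derivative u (at x) h)" "Ck_on k S u"
  using assms Ck_on_SucD[OF assms] by (auto simp: frechet_derivative_works)

lemma Ck_on_const: "open S \<Longrightarrow> Ck_on k S (\<lambda>x. c)"
proof (induction k arbitrary: c)
  case (Suc k)
  show ?case by (rule Ck_on_SucI[OF Suc.prems, where D = "\<lambda>x h. 0"]) (use Suc in auto)
qed simp

lemma Ck_on_linear:
  assumes "open S" "bounded_linear f"
  shows "Ck_on k S f"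
proof (cases k)
  case 0
  then show ?thesis using assms by (auto intro: linear_continuous_on)
next
  case (Suc m)
  show ?thesis unfolding Suc
    by (rule Ck_on_SucI[OF assms(1), where D = "\<lambda>x. f"])
       (use assms in \<open>auto intro: Ck_on_const bounded_linear_imp_has_derivative\<close>)
qed

lemma Ck_on_add:
  assumes "open S" "Ck_on k S u" "Ck_on k S v"
  shows "Ck_on k S (\<lambda>x. u x + v x)"
  using assms(2,3)
proof (induction k arbitrary: u v)
  case (Suc k)
  note u = Ck_on_SucE[OF Suc.prems(1)] and v = Ck_on_SucE[OF Suc.prems(2)]
  show ?case
    by (rule Ck_on_SucI[OF assms(1) has_derivative_add[OF u(1) v(1)]]) (auto intro: Suc.IH u v)
qed (simp add: continuous_on_add)

lemma Ck_on_mult: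
  assumes "open S" "Ck_on k S u" "Ck_on k S v"
  shows "Ck_on k S (\<lambda>x. u x * v x)"
  using assms(2,3)
proof (induction k arbitrary: u v)
  case (Suc k)
  note u = Ck_on_SucE[OF Suc.prems(1)] and v = Ck_on_SucE[OF Suc.prems(2)]
  show ?case
    by (rule Ck_on_SucI[OF assms(1) has_derivative_mult[OF u(1) v(1)]])
       (auto intro!: Ck_on_add[OF assms(1)] Suc.IH u v)
qed (simp add: continuous_on_mult)

lemma Ck_on_powr:
  assumes "open S" "Ck_on k S u" "\<And>x. x \<in> S \<Longrightarrow> u x > 0"
  shows "Ck_on k S (\<lambda>x. u x powr q)"
  using assms(2)
proof (induction k arbitrary: q)
  case 0
  then show ?case using assms(3) by (auto intro!: continuous_on_powr simp: less_imp_neq[THEN not_sym])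
next
  case (Suc k)
  note u = Ck_on_SucE[OF Suc.prems]
  show ?case
  proof (rule Ck_on_SucI[OF assms(1)])
    show "((\<lambda>x. u x powr q) has_derivative (\<lambda>h. frechet_derivative u (at x) h * (q * u x powr (q - 1)))) (at x)"
      if "x \<in> S" for x
      by (rule DERIV_compose_FDERIV[OF has_real_derivative_powr[OF assms(3)[OF that]] u(1)[OF that]])
    show "Ck_on k S (\<lambda>x. frechet_derivative u (at x) h * (q * u x powr (q - 1)))" for h
      by (intro Ck_on_mult assms(1) u Ck_on_const Suc.IH)
  qed
qed

lemma Ck_on_nth: "open S \<Longrightarrow> Ck_on k S (\<lambda>x :: real ^ 2. x $ i)"
  by (intro Ck_on_linear bounded_linear_vec_nth)

text \<open>Induction on the exponent through the real and imaginary parts of \<open>z z\<^sup>n\<close>, simultaneously.\<close>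

lemma Ck_on_complex_power:
  assumes S: "open (S :: (real ^ 2) set)"
  shows "Ck_on k S (\<lambda>x. Re (Complex (x $ 1) (x $ 2) ^ n))" "Ck_on k S (\<lambda>x. Im (Complex (x $ 1) (x $ 2) ^ n))"
proof (induction n)
  case 0
  { case 1 show ?case by (simp add: Ck_on_const[OF S]) }
  { case 2 show ?case by (simp add: Ck_on_const[OF S]) }
next
  case (Suc n)
  note c = Ck_on_mult[OF S Ck_on_nth[OF S]]
  { case 1
    have "Ck_on k S (\<lambda>x. x $ 1 * Re (Complex (x $ 1) (x $ 2) ^ n) + (-1) * (x $ 2 * Im (Complex (x $ 1) (x $ 2) ^ n)))"
      by (intro Ck_on_add[OF S] c Suc Ck_on_mult[OF S Ck_on_const[OF S]])
    then show ?case by simp }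
  { case 2
    have "Ck_on k S (\<lambda>x. x $ 1 * Im (Complex (x $ 1) (x $ 2) ^ n) + x $ 2 * Re (Complex (x $ 1) (x $ 2) ^ n))"
      by (intro Ck_on_add[OF S] c Suc)
    then show ?case by simp }
qed

lemma polar_nth [simp]: "polar r \<theta> $ 1 = r * cos \<theta>" "polar r \<theta> $ 2 = r * sin \<theta>"
  by (simp_all add: polar_def)

lemma norm_sq_2: "(norm (x :: real ^ 2))\<^sup>2 = (x $ 1)\<^sup>2 + (x $ 2)\<^sup>2"
  unfolding power2_norm_eq_inner inner_vec_def sum_2 by (simp add: power2_eq_square)

lemma norm_polar: "norm (polar r \<theta>) = \<bar>r\<bar>"
proof -
  have "(norm (polar r \<theta>))\<^sup>2 = r\<^sup>2 * ((cos \<theta>)\<^sup>2 + (sin \<theta>)\<^sup>2)"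
    unfolding norm_sq_2 by (simp add: power_mult_distrib distrib_left del: sin_cos_squared_add2)
  then have "(norm (polar r \<theta>))\<^sup>2 = \<bar>r\<bar>\<^sup>2" by simp
  then show ?thesis by (simp only: power2_eq_iff_nonneg norm_ge_zero abs_ge_zero)
qed

lemma polar_nonzero: "r \<noteq> 0 \<Longrightarrow> polar r \<theta> \<noteq> 0"
  using norm_polar[of r \<theta>] by auto

lemma polar_zero [simp]: "polar 0 \<theta> = 0"
  using norm_polar[of 0 \<theta>] by simp

lemma obtain_polar:
  assumes "x \<noteq> (0 :: real ^ 2)"
  obtains t \<theta> where "x = polar (exp t) \<theta>"
proof -
  have n: "norm x > 0" using assms by simp
  have "(x $ 1 / norm x)\<^sup>2 + (x $ 2 / norm x)\<^sup>2 = 1"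
    unfolding power_divide add_divide_distrib[symmetric] norm_sq_2[symmetric] using n by simp
  then obtain \<theta> where th: "x $ 1 / norm x = cos \<theta>" "x $ 2 / norm x = sin \<theta>"
    using sincos_total_2pi by blast
  then have "x $ 1 = norm x * cos \<theta>" "x $ 2 = norm x * sin \<theta>" using n by (auto simp: field_simps)
  then have "x = polar (norm x) \<theta>" unfolding vec_eq_iff forall_2 polar_nth by blast
  moreover have "exp (ln (norm x)) = norm x" using n by simp
  ultimately have "x = polar (exp (ln (norm x))) \<theta>" by (simp only:)
  then show ?thesis by (rule that)
qed

lemma polar_axes: "polar r \<theta> = (r * cos \<theta>) *\<^sub>R axis 1 1 + (r * sin \<theta>) *\<^sub>R axis 2 1"
  by (simp add: vec_eq_iff forall_2 axis_def)

lemma sum_Basis_real2: "(\<Sum>i\<in>(Basis :: (real ^ 2) set). f i) = f (axis 1 1) + f (axis 2 1)"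
proof -
  have B: "(Basis :: (real ^ 2) set) = {axis 1 1, axis 2 1}"
    by (auto simp: Basis_vec_def UNIV_2)
  have "axis 1 1 \<noteq> (axis 2 1 :: real ^ 2)" by (simp add: axis_eq_axis)
  then show ?thesis unfolding B by (subst sum.insert) auto
qed

lemma polar_chain:
  assumes "(f has_derivative D) (at (polar (exp t) \<theta>))"
  shows "((\<lambda>s. f (polar (exp s) \<theta>)) has_real_derivative
            exp t * cos \<theta> * D (axis 1 1) + exp t * sin \<theta> * D (axis 2 1)) (at t)"
    and "((\<lambda>s. f (polar (exp t) s)) has_real_derivative
            - (exp t * sin \<theta>) * D (axis 1 1) + exp t * cos \<theta> * D (axis 2 1)) (at \<theta>)"
proof -
  interpret D: bounded_linear D using assms by (rule has_derivative_bounded_linear)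
  have lin: "D (x *\<^sub>R axis 1 1 + y *\<^sub>R axis 2 1) = x * D (axis 1 1) + y * D (axis 2 1)" for x y
    by (simp add: D.add D.scaleR)
  have "((\<lambda>s. polar (exp s) \<theta>) has_vector_derivative
       (exp t * cos \<theta>) *\<^sub>R axis 1 1 + (exp t * sin \<theta>) *\<^sub>R axis 2 1) (at t)"
    unfolding polar_axes by (auto intro!: derivative_eq_intros)
  from vector_derivative_diff_chain_within[OF this, of f D] assms
  show "((\<lambda>s. f (polar (exp s) \<theta>)) has_real_derivative
            exp t * cos \<theta> * D (axis 1 1) + exp t * sin \<theta> * D (axis 2 1)) (at t)"
    unfolding has_real_derivative_iff_has_vector_derivative lin by (simp add: o_def has_derivative_at_withinI)
  have "((\<lambda>s. polar (exp t) s) has_vector_derivative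
       (- (exp t * sin \<theta>)) *\<^sub>R axis 1 1 + (exp t * cos \<theta>) *\<^sub>R axis 2 1) (at \<theta>)"
    unfolding polar_axes by (auto intro!: derivative_eq_intros simp: mult.commute)
  from vector_derivative_diff_chain_within[OF this, of f D] assms
  show "((\<lambda>s. f (polar (exp t) s)) has_real_derivative
            - (exp t * sin \<theta>) * D (axis 1 1) + exp t * cos \<theta> * D (axis 2 1)) (at \<theta>)"
    unfolding has_real_derivative_iff_has_vector_derivative lin by (simp add: o_def has_derivative_at_withinI)
qed

lemma polar_coordinates:
  assumes u: "Ck_on 2 (- {0}) u"
  obtains Ut Ux Utt Utx Uxx where "polar_partials u Ut Ux Utt Utx Uxx"
proof -
  define e1 e2 :: "real ^ 2" where "e1 = axis 1 1" and "e2 = axis 2 1"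
  define du where "du h x = frechet_derivative u (at x) h" for h x
  define ddu where "ddu h k x = frechet_derivative (du h) (at x) k" for h k x
  define P where "P t x = polar (exp t) x" for t x
  define c where "c t x = exp t * cos x" for t x :: real
  define s where "s t x = exp t * sin x" for t x :: real
  have C2: "Ck_on (Suc (Suc 0)) (- {0}) u" using u by (simp add: numeral_2_eq_2)
  note u1 = Ck_on_SucE[OF C2]
  have Du: "(u has_derivative (\<lambda>h. du h x)) (at x)" if "x \<noteq> 0" for x
    using u1(1)[of x] that by (simp add: du_def)
  have Ddu: "(du h has_derivative (\<lambda>k. ddu h k x)) (at x)" if "x \<noteq> 0" for h x
    using Ck_on_SucE(1)[OF u1(2)[of h], of x] that unfolding ddu_def du_def[abs_def] by simp
  have P0: "P t x \<noteq> 0" for t x by (simp add: P_def polar_nonzero)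
  have cP: "continuous_on A (\<lambda>z. P (fst z) (snd z))" for A
    unfolding P_def polar_axes by (intro continuous_intros)
  have cc: "continuous_on A (\<lambda>z. c (fst z) (snd z))" "continuous_on A (\<lambda>z. s (fst z) (snd z))" for A
    unfolding c_def s_def by (intro continuous_intros)+
  have cu: "continuous_on UNIV (\<lambda>z. f (P (fst z) (snd z)))" if "continuous_on (- {0}) f" for f
    by (rule continuous_on_compose2[OF that cP]) (use P0 in auto)
  have cu0: "continuous_on UNIV (\<lambda>z. u (P (fst z) (snd z)))"
    by (rule cu) (use u1(3) Ck_on_SucD[of 0] in auto)
  have cu1: "continuous_on UNIV (\<lambda>z. du h (P (fst z) (snd z)))" for h
    by (rule cu) (use u1(2)[of h] Ck_on_SucD[of 0] in \<open>auto simp: du_def[abs_def]\<close>)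
  have cu2: "continuous_on UNIV (\<lambda>z. ddu h k (P (fst z) (snd z)))" for h k
    by (rule cu) (use Ck_on_SucE(2)[OF u1(2)[of h], of k] in \<open>simp add: ddu_def du_def[abs_def]\<close>)
  have dP: "((\<lambda>r. f (P r x)) has_real_derivative c t x * D e1 + s t x * D e2) (at t)"
       "((\<lambda>y. f (P t y)) has_real_derivative - s t x * D e1 + c t x * D e2) (at x)"
    if "(f has_derivative D) (at (P t x))" for f D t x
    using polar_chain[of f D t x] that by (simp_all add: P_def c_def s_def e1_def e2_def)
  have dc: "((\<lambda>r. c r x) has_real_derivative c t x) (at t)" "((\<lambda>r. s r x) has_real_derivative s t x) (at t)"
    "(c t has_real_derivative - s t x) (at x)" "(s t has_real_derivative c t x) (at x)" for t x
    unfolding c_def[abs_def] s_def[abs_def] by (auto intro!: derivative_eq_intros)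
  define Ut where "Ut t x = c t x * du e1 (P t x) + s t x * du e2 (P t x)" for t x
  define Ux where "Ux t x = - s t x * du e1 (P t x) + c t x * du e2 (P t x)" for t x
  define Utt where "Utt t x = c t x * du e1 (P t x) + s t x * du e2 (P t x)
     + (c t x * (c t x * ddu e1 e1 (P t x) + s t x * ddu e1 e2 (P t x))
      + s t x * (c t x * ddu e2 e1 (P t x) + s t x * ddu e2 e2 (P t x)))" for t x
  define Uxt where "Uxt t x = - s t x * du e1 (P t x) + c t x * du e2 (P t x)
     + (- s t x * (c t x * ddu e1 e1 (P t x) + s t x * ddu e1 e2 (P t x))
      + c t x * (c t x * ddu e2 e1 (P t x) + s t x * ddu e2 e2 (P t x)))" for t x
  define Utx where "Utx t x = - s t x * du e1 (P t x) + c t x * du e2 (P t x)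
     + (c t x * (- s t x * ddu e1 e1 (P t x) + c t x * ddu e1 e2 (P t x))
      + s t x * (- s t x * ddu e2 e1 (P t x) + c t x * ddu e2 e2 (P t x)))" for t x
  define Uxx where "Uxx t x = - c t x * du e1 (P t x) - s t x * du e2 (P t x)
     + (- s t x * (- s t x * ddu e1 e1 (P t x) + c t x * ddu e1 e2 (P t x))
      + c t x * (- s t x * ddu e2 e1 (P t x) + c t x * ddu e2 e2 (P t x)))" for t x
  have 1: "((\<lambda>r. u (P r x)) has_real_derivative Ut t x) (at t)" for t x
    unfolding Ut_def by (rule dP(1)[OF Du[OF P0]])
  have 2: "((\<lambda>y. u (P t y)) has_real_derivative Ux t x) (at x)" for t x
    unfolding Ux_def by (rule dP(2)[OF Du[OF P0]])
  note dt = dP(1)[OF Ddu[OF P0]] and dx = dP(2)[OF Ddu[OF P0]]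
  have 3: "((\<lambda>r. Ut r x) has_real_derivative Utt t x) (at t)" for t x
    unfolding Ut_def Utt_def
    by (rule DERIV_cong[OF DERIV_add[OF DERIV_mult[OF dc(1) dt] DERIV_mult[OF dc(2) dt]]]) (simp add: algebra_simps)
  have 4: "((\<lambda>r. Ux r x) has_real_derivative Uxt t x) (at t)" for t x
    unfolding Ux_def Uxt_def
    by (rule DERIV_cong[OF DERIV_add[OF DERIV_mult[OF DERIV_minus[OF dc(2)] dt] DERIV_mult[OF dc(1) dt]]])
       (simp add: algebra_simps)
  have 5: "(Ut t has_real_derivative Utx t x) (at x)" for t x
    unfolding Ut_def[abs_def] Utx_def
    by (rule DERIV_cong[OF DERIV_add[OF DERIV_mult[OF dc(3) dx] DERIV_mult[OF dc(4) dx]]]) (simp add: algebra_simps)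
  have 6: "(Ux t has_real_derivative Uxx t x) (at x)" for t x
    unfolding Ux_def[abs_def] Uxx_def
    by (rule DERIV_cong[OF DERIV_add[OF DERIV_mult[OF DERIV_minus[OF dc(4)] dx] DERIV_mult[OF dc(3) dx]]])
       (simp add: algebra_simps)
  have cont: "cont2 (\<lambda>t x. u (P t x))" "cont2 Ut" "cont2 Ux" "cont2 Utt" "cont2 Uxt" "cont2 Uxx"
    unfolding cont2_def Ut_def Ux_def Utt_def Uxt_def Uxx_def
    by (intro continuous_intros cc cu0 cu1 cu2)+
  have mixed: "Utx t x = Uxt t x" for t x
    by (rule mixed_partials_eq[OF 1 2 4 5 cont(3,5)])
  have lap: "Utt t x + Uxx t x = exp (2 * t) * laplacian u (P t x)" for t x
  proof -
    have "laplacian u (P t x) = ddu e1 e1 (P t x) + ddu e2 e2 (P t x)"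
      unfolding laplacian_def sum_Basis_real2 ddu_def du_def[abs_def] e1_def e2_def by simp
    moreover have "(c t x)\<^sup>2 + (s t x)\<^sup>2 = exp (2 * t)"
    proof -
      have "(c t x)\<^sup>2 + (s t x)\<^sup>2 = (exp t)\<^sup>2 * ((cos x)\<^sup>2 + (sin x)\<^sup>2)"
        unfolding c_def s_def power_mult_distrib distrib_left ..
      then show ?thesis by (simp add: exp_double)
    qed
    moreover have "Utt t x + Uxx t x = ((c t x)\<^sup>2 + (s t x)\<^sup>2) * (ddu e1 e1 (P t x) + ddu e2 e2 (P t x))"
      by (simp add: Utt_def Uxx_def algebra_simps power2_eq_square)
    ultimately show ?thesis by simp
  qed
  show ?thesis
  proof (rule that)
    show "polar_partials u Ut Ux Utt Uxt Uxx"
      by standard (use 1 2 3 4 5 6 cont lap mixed in \<open>auto simp: P_def\<close>)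
  qed
qed

section \<open>Global solutions\<close>

text \<open>A primitive of \<open>mems_force\<close> on the positive axis; for \<open>p = 1\<close> the singular part is logarithmic.\<close>

definition mems_potential :: "real \<Rightarrow> real \<Rightarrow> real \<Rightarrow> real \<Rightarrow> real" where
  "mems_potential lam b p y = b\<^sup>2 * y\<^sup>2 / 2 - lam * (if p = 1 then ln y else y powr (1 - p) / (1 - p))"

text \<open>The density \<open>H\<close> of the cylinder equation for the force \<open>mems_force\<close>.\<close>

definition reduced_energy :: "real \<Rightarrow> real \<Rightarrow> real \<Rightarrow> real \<Rightarrow> real" where
  "reduced_energy lam b p y = mems_potential lam b p y - y * mems_force lam b p y / 2"

lemma mems_potential_deriv:
  assumes "y > 0"
  shows "(mems_potential lam b p has_real_derivative mems_force lam b p y) (at y)"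
proof (cases "p = 1")
  case True
  have "y powr (- 1) = inverse y" using assms by (simp add: powr_minus)
  then show ?thesis unfolding True mems_potential_def[abs_def] mems_force_def
    using assms by (auto intro!: derivative_eq_intros simp: field_simps)
next
  case False
  have "((\<lambda>y. y powr (1 - p) / (1 - p)) has_real_derivative (1 - p) * y powr (1 - p - 1) / (1 - p)) (at y)"
    by (intro DERIV_cdivide has_real_derivative_powr assms)
  then have d: "((\<lambda>y. y powr (1 - p) / (1 - p)) has_real_derivative y powr (- p)) (at y)"
    using False by simp
  have "((\<lambda>y. b\<^sup>2 * y\<^sup>2 / 2 - lam * (y powr (1 - p) / (1 - p))) has_real_derivative b\<^sup>2 * y - lam * y powr (- p)) (at y)"
    by (rule d refl derivative_eq_intros | simp)+
  then show ?thesis using False by (simp add: mems_potential_def[abs_def] mems_force_def)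
qed

lemma polar_periodic: "polar r (\<theta> + 2 * pi) = polar r \<theta>"
  by (simp add: polar_def)

text \<open>The exponent \<open>b\<close> is chosen so that the powers of \<open>r\<close> cancel: \<open>2 - b + \<alpha> = b p\<close>. The two-sided bound becomes
the range of the transformed solution.\<close>

lemma cylinder_form:
  fixes u :: "real ^ 2 \<Rightarrow> real"
  assumes sol: "global_solution lam \<alpha> p u" and bound: "two_sided_bound \<alpha> p u"
    and lam: "lam > 0" and al: "\<alpha> > -2" and p: "p > 0" and beta: "b = (\<alpha> + 2) / (p + 1)"
  obtains vt vx vtt vtx vxx c1 c2 where "c1 > 0"
    "damped_cylinder (\<lambda>t x. exp (- b * t) * u (polar (exp t) x)) vt vx vtt vtx vxx
       (mems_force lam b p) (mems_force' lam b p) (mems_potential lam b p) b c1 c2"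
proof -
  have b: "b > 0" using al p by (simp add: beta)
  have bp: "b * (p + 1) = \<alpha> + 2" using p by (simp add: beta)
  have C2: "Ck_on 2 (- {0}) u" and eq: "\<And>x. x \<noteq> 0 \<Longrightarrow> laplacian u x = lam * norm x powr \<alpha> / u x powr p"
    and pos: "\<And>x. x \<noteq> 0 \<Longrightarrow> u x > 0"
    using sol by (auto simp: global_solution_def)
  obtain c1 c2 where c: "0 < c1"
    "\<And>r \<theta>. r > 0 \<Longrightarrow> c1 \<le> r powr (- b) * u (polar r \<theta>) \<and> r powr (- b) * u (polar r \<theta>) \<le> c2"
    using bound unfolding two_sided_bound_def beta[symmetric] by blast
  define v where "v t x = exp (- b * t) * u (polar (exp t) x)" for t x
  have v_rng: "v t x \<in> {c1..c2}" for t x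
  proof -
    have "exp t powr (- b) = exp (- b * t)" by (simp add: exp_powr_real mult.commute)
    then show ?thesis using c(2)[of "exp t" x] by (simp add: v_def)
  qed
  obtain Ut Ux Utt Utx Uxx where "polar_partials u Ut Ux Utt Utx Uxx"
    by (rule polar_coordinates[OF C2]) (rule that)
  then interpret polar_partials u Ut Ux Utt Utx Uxx .
  define vt where "vt t x = exp (- b * t) * (Ut t x - b * u (polar (exp t) x))" for t x
  define vx where "vx t x = exp (- b * t) * Ux t x" for t x
  define vtt where "vtt t x = exp (- b * t) * (Utt t x - 2 * b * Ut t x + b\<^sup>2 * u (polar (exp t) x))" for t x
  define vtx where "vtx t x = exp (- b * t) * (Utx t x - b * Ux t x)" for t x
  define vxx where "vxx t x = exp (- b * t) * Uxx t x" for t x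
  have de: "((\<lambda>t. exp (- b * t)) has_real_derivative - b * exp (- b * t)) (at t)" for t
    by (auto intro!: derivative_eq_intros)
  have cyl: "damped_cylinder v vt vx vtt vtx vxx (mems_force lam b p) (mems_force' lam b p) (mems_potential lam b p) b c1 c2"
  proof
    fix t x y
    show "((\<lambda>s. v s x) has_real_derivative vt t x) (at t)"
      unfolding v_def vt_def
      by (rule DERIV_cong[OF DERIV_mult[OF de deriv_t]]) (simp add: algebra_simps)
    show "(v t has_real_derivative vx t x) (at x)"
      unfolding v_def[abs_def] vx_def by (intro DERIV_cmult deriv_x)
    show "((\<lambda>s. vt s x) has_real_derivative vtt t x) (at t)"
      unfolding vt_def vtt_def
      by (rule DERIV_cong[OF DERIV_mult[OF de DERIV_diff[OF deriv_tt DERIV_cmult[OF deriv_t]]]])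
         (simp add: algebra_simps power2_eq_square)
    show "((\<lambda>s. vx s x) has_real_derivative vtx t x) (at t)"
      unfolding vx_def vtx_def by (rule DERIV_cong[OF DERIV_mult[OF de deriv_xt]]) (simp add: algebra_simps)
    show "(vt t has_real_derivative vtx t x) (at x)"
      unfolding vt_def[abs_def] vtx_def by (intro DERIV_cmult DERIV_diff deriv_tx deriv_x)
    show "(vx t has_real_derivative vxx t x) (at x)"
      unfolding vx_def[abs_def] vxx_def by (intro DERIV_cmult deriv_xx)
    note cc = cont[unfolded cont2_def]
    show "cont2 v" "cont2 vt" "cont2 vx" "cont2 vtt" "cont2 vtx" "cont2 vxx"
      unfolding cont2_def v_def vt_def vx_def vtt_def vtx_def vxx_def by (intro continuous_intros cc)+
    show "v t (x + 2 * pi) = v t x" by (simp add: v_def polar_periodic)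
    show "b > 0" by (rule b)
    show "v t x \<in> {c1..c2}" by (rule v_rng)
    show "continuous_on {c1..c2} (mems_force' lam b p)"
      unfolding mems_force'_def[abs_def] using c(1) by (intro continuous_intros) auto
    show "vtt t x + 2 * b * vt t x + vxx t x + mems_force lam b p (v t x) = 0"
    proof -
      have P0: "polar (exp t) x \<noteq> 0" by (simp add: polar_nonzero)
      define U where "U = u (polar (exp t) x)"
      have U: "U > 0" using pos[OF P0] by (simp add: U_def)
      have "vtt t x + 2 * b * vt t x + vxx t x = exp (- b * t) * ((Utt t x + Uxx t x) - b\<^sup>2 * U)"
        by (simp add: vtt_def vt_def vxx_def U_def algebra_simps power2_eq_square)
      also have "Utt t x + Uxx t x = lam * (exp (2 * t) * (exp t powr \<alpha> / U powr p))"
        by (simp add: conformal eq[OF P0] norm_polar U_def)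
      finally have 1: "vtt t x + 2 * b * vt t x + vxx t x
          = lam * (exp (- b * t) * exp (2 * t) * exp t powr \<alpha> / U powr p) - b\<^sup>2 * (exp (- b * t) * U)"
        by (simp add: algebra_simps)
      have "exp (- b * t) * exp (2 * t) * exp t powr \<alpha> = exp (t * (\<alpha> + 2) - b * t)"
        by (simp add: exp_powr_real exp_add[symmetric] exp_diff algebra_simps)
      also have "\<dots> = exp (b * p * t)" unfolding bp[symmetric] by (simp add: algebra_simps)
      finally have 2: "exp (- b * t) * exp (2 * t) * exp t powr \<alpha> = exp (b * p * t)" .
      have "(exp (- b * t) * U) powr (- p) = exp (- b * t) powr (- p) * U powr (- p)"
        by (rule powr_mult)
      also have "exp (- b * t) powr (- p) = exp (b * p * t)"
        by (simp add: exp_powr_real mult_ac)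
      also have "exp (b * p * t) * U powr (- p) = exp (b * p * t) / U powr p"
        unfolding powr_minus divide_inverse ..
      finally show ?thesis unfolding 1 2 by (simp add: mems_force_def v_def U_def[symmetric])
    qed
    assume y: "y \<in> {c1..c2}"
    then have y0: "y > 0" using c(1) by simp
    show "(mems_potential lam b p has_real_derivative mems_force lam b p y) (at y)"
      by (rule mems_potential_deriv[OF y0])
    show "(mems_force lam b p has_real_derivative mems_force' lam b p y) (at y)"
      by (rule mems_force_deriv[OF y0])
  qed
  show ?thesis by (rule that[OF c(1) cyl[unfolded v_def[abs_def]]])
qed

text \<open>By \<open>stationary\<close> the transformed solution depends on the angle alone, and what remains of its equation is
the profile equation.\<close>

lemma global_solution_homogeneous:
  fixes u :: "real ^ 2 \<Rightarrow> real"
  assumes sol: "global_solution lam \<alpha> p u" and bound: "two_sided_bound \<alpha> p u"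
    and lam: "lam > 0" and al: "\<alpha> > -2" and p: "p > 0" and beta: "b = (\<alpha> + 2) / (p + 1)"
    and same: "\<And>w w' c1 c2. solves_ode (mems_force lam b p) w w' \<Longrightarrow> (\<And>x. w x \<in> {c1..c2}) \<Longrightarrow> c1 > 0 \<Longrightarrow>
       (\<And>x. w (x + 2 * pi) = w x) \<Longrightarrow>
       integral {0..2 * pi} (\<lambda>x. reduced_energy lam b p (w x)) = h"
  obtains w w' c1 c2 where "solves_ode (mems_force lam b p) w w'" "\<And>x. w x \<in> {c1..c2}" "c1 > 0"
    "\<And>x. w (x + 2 * pi) = w x" "\<And>t x. u (polar (exp t) x) = exp (b * t) * w x"
proof -
  obtain vt vx vtt vtx vxx c1 c2 where c1: "c1 > 0" and
    C: "damped_cylinder (\<lambda>t x. exp (- b * t) * u (polar (exp t) x)) vt vx vtt vtx vxx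
       (mems_force lam b p) (mems_force' lam b p) (mems_potential lam b p) b c1 c2"
    by (rule cylinder_form[OF sol bound lam al p beta]) (rule that)
  define v where "v t x = exp (- b * t) * u (polar (exp t) x)" for t x
  interpret damped_cylinder v vt vx vtt vtx vxx "mems_force lam b p" "mems_force' lam b p"
    "mems_potential lam b p" b c1 c2
    using C by (simp add: v_def[abs_def])
  have vt0: "vt t x = 0" for t x
    by (rule stationary[where h = h]) (unfold J_def H_def reduced_energy_def[symmetric], rule same[OF _ _ c1])
  have const: "v t x = v 0 x" for t x
    by (rule DERIV_isconst_all) (use vt[of x] vt0 in simp)
  have vtt0: "vtt t x = 0" for t x
    by (rule DERIV_unique[OF vtt[of x t, unfolded vt0] DERIV_const])
  have "solves_ode (mems_force lam b p) (v 0) (vx 0)"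
    unfolding solves_ode_def
  proof (intro allI conjI)
    fix x
    show "(v 0 has_real_derivative vx 0 x) (at x)" by (rule vx)
    have "vxx 0 x = - mems_force lam b p (v 0 x)" using eq[of 0 x] by (simp add: vt0 vtt0)
    then show "(vx 0 has_real_derivative - mems_force lam b p (v 0 x)) (at x)" using vxx[of 0 x] by simp
  qed
  moreover have "u (polar (exp t) x) = exp (b * t) * v 0 x" for t x
  proof -
    have "exp (b * t) * v t x = u (polar (exp t) x)" by (simp add: v_def exp_minus)
    then show ?thesis by (simp only: const[of t x])
  qed
  ultimately show ?thesis using that rng c1 per by blast
qed

lemma homogeneous_global_solution:
  fixes u :: "real ^ 2 \<Rightarrow> real"
  assumes C2: "Ck_on 2 (- {0}) u" and w: "solves_ode (mems_force lam b p) w w'"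
    and u: "\<And>t x. u (polar (exp t) x) = exp (b * t) * w x" and u0: "u 0 = 0"
    and rng: "\<And>x. w x \<in> {c1..c2}" and c1: "c1 > 0"
    and p: "p > 0" and beta: "b = (\<alpha> + 2) / (p + 1)"
  shows "global_solution lam \<alpha> p u \<and> two_sided_bound \<alpha> p u"
proof
  have bp: "b * (p + 1) = \<alpha> + 2" using p by (simp add: beta)
  have wpos: "w x > 0" for x using rng[of x] c1 by auto
  obtain Ut Ux Utt Utx Uxx where "polar_partials u Ut Ux Utt Utx Uxx"
    by (rule polar_coordinates[OF C2]) (rule that)
  then interpret polar_partials u Ut Ux Utt Utx Uxx .
  have de: "((\<lambda>t. exp (b * t)) has_real_derivative b * exp (b * t)) (at t)" for t
    by (auto intro!: derivative_eq_intros)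
  have "Ut t x = b * exp (b * t) * w x" for t x
    using DERIV_unique[OF deriv_t[unfolded u]] DERIV_cmult_right[OF de] by blast
  then have Ut: "Ut = (\<lambda>t x. b * exp (b * t) * w x)" by blast
  have Utt: "Utt t x = b * (b * exp (b * t)) * w x" for t x
    using DERIV_unique[OF deriv_tt[unfolded Ut]] DERIV_cmult_right[OF DERIV_cmult[OF de]] by blast
  have "Ux t x = exp (b * t) * w' x" for t x
    using DERIV_unique[OF deriv_x[unfolded u]] DERIV_cmult[OF solves_odeD(1)[OF w]] by blast
  then have Ux: "Ux = (\<lambda>t x. exp (b * t) * w' x)" by blast
  have Uxx: "Uxx t x = exp (b * t) * - mems_force lam b p (w x)" for t x
    using DERIV_unique[OF deriv_xx[unfolded Ux]] DERIV_cmult[OF solves_odeD(2)[OF w]] by blast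
  show "global_solution lam \<alpha> p u"
    unfolding global_solution_def
  proof (intro conjI allI impI C2 u0)
    fix z :: "real ^ 2" assume "z \<noteq> 0"
    then obtain t x where z: "z = polar (exp t) x" by (rule obtain_polar)
    show "u z > 0" unfolding z u using wpos by simp
    have "exp (2 * t) * laplacian u z = lam * (exp (b * t) * w x powr (- p))"
      unfolding z conformal[symmetric] Utt Uxx by (simp add: mems_force_def algebra_simps power2_eq_square)
    then have "laplacian u z = lam * (exp (b * t) / exp (2 * t)) * w x powr (- p)"
      by (simp add: field_simps)
    also have "exp (b * t) / exp (2 * t) = exp t powr \<alpha> * exp (b * t) powr (- p)"
    proof -
      have "b * t - 2 * t = t * (b - 2)" by (simp add: algebra_simps)
      also have "b - 2 = \<alpha> - b * p" using bp by (simp add: algebra_simps)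
      finally have *: "b * t - 2 * t = t * \<alpha> + b * t * (- p)" by (simp add: algebra_simps)
      show ?thesis unfolding exp_diff[symmetric] * exp_add exp_powr_real by simp
    qed
    also have "lam * (exp t powr \<alpha> * exp (b * t) powr (- p)) * w x powr (- p)
        = lam * exp t powr \<alpha> * (exp (b * t) * w x) powr (- p)"
      using wpos[of x] by (simp add: powr_mult)
    also have "\<dots> = lam * norm z powr \<alpha> / u z powr p"
      unfolding z u norm_polar by (simp add: powr_minus divide_inverse)
    finally show "laplacian u z = lam * norm z powr \<alpha> / u z powr p" .
  qed
  show "two_sided_bound \<alpha> p u"
    unfolding two_sided_bound_def beta[symmetric]
  proof (intro exI conjI allI impI)
    fix r \<theta> :: real assume r: "r > 0"
    have "r powr (- b) * u (polar r \<theta>) = w \<theta>"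
      using u[of "ln r" \<theta>] r by (simp add: powr_def exp_minus)
    then show "c1 \<le> r powr (- b) * u (polar r \<theta>)" "r powr (- b) * u (polar r \<theta>) \<le> c2"
      using rng[of \<theta>] by auto
  qed (rule c1)
qed

lemma sq_norm_pos: "x \<in> - {0} \<Longrightarrow> x $ 1 * x $ 1 + x $ 2 * x $ 2 > (0 :: real)" for x :: "real ^ 2"
  using norm_sq_2[of x] by (simp add: power2_eq_square) (metis mult_pos_pos zero_less_norm_iff)

lemma Ck_on_norm_powr: "Ck_on k (- {0}) (\<lambda>x :: real ^ 2. norm x powr q)"
proof -
  have o: "open (- {0 :: real ^ 2})" by (rule open_Compl) simp
  have "Ck_on k (- {0}) (\<lambda>x :: real ^ 2. (x $ 1 * x $ 1 + x $ 2 * x $ 2) powr (q / 2))"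
    by (intro Ck_on_powr Ck_on_add Ck_on_mult Ck_on_nth o sq_norm_pos)
  then show ?thesis
  proof (rule Ck_on_cong[OF o, rotated])
    fix x :: "real ^ 2" assume x: "x \<in> - {0}"
    have "(x $ 1 * x $ 1 + x $ 2 * x $ 2) powr (q / 2) = ((norm x)\<^sup>2) powr (q / 2)"
      unfolding norm_sq_2 by (simp add: power2_eq_square)
    also have "\<dots> = norm x powr q" using x by (simp add: powr_powr flip: powr_numeral)
    finally show "(x $ 1 * x $ 1 + x $ 2 * x $ 2) powr (q / 2) = norm x powr q" .
  qed
qed

text \<open>With \<open>n = 2 b\<close>, the double-angle formula turns the square of \<open>u\<close> into a constant multiple of a linear
combination \<open>q\<close> of \<open>|z|\<^sup>n\<close>, \<open>Re z\<^sup>n\<close> and \<open>Im z\<^sup>n\<close>; it is positive away from the origin, so its root is smooth there.\<close>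

lemma Ck_on_profile:
  fixes u :: "real ^ 2 \<Rightarrow> real"
  assumes \<epsilon>: "\<epsilon> > 0" and b: "2 * b = real n"
    and u: "\<And>t x. u (polar (exp t) x) = exp (b * t) * w_profile lam b \<epsilon> a x"
  shows "Ck_on k (- {0}) u"
proof -
  have o: "open (- {0 :: real ^ 2})" by (rule open_Compl) simp
  \<comment> \<open>\<open>\<epsilon> cos\<^sup>2 y + \<epsilon>\<^sup>-\<^sup>1 sin\<^sup>2 y = A + B cos (2 y)\<close> and \<open>2 y = n x + \<delta>\<close>\<close>
  define A where "A = (\<epsilon> + inverse \<epsilon>) / 2"
  define B where "B = (\<epsilon> - inverse \<epsilon>) / 2"
  define \<delta> where "\<delta> = 2 * b * a"
  define q where "q x = A * norm x powr real n +
     (B * cos \<delta> * Re (Complex (x $ 1) (x $ 2) ^ n) + - (B * sin \<delta>) * Im (Complex (x $ 1) (x $ 2) ^ n))" for x :: "real ^ 2"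
  have q: "q (polar (exp t) x) = exp (b * t) * exp (b * t) * (\<epsilon> * (cos (b * (x + a)))\<^sup>2 + inverse \<epsilon> * (sin (b * (x + a)))\<^sup>2)" for t x
  proof -
    define y where "y = b * (x + a)"
    have "Complex (exp t * cos x) (exp t * sin x) = rcis (exp t) x"
      by (simp add: complex_eq_iff)
    then have "Complex (exp t * cos x) (exp t * sin x) ^ n = rcis (exp t) x ^ n" by simp
    also have "\<dots> = rcis (exp t ^ n) (real n * x)" by (rule DeMoivre2)
    finally have z: "Complex (exp t * cos x) (exp t * sin x) ^ n = rcis (exp t ^ n) (real n * x)" .
    have e: "exp t powr real n = exp t ^ n" by (simp add: powr_realpow)
    have e2: "exp t ^ n = exp (b * t) * exp (b * t)"
      unfolding exp_of_nat_mult[symmetric] exp_add[symmetric] b[symmetric] by simp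
    have y2: "real n * x + \<delta> = 2 * y" unfolding b[symmetric] by (simp add: \<delta>_def y_def algebra_simps)
    have "q (polar (exp t) x) = exp t ^ n * (A + B * (cos (real n * x) * cos \<delta> - sin (real n * x) * sin \<delta>))"
      unfolding q_def polar_nth z Re_rcis Im_rcis norm_polar by (simp add: e algebra_simps)
    also have "cos (real n * x) * cos \<delta> - sin (real n * x) * sin \<delta> = cos (2 * y)"
      unfolding y2[symmetric] cos_add ..
    also have "A + B * cos (2 * y) = \<epsilon> * (cos y)\<^sup>2 + inverse \<epsilon> * (sin y)\<^sup>2"
      unfolding A_def B_def cos_double_cos by (simp add: sin_squared_eq algebra_simps add_divide_distrib diff_divide_distrib)
    finally show ?thesis by (simp add: e2 y_def)
  qed
  have qpos: "q x > 0" if "x \<in> - {0}" for x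
  proof -
    from that obtain t y where "x = polar (exp t) y" using obtain_polar by (metis ComplD singletonI)
    then show ?thesis using profile_pos[OF \<epsilon>] by (simp add: q)
  qed
  have "Ck_on k (- {0}) q"
    unfolding q_def
    by (intro Ck_on_add Ck_on_mult Ck_on_const Ck_on_norm_powr Ck_on_complex_power o)
  then have "Ck_on k (- {0}) (\<lambda>x. (lam / b\<^sup>2) powr (1 / 4) * q x powr (1 / 2))"
    by (intro Ck_on_mult Ck_on_const Ck_on_powr qpos o)
  then show ?thesis
  proof (rule Ck_on_cong[OF o, rotated])
    fix x :: "real ^ 2" assume "x \<in> - {0}"
    then obtain t y where x: "x = polar (exp t) y" using obtain_polar by (metis ComplD singletonI)
    have "q x powr (1 / 2) = sqrt (q x)"
      using qpos[OF \<open>x \<in> - {0}\<close>] by (simp add: powr_half_sqrt)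
    also have "sqrt (q x) = exp (b * t) * sqrt (\<epsilon> * (cos (b * (y + a)))\<^sup>2 + inverse \<epsilon> * (sin (b * (y + a)))\<^sup>2)"
      unfolding x q real_sqrt_mult by simp
    finally show "(lam / b\<^sup>2) powr (1 / 4) * q x powr (1 / 2) = u x"
      unfolding x u w_profile_def by simp
  qed
qed

theorem theorem1p4:
  fixes lam \<alpha> p \<beta> :: real
  assumes "lam > 0" and "\<alpha> > -2" and "p > 0" and "\<beta> = (\<alpha> + 2) / (p + 1)"
  shows "((\<alpha>, p) \<in> \<M> \<longrightarrow>
           (let U = (\<lambda>x :: real ^ 2. (lam / \<beta>\<^sup>2) powr (1 / (p + 1)) * norm x powr ((\<alpha> + 2) / (p + 1)))
            in global_solution lam \<alpha> p U \<and> two_sided_bound \<alpha> p U \<and>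
               (\<forall>u. global_solution lam \<alpha> p u \<and> two_sided_bound \<alpha> p u \<longrightarrow> u = U)))
       \<and> (p = 3 \<and> \<alpha> \<in> {2 * real k | k::nat. True} \<longrightarrow>
           (\<forall>u :: real ^ 2 \<Rightarrow> real.
              global_solution lam \<alpha> p u \<and> two_sided_bound \<alpha> p u \<longleftrightarrow>
              (\<exists>\<epsilon> \<in> {0<..1}. \<exists>a \<in> {0..<pi / \<beta>}. \<forall>r\<ge>0. \<forall>\<theta>.
                 u (polar r \<theta>) = r powr ((\<alpha> + 2) / (p + 1)) * w_profile lam \<beta> \<epsilon> a \<theta>)))"
proof (intro conjI impI)
  note lam = assms(1) and al = assms(2) and p = assms(3) and beta = assms(4)
  have b: "\<beta> > 0" using al p by (simp add: beta)
  {
    assume M: "(\<alpha>, p) \<in> \<M>"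
    define k where "k = (lam / \<beta>\<^sup>2) powr (1 / (p + 1))"
    define U where "U = (\<lambda>x :: real ^ 2. k * norm x powr \<beta>)"
    have k: "k > 0" using lam b by (simp add: k_def)
    have kp: "k powr (p + 1) = lam / \<beta>\<^sup>2" using lam b p by (simp add: k_def powr_powr)
    have "mems_force lam \<beta> p k = 0"
    proof -
      have "k powr p * k = lam / \<beta>\<^sup>2" using kp k by (simp add: powr_add)
      then show ?thesis using k b by (simp add: mems_force_def powr_minus field_simps)
    qed
    then have sk: "solves_ode (mems_force lam \<beta> p) (\<lambda>x. k) (\<lambda>x. 0)" by (simp add: solves_ode_def)
    have U: "global_solution lam \<alpha> p U \<and> two_sided_bound \<alpha> p U"
    proof (rule homogeneous_global_solution[OF _ sk, where ?c1.0 = k and ?c2.0 = k])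
      show "Ck_on 2 (- {0}) U"
        unfolding U_def by (intro Ck_on_mult Ck_on_const Ck_on_norm_powr open_Compl) auto
      show "U (polar (exp t) x) = exp (\<beta> * t) * k" for t x
        by (simp add: U_def norm_polar exp_powr_real mult.commute)
    qed (use k p beta in \<open>auto simp: U_def\<close>)
    have uniq: "u = U" if us: "global_solution lam \<alpha> p u" "two_sided_bound \<alpha> p u" for u
    proof -
      have wk: "w x = k"
        if "solves_ode (mems_force lam \<beta> p) w w'" "\<And>x. w x \<in> {c1..c2}" "c1 > 0" "\<And>x. w (x + 2 * pi) = w x"
        for w w' c1 c2 x
      proof -
        have "w y > 0" for y using that(2)[of y] that(3) by simp
        then show ?thesis unfolding k_def
          using steady_constant[OF M beta that(1,4,2,3) lam p al]
          by (intro steady_const_value[OF that(1) _ _ lam b p]) auto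
      qed
      define h where "h = integral {0..2 * pi} (\<lambda>x. reduced_energy lam \<beta> p k)"
      obtain w w' c1 c2 where w: "solves_ode (mems_force lam \<beta> p) w w'" "\<And>x. w x \<in> {c1..c2}" "c1 > 0"
        "\<And>x. w (x + 2 * pi) = w x" and u: "\<And>t x. u (polar (exp t) x) = exp (\<beta> * t) * w x"
      proof (rule global_solution_homogeneous[OF us lam al p beta, where h = h])
        show "integral {0..2 * pi} (\<lambda>x. reduced_energy lam \<beta> p (w x)) = h"
          if "solves_ode (mems_force lam \<beta> p) w w'" "\<And>x. w x \<in> {c1..c2}" "c1 > 0" "\<And>x. w (x + 2 * pi) = w x"
          for w w' c1 c2
          using wk[OF that] by (simp add: h_def)
      qed blast
      show "u = U"
      proof
        fix x
        show "u x = U x"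
        proof (cases "x = 0")
          case True
          then show ?thesis using us(1) by (simp add: U_def global_solution_def)
        next
          case False
          then obtain t y where x: "x = polar (exp t) y" by (rule obtain_polar)
          show ?thesis unfolding x u wk[OF w] by (simp add: U_def norm_polar exp_powr_real mult.commute)
        qed
      qed
    qed
    show "let U = (\<lambda>x :: real ^ 2. (lam / \<beta>\<^sup>2) powr (1 / (p + 1)) * norm x powr ((\<alpha> + 2) / (p + 1)))
            in global_solution lam \<alpha> p U \<and> two_sided_bound \<alpha> p U \<and>
               (\<forall>u. global_solution lam \<alpha> p u \<and> two_sided_bound \<alpha> p u \<longrightarrow> u = U)"
      unfolding Let_def beta[symmetric] k_def[symmetric] U_def[symmetric] using U uniq by blast
  }
  {
    assume "p = 3 \<and> \<alpha> \<in> {2 * real k | k::nat. True}"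
    then obtain k :: nat where p3: "p = 3" and al2: "\<alpha> = 2 * real k" by blast
    have b2: "2 * \<beta> = real (k + 1)" using al2 by (simp add: beta p3)
    then have b2i: "2 * \<beta> = of_int (int (k + 1))" by simp
    have H: "integral {0..2 * pi} (\<lambda>x. reduced_energy lam \<beta> p (w x))
        = lam / (lam / \<beta>\<^sup>2) powr (1 / 2) * (2 * pi)"
      if st: "solves_ode (mems_force lam \<beta> p) w w'" "\<And>x. w x \<in> {c1..c2}" "c1 > 0" "\<And>x. w (x + 2 * pi) = w x"
      for w w' c1 c2
    proof -
      obtain \<epsilon> a where e: "\<epsilon> \<in> {0<..1}" and w: "w = w_profile lam \<beta> \<epsilon> a"
        using steady_cubic_is_profile[OF st(1)[unfolded p3] st(4,2,3) lam b] by blast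
      have e0: "\<epsilon> > 0" using e by simp
      define N where "N x = \<epsilon> * (cos (\<beta> * (x + a)))\<^sup>2 + inverse \<epsilon> * (sin (\<beta> * (x + a)))\<^sup>2" for x
      have Npos: "N x > 0" for x unfolding N_def by (rule profile_pos[OF e0])
      have dens: "reduced_energy lam \<beta> p (w x)
          = lam / (lam / \<beta>\<^sup>2) powr (1 / 2) * (1 / N x)" for x
      proof -
        define y where "y = w x"
        have y: "y > 0" unfolding y_def w by (rule w_profile_pos[OF e0 lam b])
        have "y powr (- 2) = 1 / y\<^sup>2" "y powr (- 3) = 1 / y ^ 3"
          using y by (simp_all add: powr_minus divide_inverse)
        then have "mems_potential lam \<beta> p y = \<beta>\<^sup>2 * y\<^sup>2 / 2 + lam / y\<^sup>2 / 2"
          "mems_force lam \<beta> p y = \<beta>\<^sup>2 * y - lam / y ^ 3"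
          by (simp_all add: p3 mems_potential_def mems_force_def)
        then have "reduced_energy lam \<beta> p y = lam / y\<^sup>2"
          using y by (simp add: reduced_energy_def field_simps eval_nat_numeral)
        moreover have "y\<^sup>2 = (lam / \<beta>\<^sup>2) powr (1 / 2) * N x"
        proof -
          have "((lam / \<beta>\<^sup>2) powr (1 / 4))\<^sup>2 = (lam / \<beta>\<^sup>2) powr (1 / 2)"
            using lam b by (simp add: powr_power)
          then show ?thesis using Npos[of x]
            by (simp add: y_def w w_profile_def power_mult_distrib N_def[symmetric])
        qed
        ultimately show ?thesis by (simp add: y_def)
      qed
      show ?thesis
        unfolding dens N_def
        by (rule integral_unique) (rule has_integral_mult_right[OF has_integral_profile_inverse[OF e0 b b2i]])
    qed
    show "\<forall>u :: real ^ 2 \<Rightarrow> real.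
              global_solution lam \<alpha> p u \<and> two_sided_bound \<alpha> p u \<longleftrightarrow>
              (\<exists>\<epsilon> \<in> {0<..1}. \<exists>a \<in> {0..<pi / \<beta>}. \<forall>r\<ge>0. \<forall>\<theta>.
                 u (polar r \<theta>) = r powr ((\<alpha> + 2) / (p + 1)) * w_profile lam \<beta> \<epsilon> a \<theta>)"
      unfolding beta[symmetric]
    proof (intro allI iffI)
      fix u :: "real ^ 2 \<Rightarrow> real"
      assume "global_solution lam \<alpha> p u \<and> two_sided_bound \<alpha> p u"
      then have sol: "global_solution lam \<alpha> p u" "two_sided_bound \<alpha> p u" by blast+
      obtain w w' c1 c2 where w: "solves_ode (mems_force lam \<beta> p) w w'" "\<And>x. w x \<in> {c1..c2}" "c1 > 0"
        "\<And>x. w (x + 2 * pi) = w x" and u: "\<And>t x. u (polar (exp t) x) = exp (\<beta> * t) * w x"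
        by (rule global_solution_homogeneous[OF sol lam al p beta]) (rule H, assumption+, rule that)
      obtain \<epsilon> a where e: "\<epsilon> \<in> {0<..1}" "a \<in> {0..<pi / \<beta>}" and wp: "w = w_profile lam \<beta> \<epsilon> a"
        using steady_cubic_is_profile[OF w(1)[unfolded p3] w(4,2,3) lam b] by blast
      have "u (polar r \<theta>) = r powr \<beta> * w_profile lam \<beta> \<epsilon> a \<theta>" if "r \<ge> 0" for r \<theta>
      proof (cases "r = 0")
        case True
        then show ?thesis using sol(1) by (simp add: global_solution_def)
      next
        case False
        then show ?thesis using u[of "ln r" \<theta>] that by (simp add: wp powr_def)
      qed
      then show "\<exists>\<epsilon> \<in> {0<..1}. \<exists>a \<in> {0..<pi / \<beta>}. \<forall>r\<ge>0. \<forall>\<theta>.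
                 u (polar r \<theta>) = r powr \<beta> * w_profile lam \<beta> \<epsilon> a \<theta>"
        using e by blast
    next
      fix u :: "real ^ 2 \<Rightarrow> real"
      assume "\<exists>\<epsilon> \<in> {0<..1}. \<exists>a \<in> {0..<pi / \<beta>}. \<forall>r\<ge>0. \<forall>\<theta>.
                 u (polar r \<theta>) = r powr \<beta> * w_profile lam \<beta> \<epsilon> a \<theta>"
      then obtain \<epsilon> a where e01: "\<epsilon> \<in> {0<..1}"
        and u: "\<And>r \<theta>. r \<ge> 0 \<Longrightarrow> u (polar r \<theta>) = r powr \<beta> * w_profile lam \<beta> \<epsilon> a \<theta>" by blast
      from e01 have e: "\<epsilon> > 0" "\<epsilon> \<le> 1" by simp_all
      have u': "u (polar (exp t) x) = exp (\<beta> * t) * w_profile lam \<beta> \<epsilon> a x" for t x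
        using u[of "exp t" x] by (simp add: exp_powr_real mult.commute)
      show "global_solution lam \<alpha> p u \<and> two_sided_bound \<alpha> p u"
      proof (rule homogeneous_global_solution[OF Ck_on_profile[OF e(1) b2 u']
            w_profile_solves[OF e(1) lam b, folded p3] u' _ w_profile_range[OF e]])
        show "u 0 = 0" using u[of 0 0] by simp
        show "0 < (lam / \<beta>\<^sup>2) powr (1 / 4) * sqrt \<epsilon>" using e lam b by simp
      qed (use p beta in auto)
    qed
  }
qed

end
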